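(* Let $n\ge 2$ and $k\in[n]$. Let $P_k$ be the transition matrix on $S_n$ of the $k$-star transpositions shuffle: $$P_k(x,x\sigma)=\begin{cases}\frac1n,&\sigma=\mathrm{id},\\ \frac{n-1}{n}\cdot\frac{2}{k(2n-(k+1))},&\sigma=(i\ j)\text{ with }1\le i<j,\ n-k+1\le j\le n,\\ 0,&\text{otherwise}.\end{cases}$$ For a partition $\lambda$ of $n$ and a partition $\mu$ of $n-k$ with $\mu\subseteq\lambda$, set $$\mathrm{eig}(\lambda,\mu)=\frac1n+\frac{2(n-1)}{nk(2n-(k+1))}\big(\mathrm{Diag}(\lambda)-\mathrm{Diag}(\mu)\big).$$ Then the spectrum of $P_k$, counted with multiplicity, consists of the numbers $\mathrm{eig}(\lambda,\mu)$ over all such pairs $(\lambda,\mu)$, the pair $(\lambda,\mu)$ contributing $\mathrm{eig}(\lambda,\mu)$ with multiplicity $d_\lambda d_\mu d_{\lambda\setminus\mu}$.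
   Context: Partitions are identified with Young diagrams (rows indexed top to bottom from 1, columns left to right from 1); $\mu\subseteq\lambda$ means containment of diagrams, and the empty partition of $0$ is allowed (when $k=n$). $\mathrm{Diag}(\lambda)=\sum_{(i,j)\in\lambda}(j-i)$, the sum over boxes of the diagram. $d_\lambda$ is the number of standard Young tableaux of shape $\lambda$ (fillings with $1,\dots,|\lambda|$ increasing along rows and columns), with $d_\emptyset=1$. $d_{\lambda\setminus\mu}$ is the number of standard skew tableaux of the skew shape $\lambda/\mu$, i.e. fillings of the boxes of $\lambda$ not in $\mu$ with $1,\dots,k$, each once, increasing along rows and down columns. *)

theory Defs
  imports
    "Jordan_Normal_Form.Char_Poly"
    "HOL-Combinatorics.Permutations"
    "HOL-Library.FuncSet"
begin

text \<open>The elements of the symmetric group are the functions \<open>x\<close> on the naturals with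
  \<open>x permutes {1..n}\<close>; the product \<open>x\<sigma>\<close> is \<open>x \<circ> \<sigma>\<close>.\<close>

definition star_step :: "nat \<Rightarrow> nat \<Rightarrow> (nat \<Rightarrow> nat) \<Rightarrow> real" where
  "star_step n k \<sigma> =
    (if \<sigma> = id then 1 / real n
     else if \<exists>i j. 1 \<le> i \<and> i < j \<and> n - k + 1 \<le> j \<and> j \<le> n \<and> \<sigma> = transpose i j
       then (real n - 1) / real n * (2 / (real k * (2 * real n - (real k + 1))))
     else 0)"

text \<open>The matrix entry \<open>P\<^sub>k(x, y)\<close>: the unique \<open>\<sigma>\<close> with \<open>y = x\<sigma>\<close> is \<open>x\<inverse>y\<close>.\<close>

definition star_trans :: "nat \<Rightarrow> nat \<Rightarrow> (nat \<Rightarrow> nat) \<Rightarrow> (nat \<Rightarrow> nat) \<Rightarrow> real" where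
  "star_trans n k x y = star_step n k (inv_into UNIV x \<circ> y)"

text \<open>Matrices are indexed by natural numbers, so the transition matrix is written with respect to
  an enumeration \<open>e\<close> of the group. Its entries are taken as complex numbers so that its
  characteristic polynomial has all its roots.\<close>

definition star_matrix :: "nat \<Rightarrow> nat \<Rightarrow> (nat \<Rightarrow> nat \<Rightarrow> nat) \<Rightarrow> complex mat" where
  "star_matrix n k e =
    mat (fact n) (fact n) (\<lambda>(a, b). complex_of_real (star_trans n k (e a) (e b)))"

definition spectrum_mset :: "complex mat \<Rightarrow> complex multiset" where
  "spectrum_mset A = proots (char_poly A)"

text \<open>A partition is the weakly decreasing list of its positive parts, so \<open>[]\<close> is the only
  partition of \<open>0\<close>.\<close>

definition partition_of :: "nat \<Rightarrow> nat list \<Rightarrow> bool" where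
  "partition_of n p \<longleftrightarrow> sorted_wrt (\<ge>) p \<and> (\<forall>m\<in>set p. 0 < m) \<and> sum_list p = n"

definition diagram :: "nat list \<Rightarrow> (nat \<times> nat) set" where
  "diagram p = {(i, j). 1 \<le> i \<and> i \<le> length p \<and> 1 \<le> j \<and> j \<le> p ! (i - 1)}"

definition Diag :: "nat list \<Rightarrow> int" where
  "Diag p = (\<Sum>(i, j)\<in>diagram p. int j - int i)"

text \<open>Fillings of a set \<open>D\<close> of boxes are functions fixed to \<open>undefined\<close> outside \<open>D\<close>, so that
  distinct functions are distinct fillings.\<close>

definition standard_tableaux :: "(nat \<times> nat) set \<Rightarrow> (nat \<times> nat \<Rightarrow> nat) set" where
  "standard_tableaux D =
    {T \<in> extensional D.
      bij_betw T D {1..card D} \<and>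
      (\<forall>i j j'. (i, j) \<in> D \<longrightarrow> (i, j') \<in> D \<longrightarrow> j < j' \<longrightarrow> T (i, j) < T (i, j')) \<and>
      (\<forall>i i' j. (i, j) \<in> D \<longrightarrow> (i', j) \<in> D \<longrightarrow> i < i' \<longrightarrow> T (i, j) < T (i', j))}"

definition num_syt :: "nat list \<Rightarrow> nat" where
  "num_syt p = card (standard_tableaux (diagram p))"

definition num_skew_syt :: "nat list \<Rightarrow> nat list \<Rightarrow> nat" where
  "num_skew_syt p q = card (standard_tableaux (diagram p - diagram q))"

definition shape_pairs :: "nat \<Rightarrow> nat \<Rightarrow> (nat list \<times> nat list) set" where
  "shape_pairs n k =
    {(p, q). partition_of n p \<and> partition_of (n - k) q \<and> diagram q \<subseteq> diagram p}"

definition star_eig :: "nat \<Rightarrow> nat \<Rightarrow> nat list \<Rightarrow> nat list \<Rightarrow> real" where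
  "star_eig n k p q =
    1 / real n +
    2 * (real n - 1) / (real n * real k * (2 * real n - (real k + 1))) *
      real_of_int (Diag p - Diag q)"

text \<open>Sums over an infinite index set would be empty by convention.\<close>

lemma finite_partition_of: "finite {p. partition_of n p}"
proof (rule finite_subset)
  show "{p. partition_of n p} \<subseteq> {p. set p \<subseteq> {..n} \<and> length p \<le> n}"
  proof clarsimp
    fix p assume p: "partition_of n p"
    have "length p \<le> sum_list p" if "\<forall>m\<in>set p. 0 < m" for p :: "nat list"
      using that by (induction p) auto
    then show "set p \<subseteq> {..n} \<and> length p \<le> n"
      using p member_le_sum_list[of _ p] by (auto simp: partition_of_def)
  qed
qed (rule finite_lists_length_le, simp)

lemma finite_shape_pairs: "finite (shape_pairs n k)"
  by (rule finite_subset[of _ "{p. partition_of n p} \<times> {q. partition_of (n - k) q}"])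
    (auto simp: shape_pairs_def finite_partition_of)

end

theory Submission
  imports Defs
begin

text \<open>
  The sum of the transpositions \<open>(i j)\<close> with \<open>i < j\<close> is the Jucys--Murphy element of \<open>j\<close>, so \<open>P\<^sub>k\<close> is a
  combination of the identity and of the last \<open>k\<close> Jucys--Murphy elements, acting from the right on
  functions on the symmetric group. The argument of Okounkov and Vershik shows that the eigenvalues of
  a joint eigenfunction of all Jucys--Murphy elements are the contents, in order, of the boxes of a
  standard tableau. Consider joint eigenfunctions for the left and the right action, with tableaux
  \<open>S\<close> and \<open>T\<close>. Intertwiners move \<open>S\<close> to the row reading tableau and \<open>T\<close> to the column reading tableau,
  and then the function is invariant under a row group on one side and alternating under a column group
  on the other. Counting points in a grid shows that such a function exists only if \<open>S\<close> and \<open>T\<close> have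
  the same shape, and that it is then unique up to a scalar. Joint eigenfunctions span, as the
  operators commute and are symmetric, and there are \<open>\<Sum> d\<^sub>\<lambda>\<^sup>2 = n!\<close> pairs \<open>(S, T)\<close> of the same shape; so
  choosing one function for each pair gives an eigenbasis of \<open>P\<^sub>k\<close>, with eigenvalues determined by the
  contents of the last \<open>k\<close> boxes of \<open>T\<close>.

  A tableau is encoded as the word listing the rows, counted from 0, of its entries in increasing
  order; its shape is the function counting the letters.
\<close>

section \<open>Lattice words\<close>

text \<open>The right operators alone leave an eigenspace of dimension d_lambda for each tableau of
  shape lambda. The left operators commute with them and cut these spaces into lines, so
  multiplicities can be counted without constructing irreducible modules. The two reading orders are
  chosen for the signs. Consecutive boxes in a row have contents differing by 1, and there the swap
  of the two entries must act as 1; down a column the difference is -1 and the swap acts as -1. If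
  two points of a permutation share both a row and a column, the same transposition acts with both
  signs, and the function vanishes there. No nonzero function is exhibited for a given pair of
  tableaux. One possibly zero function is chosen for each of the n! pairs of equal shape; by
  completeness nothing nonzero is orthogonal to all of them, so the square matrix of the choices is
  invertible and none of them was zero. Complex numbers enter through the fundamental theorem of
  algebra, which yields joint eigenvectors; since the operators are real and symmetric, the
  eigenvalues are real and the argument returns to real functions.\<close>

definition inc :: "(nat \<Rightarrow> nat) \<Rightarrow> nat \<Rightarrow> nat \<Rightarrow> nat" where
  "inc f i = f(i := Suc (f i))"

definition dec :: "(nat \<Rightarrow> nat) \<Rightarrow> nat \<Rightarrow> nat \<Rightarrow> nat" where
  "dec f i = f(i := f i - 1)"

definition addable :: "(nat \<Rightarrow> nat) \<Rightarrow> nat set" where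
  "addable f = {i. i = 0 \<or> f i < f (i - 1)}"

definition removable :: "(nat \<Rightarrow> nat) \<Rightarrow> nat set" where
  "removable f = {i. f (Suc i) < f i}"

lemma count_list_snoc: "count_list (w @ [i]) = inc (count_list w) i"
  by (auto simp: inc_def)

lemma antimono_inc_iff:
  assumes "antimono f"
  shows "antimono (inc f i) \<longleftrightarrow> i \<in> addable f"
proof
  assume "antimono (inc f i)"
  then have "inc f i (Suc (i - 1)) \<le> inc f i (i - 1)"
    unfolding antimono_iff_le_Suc by blast
  then show "i \<in> addable f"
    by (cases i) (auto simp: inc_def addable_def)
next
  assume i: "i \<in> addable f"
  show "antimono (inc f i)"
    unfolding antimono_iff_le_Suc
  proof
    fix m
    have "f (Suc m) \<le> f m" using assms unfolding antimono_iff_le_Suc by blast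
    then show "inc f i (Suc m) \<le> inc f i m"
      using i by (auto simp: inc_def addable_def)
  qed
qed

lemma antimono_dec:
  assumes "antimono f" "i \<in> removable f"
  shows "antimono (dec f i)"
  unfolding antimono_iff_le_Suc
proof
  fix m
  have "f (Suc m) \<le> f m" using assms unfolding antimono_iff_le_Suc by blast
  then show "dec f i (Suc m) \<le> dec f i m"
    using assms(2) by (auto simp: dec_def removable_def)
qed

lemma inc_dec: "i \<in> removable f \<Longrightarrow> inc (dec f i) i = f"
  by (auto simp: inc_def dec_def removable_def)

lemma dec_inc [simp]: "dec (inc f i) i = f"
  by (auto simp: inc_def dec_def)

lemma inc_commute: "inc (inc f i) j = inc (inc f j) i"
  by (auto simp: inc_def)

lemma addable_dec:
  assumes "antimono f" "i \<in> removable f"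
  shows "i \<in> addable (dec f i)"
  using assms antimono_inc_iff[OF antimono_dec[OF assms], of i] by (simp add: inc_dec)

lemma addable_eq: "addable f = insert 0 (Suc ` removable f)"
  unfolding addable_def removable_def
proof (intro Set.set_eqI iffI)
  fix x assume "x \<in> {i. i = 0 \<or> f i < f (i - 1)}"
  then show "x \<in> insert 0 (Suc ` {i. f (Suc i) < f i})" by (cases x) auto
qed auto

lemma addable_inc:
  assumes "i \<in> addable f" "i \<noteq> j"
  shows "i \<in> addable (inc f j)"
  using assms by (auto simp: addable_def inc_def)

lemma addable_antimono_less:
  assumes "antimono f" "i \<in> addable f" "j < i"
  shows "f i < f j"
proof -
  have "f (i - 1) \<le> f j" using assms by (intro antimonoD[of f]) auto
  then show ?thesis using assms by (auto simp: addable_def)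
qed

text \<open>A path in Young's lattice starting at the shape \<open>f\<close>: for
  \<open>f = 0\<close> these are the ballot words of standard tableaux, for general \<open>f\<close>
  the words of skew tableaux. For \<open>m\<close> beyond the length, \<open>take m w\<close> is
  \<open>w\<close> itself.\<close>

definition lattice_from :: "(nat \<Rightarrow> nat) \<Rightarrow> nat list \<Rightarrow> bool" where
  "lattice_from f w \<longleftrightarrow> (\<forall>m. antimono (\<lambda>i. f i + count_list (take m w) i))"

abbreviation lattice_word :: "nat list \<Rightarrow> bool" where
  "lattice_word \<equiv> lattice_from (\<lambda>_. 0)"

lemma lattice_from_Nil [simp]: "lattice_from f [] \<longleftrightarrow> antimono f"
  by (simp add: lattice_from_def)

lemma lattice_from_antimono:
  assumes "lattice_from f w"
  shows "antimono (\<lambda>i. f i + count_list w i)"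
  using assms[unfolded lattice_from_def, rule_format, of "length w"] by simp

lemma lattice_word_antimono: "lattice_word w \<Longrightarrow> antimono (count_list w)"
  using lattice_from_antimono by fastforce

lemma lattice_from_append:
  "lattice_from f (u @ v) \<longleftrightarrow>
    lattice_from f u \<and> lattice_from (\<lambda>i. f i + count_list u i) v"
proof (intro iffI conjI)
  assume *: "lattice_from f (u @ v)"
  have **: "antimono (\<lambda>i. f i + count_list (take m (u @ v)) i)" for m
    using * by (simp add: lattice_from_def)
  show "lattice_from f u" unfolding lattice_from_def
  proof
    fix m show "antimono (\<lambda>i. f i + count_list (take m u) i)"
      using **[of "min m (length u)"] by (simp split: if_splits add: min_def)
  qed
  show "lattice_from (\<lambda>i. f i + count_list u i) v" unfolding lattice_from_def
  proof
    fix m show "antimono (\<lambda>i. f i + count_list u i + count_list (take m v) i)"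
      using **[of "length u + m"] by (simp add: add.assoc)
  qed
next
  assume *: "lattice_from f u \<and> lattice_from (\<lambda>i. f i + count_list u i) v"
  show "lattice_from f (u @ v)" unfolding lattice_from_def
  proof
    fix m
    show "antimono (\<lambda>i. f i + count_list (take m (u @ v)) i)"
      using *[unfolded lattice_from_def, THEN conjunct1, rule_format, of m]
        *[unfolded lattice_from_def, THEN conjunct2, rule_format, of "m - length u"]
      by (cases "m \<le> length u") (simp_all add: add.assoc)
  qed
qed

lemma lattice_from_single:
  "lattice_from f [i] \<longleftrightarrow> antimono f \<and> i \<in> addable f"
proof -
  have "lattice_from f [i] \<longleftrightarrow> antimono f \<and> antimono (inc f i)"
  proof -
    have eq: "(\<lambda>j. f j + count_list [i] j) = inc f i" by (auto simp: inc_def)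
    show ?thesis
      unfolding lattice_from_def
    proof (intro iffI conjI allI)
      assume *: "\<forall>m. antimono (\<lambda>j. f j + count_list (take m [i]) j)"
      show "antimono f" using *[rule_format, of 0] by simp
      show "antimono (inc f i)" using *[rule_format, of 1] eq by simp
    next
      fix m assume "antimono f \<and> antimono (inc f i)"
      then show "antimono (\<lambda>j. f j + count_list (take m [i]) j)"
        using eq by (cases m) simp_all
    qed
  qed
  then show ?thesis using antimono_inc_iff by blast
qed

lemma lattice_from_snoc:
  "lattice_from f (w @ [i]) \<longleftrightarrow>
    lattice_from f w \<and> i \<in> addable (\<lambda>j. f j + count_list w j)"
  using lattice_from_append lattice_from_single lattice_from_antimono by blast

lemma lattice_word_snoc:
  "lattice_word (w @ [i]) \<longleftrightarrow> lattice_word w \<and> i \<in> addable (count_list w)"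
  by (simp add: lattice_from_snoc)

lemma lattice_word_append:
  "lattice_word (u @ v) \<longleftrightarrow> lattice_word u \<and> lattice_from (count_list u) v"
  by (simp add: lattice_from_append)

lemma set_lattice_word:
  "lattice_word w \<Longrightarrow> set w \<subseteq> {..<length w}"
proof (induction w rule: rev_induct)
  case (snoc i w)
  then have w: "set w \<subseteq> {..<length w}" and i: "i \<in> addable (count_list w)"
    by (auto simp: lattice_word_snoc)
  have "i < Suc (length w)"
  proof (cases i)
    case (Suc j)
    then have "count_list w j \<noteq> 0" using i by (auto simp: addable_def)
    then have "j \<in> set w" by (simp add: count_list_0_iff)
    then show ?thesis using w Suc by auto
  qed simp
  then show ?case using w by auto
qed simp

definition lattice_words :: "nat \<Rightarrow> nat list set" where
  "lattice_words n = {w. lattice_word w \<and> length w = n}"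

lemma finite_lattice_words: "finite (lattice_words n)"
proof (rule finite_subset)
  show "lattice_words n \<subseteq> {w. set w \<subseteq> {..<n} \<and> length w = n}"
    using set_lattice_word by (auto simp: lattice_words_def)
qed (simp add: finite_lists_length_eq)

definition words_of :: "(nat \<Rightarrow> nat) \<Rightarrow> nat list set" where
  "words_of f = {w. lattice_word w \<and> count_list w = f}"

lemma count_list_eq_imp_mset: "count_list u = count_list v \<Longrightarrow> mset u = mset v"
  by (metis count_mset multiset_eqI)

lemma count_list_eq_imp_length: "count_list u = count_list v \<Longrightarrow> length u = length v"
  using count_list_eq_imp_mset mset_eq_length by blast

text \<open>Any corner of the shape can be made the last box. If \<open>w\<close> ends in another
  letter \<open>i\<close>, the corner was there before \<open>i\<close> was added, so the induction
  hypothesis rearranges the shorter word to end in \<open>j\<close>, and \<open>i\<close> is then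
  inserted before this \<open>j\<close>.\<close>

lemma removable_exchange:
  assumes "lattice_word w" "j \<in> removable (count_list w)"
  shows "\<exists>u. lattice_word (u @ [j]) \<and> count_list (u @ [j]) = count_list w"
  using assms
proof (induction w rule: rev_induct)
  case Nil
  then show ?case by (simp add: removable_def)
next
  case (snoc i w)
  show ?case
  proof (cases "i = j")
    case True
    then show ?thesis using snoc.prems by blast
  next
    case False
    have w: "lattice_word w" and i: "i \<in> addable (count_list w)"
      using snoc.prems by (auto simp: lattice_word_snoc)
    have j: "j \<in> removable (count_list w)"
      using snoc.prems(2) False
      by (auto simp: removable_def split: if_splits)
    obtain u where u: "lattice_word (u @ [j])" "count_list (u @ [j]) = count_list w"
      using snoc.IH[OF w j] by blast
    have u': "lattice_word u" using u by (simp add: lattice_word_snoc)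
    have c: "count_list u = dec (count_list w) j"
      using u(2) by (metis count_list_snoc dec_inc)
    have c2: "inc (count_list u) i = dec (count_list (w @ [i])) j"
      using False by (auto simp: c count_list_snoc inc_def dec_def)
    \<comment> \<open>That \<open>i\<close> may come before \<open>j\<close> is seen from the full
      shape: taking the corner \<open>j\<close> away from it leaves a partition.\<close>
    have "antimono (inc (count_list u) i)"
      unfolding c2 using snoc.prems lattice_word_antimono antimono_dec by blast
    then have ui: "lattice_word (u @ [i])"
      using u' antimono_inc_iff[OF lattice_word_antimono[OF u']] lattice_word_snoc by blast
    have cc: "count_list ((u @ [i]) @ [j]) = count_list (w @ [i])"
      using u(2) by (simp only: count_list_snoc inc_commute[of _ i j])
    have "j \<in> addable (count_list (u @ [i]))"
      using u(1) addable_inc False by (metis count_list_snoc lattice_word_snoc)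
    then have "lattice_word ((u @ [i]) @ [j])" using ui lattice_word_snoc by blast
    then show ?thesis using cc by blast
  qed
qed

text \<open>Being reached by a lattice word of length \<open>n\<close> encodes weak decrease, finite
  support and size \<open>n\<close> at once; \<open>removable_exchange\<close> makes the notion
  stable under removing a corner.\<close>

definition shape :: "nat \<Rightarrow> (nat \<Rightarrow> nat) \<Rightarrow> bool" where
  "shape n f \<longleftrightarrow> (\<exists>w. lattice_word w \<and> length w = n \<and> count_list w = f)"

lemma shape_antimono: "shape n f \<Longrightarrow> antimono f"
  using lattice_word_antimono by (auto simp: shape_def)

lemma shape_inc: "shape n f \<Longrightarrow> i \<in> addable f \<Longrightarrow> shape (Suc n) (inc f i)"
  unfolding shape_def by (metis count_list_snoc lattice_word_snoc length_append_singleton)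

lemma shape_dec:
  assumes "shape n f" "i \<in> removable f"
  shows "n > 0 \<and> shape (n - 1) (dec f i)"
proof -
  obtain w where w: "lattice_word w" "length w = n" "count_list w = f"
    using assms by (auto simp: shape_def)
  obtain u where u: "lattice_word (u @ [i])" "count_list (u @ [i]) = f"
    using removable_exchange[of w i] w assms by blast
  have "length (u @ [i]) = n"
    using count_list_eq_imp_length[of "u @ [i]" w] u w by argo
  moreover have "count_list u = dec f i"
    using u(2) by (metis count_list_snoc dec_inc)
  ultimately show ?thesis using u(1) unfolding shape_def lattice_word_snoc by force
qed

lemma finite_removable: "shape n f \<Longrightarrow> finite (removable f)"
proof -
  assume "shape n f"
  then obtain w where "count_list w = f" by (auto simp: shape_def)
  then have "removable f \<subseteq> set w" 
    by (metis (mono_tags, lifting) count_list_0_iff mem_Collect_eq not_less_zero removable_def subsetI)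
  then show ?thesis using finite_subset by blast
qed

lemma finite_words_of: "finite (words_of f)"
proof (cases "words_of f = {}")
  case False
  then obtain w where "w \<in> words_of f" by blast
  then have "words_of f \<subseteq> lattice_words (length w)"
    by (auto simp: words_of_def lattice_words_def dest: count_list_eq_imp_length)
  then show ?thesis using finite_lattice_words finite_subset by blast
qed simp

lemma words_of_decomp:
  assumes "shape (Suc n) f"
  shows "words_of f = (\<Union>j\<in>removable f. (\<lambda>u. u @ [j]) ` words_of (dec f j))"
proof (intro Set.set_eqI iffI)
  fix w assume w: "w \<in> words_of f"
  have "length w = Suc n"
    using assms w by (force simp: shape_def words_of_def dest: count_list_eq_imp_length)
  then obtain u j where uj: "w = u @ [j]" by (cases w rule: rev_cases) auto
  then have f: "f = inc (count_list u) j" and u: "lattice_word u"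
    using w count_list_snoc by (auto simp: words_of_def lattice_word_snoc)
  have "count_list u (Suc j) \<le> count_list u j"
    using lattice_word_antimono[OF u] unfolding antimono_iff_le_Suc by blast
  then have "j \<in> removable f" by (auto simp: f removable_def inc_def)
  moreover have "u \<in> words_of (dec f j)" using f u by (simp add: words_of_def)
  ultimately show "w \<in> (\<Union>j\<in>removable f. (\<lambda>u. u @ [j]) ` words_of (dec f j))"
    using uj by blast
next
  fix w assume "w \<in> (\<Union>j\<in>removable f. (\<lambda>u. u @ [j]) ` words_of (dec f j))"
  then obtain j u where j: "j \<in> removable f" and w: "w = u @ [j]"
    and u: "lattice_word u" "count_list u = dec f j"
    by (auto simp: words_of_def)
  have "lattice_word w"
    using u w addable_dec[OF shape_antimono[OF assms] j] by (simp add: lattice_word_snoc)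
  moreover have "count_list w = f"
    by (simp only: w count_list_snoc u inc_dec[OF j])
  ultimately show "w \<in> words_of f" by (simp add: words_of_def)
qed

lemma card_words_of:
  assumes "shape (Suc n) f"
  shows "card (words_of f) = (\<Sum>j\<in>removable f. card (words_of (dec f j)))"
proof -
  have "card (words_of f) = (\<Sum>j\<in>removable f. card ((\<lambda>u. u @ [j]) ` words_of (dec f j)))"
    unfolding words_of_decomp[OF assms]
    by (rule card_UN_disjoint)
      (use finite_removable[OF assms] finite_words_of in auto)
  also have "\<dots> = (\<Sum>j\<in>removable f. card (words_of (dec f j)))"
    by (intro sum.cong refl card_image) (auto intro: inj_onI)
  finally show ?thesis .
qed

section \<open>Adding and removing boxes in Young's lattice\<close>

lemma inc_in_removable:
  "antimono f \<Longrightarrow> i \<in> removable (inc f i)"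
  by (auto simp: removable_def inc_def antimono_iff_le_Suc less_Suc_eq_le)

text \<open>Adding a box in row \<open>i\<close> and removing one in row \<open>j\<close> interfere
  only if \<open>i = Suc j\<close>; then either order requires row \<open>j\<close> to exceed row
  \<open>i\<close> by at least two.\<close>

lemma inc_dec_exchange_iff:
  assumes "antimono f" "i \<noteq> j"
  shows "i \<in> addable f \<and> j \<in> removable (inc f i) \<longleftrightarrow> j \<in> removable f \<and> i \<in> addable (dec f j)"
proof
  assume *: "i \<in> addable f \<and> j \<in> removable (inc f i)"
  then have j: "inc f i (Suc j) < inc f i j" and i: "i = 0 \<or> f i < f (i - 1)"
    by (simp_all add: removable_def addable_def)
  have *: "f (Suc j) \<le> inc f i (Suc j)" "inc f i j = f j"
    using assms(2) by (simp_all add: inc_def)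
  then have "j \<in> removable f"
    using j by (simp add: removable_def)
  moreover have "i \<in> addable (dec f j)"
  proof (cases "i = Suc j")
    case True
    then show ?thesis using i j by (simp add: addable_def inc_def dec_def)
  next
    case False
    then have "i = 0 \<or> i - 1 \<noteq> j" by arith
    then show ?thesis using i assms(2) by (auto simp: addable_def dec_def)
  qed
  ultimately show "j \<in> removable f \<and> i \<in> addable (dec f j)" by blast
next
  assume *: "j \<in> removable f \<and> i \<in> addable (dec f j)"
  then have j: "f (Suc j) < f j" and i: "i = 0 \<or> dec f j i < dec f j (i - 1)"
    by (simp_all add: removable_def addable_def)
  have "dec f j (i - 1) \<le> f (i - 1)" "dec f j i = f i"
    using assms(2) by (simp_all add: dec_def)
  then have "i \<in> addable f"
    using i by (fastforce simp: addable_def)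
  moreover have "j \<in> removable (inc f i)"
  proof (cases "i = Suc j")
    case True
    then show ?thesis using i j assms(2) by (simp add: removable_def inc_def dec_def)
  next
    case False
    then show ?thesis using j assms(2) by (simp add: removable_def inc_def)
  qed
  ultimately show "i \<in> addable f \<and> j \<in> removable (inc f i)" by blast
qed

text \<open>Young's lattice is a differential poset: going up and then down exceeds going down and
  then up by one, as a shape has one more addable than removable box.\<close>

lemma sum_card_words_of_inc:
  "shape n f \<Longrightarrow> (\<Sum>i\<in>addable f. card (words_of (inc f i))) = Suc n * card (words_of f)"
proof (induction n arbitrary: f)
  case 0
  then have f: "f = (\<lambda>_. 0)" by (auto simp: shape_def)
  have a: "addable f = {0}" by (auto simp: f addable_def)
  have s1: "shape (Suc 0) (inc f 0)" using shape_inc[OF 0, of 0] a by simp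
  have r: "removable (inc f 0) = {0}" by (auto simp: removable_def f inc_def split: if_splits)
  show ?case using card_words_of[OF s1] by (simp add: a r)
next
  case (Suc n)
  let ?d = "\<lambda>g. card (words_of g)"
  note sh = Suc.prems
  have am: "antimono f" using shape_antimono sh by blast
  have finR: "finite (removable f)" using finite_removable sh by blast
  then have finA: "finite (addable f)" by (simp add: addable_eq)
  have cardA: "card (addable f) = Suc (card (removable f))"
    using finR by (simp add: addable_eq card_image card_insert_if)
  have finR': "finite (removable (inc f i))" if "i \<in> addable f" for i
    using finite_removable shape_inc sh that by blast
  have finA': "finite (addable (dec f j))" if "j \<in> removable f" for j
    using finite_removable shape_dec[OF sh] that by (auto simp: addable_eq)
  \<comment> \<open>The box just added can be removed again, which gives the diagonal term
    \<open>?d f\<close>. The off-diagonal pairs are left to be matched with those of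
    \<open>down\<close>.\<close>
  have up: "?d (inc f i) = ?d f + (\<Sum>j\<in>removable (inc f i) - {i}. ?d (dec (inc f i) j))"
    if i: "i \<in> addable f" for i
    using card_words_of[OF shape_inc[OF sh i]] finR'[OF i] inc_in_removable[OF am, of i]
    by (simp add: sum.remove)
  have down: "(\<Sum>i\<in>addable (dec f j) - {j}. ?d (inc (dec f j) i)) + ?d f = Suc n * ?d (dec f j)"
    if j: "j \<in> removable f" for j
  proof -
    have "shape n (dec f j)" using shape_dec[OF sh j] by simp
    from Suc.IH[OF this] show ?thesis
      using sum.remove[OF finA'[OF j] addable_dec[OF am j], of "\<lambda>i. ?d (inc (dec f j) i)"]
      by (simp add: inc_dec[OF j])
  qed
  have swap: "(\<Sum>i\<in>addable f. \<Sum>j\<in>removable (inc f i) - {i}. ?d (dec (inc f i) j))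
      = (\<Sum>j\<in>removable f. \<Sum>i\<in>addable (dec f j) - {j}. ?d (inc (dec f j) i))"
  proof -
    have "(\<Sum>i\<in>addable f. \<Sum>j\<in>removable (inc f i) - {i}. ?d (dec (inc f i) j))
        = (\<Sum>(i, j)\<in>(SIGMA i:addable f. removable (inc f i) - {i}). ?d (dec (inc f i) j))"
      by (rule sum.Sigma) (use finA finR' in auto)
    also have "\<dots> = (\<Sum>(j, i)\<in>(SIGMA j:removable f. addable (dec f j) - {j}). ?d (inc (dec f j) i))"
    proof (rule sum.reindex_bij_witness[of _ prod.swap prod.swap], goal_cases)
      case (2 a)
      then show ?case using inc_dec_exchange_iff[OF am, of "fst a" "snd a"]
        by (cases a) auto
    next
      case (4 b)
      then show ?case using inc_dec_exchange_iff[OF am, of "snd b" "fst b"]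
        by (cases b) auto
    next
      case (5 a)
      then have "inc (dec f (snd a)) (fst a) = dec (inc f (fst a)) (snd a)"
        by (auto simp: inc_def dec_def fun_eq_iff)
      then show ?case by (cases a) simp
    qed auto
    also have "\<dots> = (\<Sum>j\<in>removable f. \<Sum>i\<in>addable (dec f j) - {j}. ?d (inc (dec f j) i))"
      by (rule sum.Sigma[symmetric]) (use finR finA' in auto)
    finally show ?thesis .
  qed
  have "(\<Sum>i\<in>addable f. ?d (inc f i)) = card (addable f) * ?d f
      + (\<Sum>j\<in>removable f. \<Sum>i\<in>addable (dec f j) - {j}. ?d (inc (dec f j) i))"
    using up by (simp add: sum.distrib swap)
  also have "\<dots> = ?d f + (\<Sum>j\<in>removable f.
      (\<Sum>i\<in>addable (dec f j) - {j}. ?d (inc (dec f j) i)) + ?d f)"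
    by (simp add: cardA sum.distrib)
  also have "\<dots> = ?d f + Suc n * ?d f"
  proof -
    have "(\<Sum>j\<in>removable f. (\<Sum>i\<in>addable (dec f j) - {j}. ?d (inc (dec f j) i)) + ?d f)
        = (\<Sum>j\<in>removable f. Suc n * ?d (dec f j))"
      by (intro sum.cong refl down)
    then show ?thesis by (simp only: card_words_of[OF sh] sum_distrib_left)
  qed
  finally show ?case by simp
qed

section \<open>Pairs of tableaux of the same shape\<close>

definition word_pairs :: "nat \<Rightarrow> (nat list \<times> nat list) set" where
  "word_pairs n = {(u, v). u \<in> lattice_words n \<and> v \<in> lattice_words n \<and>
    count_list u = count_list v}"

lemma finite_word_pairs: "finite (word_pairs n)"
  by (rule finite_subset[of _ "lattice_words n \<times> lattice_words n"])
    (auto simp: word_pairs_def finite_lattice_words)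

lemma card_word_pairs_eq_sum:
  "card (word_pairs n) = (\<Sum>u\<in>lattice_words n. card (words_of (count_list u)))"
proof -
  have "word_pairs n = (SIGMA u:lattice_words n. words_of (count_list u))"
    by (auto simp: word_pairs_def words_of_def lattice_words_def
        dest: count_list_eq_imp_length[OF sym])
  then show ?thesis by (simp add: finite_lattice_words finite_words_of)
qed

text \<open>Splitting off the last letter of the first word turns the count for \<open>Suc n\<close>
  into sums over addable rows; by \<open>sum_card_words_of_inc\<close> each of them contributes the
  factor \<open>Suc n\<close>.\<close>

lemma card_word_pairs: "card (word_pairs n) = fact n"
proof (induction n)
  case 0
  have "lattice_words 0 = {[]}" by (auto simp: lattice_words_def antimono_def)
  moreover have "words_of (count_list []) = {[]}"
    by (auto simp: words_of_def antimono_def dest: count_list_eq_imp_length)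
  ultimately show ?case by (simp add: card_word_pairs_eq_sum)
next
  case (Suc n)
  have fin: "finite (addable (count_list u))" if "u \<in> lattice_words n" for u
    using that finite_removable[of n] by (auto simp: addable_eq shape_def lattice_words_def)
  have dec: "lattice_words (Suc n) =
      (\<lambda>(u, i). u @ [i]) ` (SIGMA u:lattice_words n. addable (count_list u))"
  proof (intro Set.set_eqI iffI)
    fix w assume w: "w \<in> lattice_words (Suc n)"
    then obtain u i where ui: "w = u @ [i]"
      by (cases w rule: rev_cases) (auto simp: lattice_words_def)
    then show "w \<in> (\<lambda>(u, i). u @ [i]) ` (SIGMA u:lattice_words n. addable (count_list u))"
      using w by (force simp: lattice_words_def lattice_word_snoc)
  qed (auto simp: lattice_words_def lattice_word_snoc)
  have "card (word_pairs (Suc n)) =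
      (\<Sum>(u, i)\<in>(SIGMA u:lattice_words n. addable (count_list u)).
        card (words_of (count_list (u @ [i]))))"
    unfolding card_word_pairs_eq_sum dec
    by (subst sum.reindex) (auto intro!: inj_onI sum.cong)
  also have "\<dots> = (\<Sum>u\<in>lattice_words n. \<Sum>i\<in>addable (count_list u).
        card (words_of (inc (count_list u) i)))"
    unfolding count_list_snoc
    by (rule sum.Sigma[symmetric]) (use finite_lattice_words fin in auto)
  also have "\<dots> = (\<Sum>u\<in>lattice_words n. Suc n * card (words_of (count_list u)))"
    by (intro sum.cong refl sum_card_words_of_inc) (auto simp: shape_def lattice_words_def)
  also have "\<dots> = fact (Suc n)"
    using Suc.IH unfolding card_word_pairs_eq_sum
    by (simp only: sum_distrib_left[symmetric] fact_Suc of_nat_id)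
  finally show ?case .
qed

section \<open>Columns and contents of the boxes of a tableau\<close>

definition box_col :: "nat list \<Rightarrow> nat \<Rightarrow> nat" where
  "box_col w m = count_list (take m w) (w ! m)"

definition box_content :: "nat list \<Rightarrow> nat \<Rightarrow> real" where
  "box_content w m = real (box_col w m) - real (w ! m)"

definition cells :: "(nat \<Rightarrow> nat) \<Rightarrow> (nat \<times> nat) set" where
  "cells f = {(i, j). j < f i}"

lemma box_col_append: "m < length u \<Longrightarrow> box_col (u @ v) m = box_col u m"
  by (simp add: box_col_def nth_append)

lemma box_content_append: "m < length u \<Longrightarrow> box_content (u @ v) m = box_content u m"
  by (simp add: box_content_def box_col_append nth_append)

lemma box_col_snoc_length [simp]: "box_col (u @ [i]) (length u) = count_list u i"
  by (simp add: box_col_def)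

lemma box_content_snoc_length [simp]:
  "box_content (u @ [i]) (length u) = real (count_list u i) - real i"
  by (simp add: box_content_def)

lemma cells_inc: "cells (inc f i) = insert (i, f i) (cells f)"
  by (auto simp: cells_def inc_def split: if_splits)

text \<open>A letter puts its box at the end of its row, so the number of earlier equal letters is
  the column of the box, counted from 0, and each cell is filled exactly once.\<close>

lemma bij_betw_box:
  "bij_betw (\<lambda>m. (w ! m, box_col w m)) {..<length w} (cells (count_list w))"
proof (induction w rule: rev_induct)
  case Nil
  then show ?case by (simp add: cells_def bij_betw_def)
next
  case (snoc i w)
  have 1: "bij_betw (\<lambda>m. ((w @ [i]) ! m, box_col (w @ [i]) m)) {..<length w} (cells (count_list w))"
    using snoc.IH by (rule bij_betw_cong[THEN iffD1, rotated]) (simp add: nth_append box_col_append)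
  have "bij_betw (\<lambda>m. ((w @ [i]) ! m, box_col (w @ [i]) m)) ({..<length w} \<union> {length w})
      (cells (count_list w) \<union> {((w @ [i]) ! length w, box_col (w @ [i]) (length w))})"
    by (rule notIn_Un_bij_betw[OF _ _ 1]) (auto simp: cells_def)
  then show ?case
    unfolding count_list_snoc cells_inc by (simp add: lessThan_Suc)
qed

lemma box_col_less_count: "m < length w \<Longrightarrow> box_col w m < count_list w (w ! m)"
  using bij_betw_apply[OF bij_betw_box[of w], of m] by (simp add: cells_def)

text \<open>Passing to a lower addable row costs at least one column and at least one row. The gap 2
  keeps content differences away from 0, 1 and -1, the values at which intertwiners are undefined or
  may fail to be injective.\<close>

lemma addable_content_less:
  assumes "antimono f" "i \<in> addable f" "j \<in> addable f" "i < j"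
  shows "real (f j) - real j + 2 \<le> real (f i) - real i"
  using addable_antimono_less[OF assms(1,3,4)] assms(4) by linarith

lemma addable_content_inj:
  assumes "antimono f" "i \<in> addable f" "j \<in> addable f"
    and "real (f j) - real j = real (f i) - real i"
  shows "i = j"
proof (rule ccontr)
  assume "i \<noteq> j"
  then consider "i < j" | "j < i" by linarith
  then show False
    using addable_content_less[OF assms(1,2,3)] addable_content_less[OF assms(1,3,2)] assms(4)
    by cases linarith+
qed

lemma addable_content_diff:
  assumes "antimono f" "i \<in> addable f" "j \<in> addable f" "i \<noteq> j"
  shows "\<bar>(real (f j) - real j) - (real (f i) - real i)\<bar> \<ge> 2"
proof -
  consider "i < j" | "j < i" using assms(4) by linarith
  then show ?thesis
    using addable_content_less[OF assms(1,2,3)] addable_content_less[OF assms(1,3,2)]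
    by cases linarith+
qed

text \<open>By induction the words agree up to the last letter, and the addable boxes of a shape
  have distinct contents, so the last content fixes the last letter.\<close>

lemma lattice_word_content_inj:
  assumes "lattice_word u" "lattice_word v" "length u = length v"
    and "\<And>m. m < length u \<Longrightarrow> box_content u m = box_content v m"
  shows "u = v"
  using assms
proof (induction u arbitrary: v rule: rev_induct)
  case (snoc i u)
  then obtain v' j where v: "v = v' @ [j]" by (cases v rule: rev_cases) auto
  have len: "length u = length v'" using snoc.prems v by simp
  have lu: "lattice_word u" "i \<in> addable (count_list u)"
    and lv: "lattice_word v'" "j \<in> addable (count_list v')"
    using snoc.prems(1,2) by (simp_all add: v lattice_word_snoc)
  have "box_content u m = box_content v' m" if "m < length u" for m
    using snoc.prems(4)[of m] that len by (simp add: v box_content_append)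
  with snoc.IH[OF lu(1) lv(1) len] have uv: "u = v'" by blast
  have "box_content (u @ [i]) (length u) = box_content (v' @ [j]) (length v')"
    using snoc.prems(4)[of "length u"] v len by simp
  then have "real (count_list u i) - real i = real (count_list u j) - real j"
    by (simp add: uv)
  then have "j = i"
    using lu lv(2) by (intro addable_content_inj[OF lattice_word_antimono[OF lu(1)]]) (simp_all add: uv)
  then show ?case using uv v by simp
qed simp

section \<open>Exchanging two consecutive entries of a tableau\<close>

definition swap_step :: "nat list \<Rightarrow> nat list \<Rightarrow> bool" where
  "swap_step u u' \<longleftrightarrow> lattice_word u \<and> lattice_word u' \<and>
    (\<exists>v i j z. i \<noteq> j \<and> u = v @ [i, j] @ z \<and> u' = v @ [j, i] @ z)"

lemma swap_step_count: "swap_step u v \<Longrightarrow> count_list v = count_list u"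
  by (auto simp: swap_step_def count_list_append fun_eq_iff)

lemma swap_step_snoc:
  assumes "swap_step u u'" "i \<in> addable (count_list u)"
  shows "swap_step (u @ [i]) (u' @ [i])"
proof -
  have "count_list u = count_list u'"
    using swap_step_count[OF assms(1)] by simp
  then show ?thesis
    using assms unfolding swap_step_def lattice_word_snoc by fastforce
qed

lemma swap_steps_count: "swap_step\<^sup>*\<^sup>* u v \<Longrightarrow> count_list v = count_list u"
  by (induction rule: rtranclp_induct) (simp_all add: swap_step_count)

lemma swap_steps_snoc:
  assumes "swap_step\<^sup>*\<^sup>* u u'" "i \<in> addable (count_list u)"
  shows "swap_step\<^sup>*\<^sup>* (u @ [i]) (u' @ [i])"
  using assms
proof (induction rule: rtranclp_induct)
  case (step y z)
  then have "swap_step (y @ [i]) (z @ [i])"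
    using swap_step_snoc swap_steps_count by metis
  then show ?case using step by (meson rtranclp.rtrancl_into_rtrancl)
qed simp

text \<open>If the last letters \<open>i\<close> and \<open>j\<close> differ, both are corners of
  the common shape. A word \<open>p\<close> for the shape without these two boxes can be continued
  by \<open>j, i\<close> or by \<open>i, j\<close>; the two results differ by one swap, and the
  induction hypothesis joins them to \<open>u\<close> and \<open>v\<close>.\<close>

lemma swap_steps_connected:
  assumes "lattice_word u" "lattice_word v" "count_list u = count_list v"
  shows "swap_step\<^sup>*\<^sup>* u v"
  using assms
proof (induction "length u" arbitrary: u v)
  case 0
  then have "length u = 0" by simp
  moreover from this have "length v = 0"
    using count_list_eq_imp_length[OF 0(4)] by argo
  ultimately show ?case by simp
next
  case (Suc n)
  have "length v = Suc n" using count_list_eq_imp_length[OF Suc.prems(3)] Suc.hyps(2) by simp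
  then obtain u' i v' j where uv: "u = u' @ [i]" "v = v' @ [j]"
    using Suc.hyps(2) by (metis length_0_conv nat.simps(3) rev_exhaust)
  have lu: "lattice_word u'" "i \<in> addable (count_list u')"
    and lv: "lattice_word v'" "j \<in> addable (count_list v')"
    using Suc.prems(1,2) by (simp_all add: uv lattice_word_snoc)
  have len: "n = length u'" "n = length v'" using Suc.hyps(2) \<open>length v = Suc n\<close> uv by simp_all
  have c: "inc (count_list u') i = inc (count_list v') j"
    using Suc.prems(3) by (simp only: uv count_list_snoc)
  show ?case
  proof (cases "i = j")
    case True
    then have "count_list u' = count_list v'" using c by (metis dec_inc)
    then have "swap_step\<^sup>*\<^sup>* u' v'" using Suc.hyps(1)[OF len(1)] lu lv by blast
    then show ?thesis using swap_steps_snoc lu True uv by blast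
  next
    case False
    have "j \<in> removable (count_list u)"
      using Suc.prems(3) inc_in_removable[OF lattice_word_antimono[OF lv(1)], of j]
      by (simp only: uv count_list_snoc)
    then have "j \<in> removable (count_list u')"
      using False by (auto simp: uv removable_def split: if_splits)
    then obtain p where p: "lattice_word (p @ [j])" "count_list (p @ [j]) = count_list u'"
      using removable_exchange lu by blast
    have "i \<in> removable (count_list v)"
      using Suc.prems(3) inc_in_removable[OF lattice_word_antimono[OF lu(1)], of i]
      by (simp only: uv count_list_snoc)
    have cpi: "count_list (p @ [i]) = count_list v'"
    proof -
      have "inc (count_list (p @ [i])) j = inc (count_list (p @ [j])) i"
        by (simp only: count_list_snoc inc_commute)
      also have "\<dots> = inc (count_list v') j" using p c by simp
      finally show ?thesis by (metis dec_inc)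
    qed
    have lpji: "lattice_word (p @ [j, i])"
      using p lu(2) lattice_word_snoc[of "p @ [j]" i] by simp
    have "i \<in> addable (count_list p)"
    proof -
      have "antimono (count_list (p @ [i]))"
        using cpi lattice_word_antimono lv(1) by simp
      then show ?thesis
        using antimono_inc_iff[of "count_list p" i] p(1) lattice_word_antimono[of p]
        by (simp only: count_list_snoc lattice_word_snoc)
    qed
    then have lpi: "lattice_word (p @ [i])" using p(1) lattice_word_snoc by blast
    then have lpij: "lattice_word (p @ [i, j])"
      using cpi lv(2) lattice_word_snoc[of "p @ [i]" j] by simp
    have "swap_step\<^sup>*\<^sup>* u' (p @ [j])" using Suc.hyps(1)[OF len(1) lu(1) p(1)] p(2) by simp
    then have "swap_step\<^sup>*\<^sup>* u (p @ [j, i])" using swap_steps_snoc[OF _ lu(2)] uv(1) by fastforce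
    moreover have "swap_step (p @ [j, i]) (p @ [i, j])"
      unfolding swap_step_def using lpji lpij False
      by (intro conjI exI[of _ p] exI[of _ j] exI[of _ i] exI[of _ "[]"]) simp_all
    moreover have "swap_step\<^sup>*\<^sup>* (p @ [i]) v'"
      using Suc.hyps(1)[OF _ lpi lv(1) cpi] len count_list_eq_imp_length[OF cpi] by simp
    then have "swap_step\<^sup>*\<^sup>* (p @ [i, j]) v"
      using swap_steps_snoc[of "p @ [i]" v' j] cpi lv(2) uv(2) by simp
    ultimately show ?thesis by (meson rtranclp_trans rtranclp.rtrancl_into_rtrancl)
  qed
qed

text \<open>The tableau filled row by row. The last box of the lowest row is always a corner, so it
  can be made the last box, and the rest is treated in the same way.\<close>

lemma ex_row_sorted_word:
  "lattice_word w \<Longrightarrow> \<exists>u. lattice_word u \<and> count_list u = count_list w \<and> sorted u"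
proof (induction "length w" arbitrary: w)
  case 0
  then show ?case by (intro exI[of _ w]) simp
next
  case (Suc n)
  define i where "i = Max (set w)"
  have "set w \<noteq> {}" using Suc.hyps(2) by force
  then have i: "i \<in> set w" "\<And>j. j \<in> set w \<Longrightarrow> j \<le> i" unfolding i_def by simp_all
  have "Suc i \<notin> set w" using i(2) Suc_n_not_le_n by blast
  then have "count_list w (Suc i) = 0" by (simp add: count_list_0_iff)
  moreover have "count_list w i \<noteq> 0" using i(1) by (simp add: count_list_0_iff)
  ultimately have "i \<in> removable (count_list w)" by (simp add: removable_def)
  then obtain u where u: "lattice_word (u @ [i])" "count_list (u @ [i]) = count_list w"
    using removable_exchange Suc.prems by blast
  have lu: "lattice_word u" "i \<in> addable (count_list u)" using u lattice_word_snoc by blast+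
  have "length u = n" using Suc.hyps(2) count_list_eq_imp_length[OF u(2)] by simp
  then obtain v where v: "lattice_word v" "count_list v = count_list u" "sorted v"
    using Suc.hyps(1) lu by blast
  have "count_list (v @ [i]) = count_list w"
    using u(2) v(2) by (simp only: count_list_snoc)
  moreover have "lattice_word (v @ [i])" using v lu by (simp add: lattice_word_snoc)
  moreover have "x \<le> i" if "x \<in> set v" for x
  proof -
    have "x \<in> set (u @ [i])" using that v(2) by (metis UnCI count_list_0_iff set_append)
    then have "x \<in> set w" using u(2) by (metis count_list_0_iff)
    then show ?thesis using i by blast
  qed
  then have "sorted (v @ [i])" using v(3) by (simp add: sorted_append)
  ultimately show ?case by blast
qed

text \<open>The tableau filled column by column; the box made last is the lowest one of the last
  column.\<close>

lemma ex_col_sorted_word: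
  "lattice_word w \<Longrightarrow> \<exists>u. lattice_word u \<and> count_list u = count_list w \<and>
    (\<forall>l m. l \<le> m \<longrightarrow> m < length u \<longrightarrow> box_col u l \<le> box_col u m)"
proof (induction "length w" arbitrary: w)
  case 0
  then show ?case by (intro exI[of _ w]) simp
next
  case (Suc n)
  let ?f = "count_list w"
  have am: "antimono ?f" using Suc.prems lattice_word_antimono by blast
  have le0: "?f i \<le> ?f 0" for i using am antimonoD by blast
  have f0: "?f 0 > 0"
  proof -
    obtain x where "x \<in> set w" using Suc.hyps(2) by (cases w) auto
    then have "?f x \<noteq> 0" by (simp add: count_list_0_iff)
    then show ?thesis using le0[of x] by simp
  qed
  have "{i. ?f i = ?f 0} \<subseteq> set w"
    using f0 by (metis (mono_tags, lifting) count_notin less_irrefl_nat mem_Collect_eq subsetI)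
  then have fin: "finite {i. ?f i = ?f 0}" using finite_subset by blast
  \<comment> \<open>The rows that reach the last column are those as long as row 0, and the lowest
    of them ends in a corner.\<close>
  define i where "i = Max {i. ?f i = ?f 0}"
  have i: "?f i = ?f 0" using Max_in[OF fin] unfolding i_def by blast
  have "?f (Suc i) \<noteq> ?f 0"
  proof
    assume "?f (Suc i) = ?f 0"
    then have "Suc i \<le> i" using Max_ge[OF fin, of "Suc i"] unfolding i_def by simp
    then show False by simp
  qed
  then have "i \<in> removable ?f" using le0[of "Suc i"] i by (simp add: removable_def)
  then obtain u where u: "lattice_word (u @ [i])" "count_list (u @ [i]) = ?f"
    using removable_exchange Suc.prems by blast
  have lu: "lattice_word u" "i \<in> addable (count_list u)" using u lattice_word_snoc by blast+
  have "length u = n" using Suc.hyps(2) count_list_eq_imp_length[OF u(2)] by simp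
  then obtain v where v: "lattice_word v" "count_list v = count_list u"
      "\<forall>l m. l \<le> m \<longrightarrow> m < length v \<longrightarrow> box_col v l \<le> box_col v m"
    using Suc.hyps(1) lu by blast
  have cv: "count_list (v @ [i]) = ?f"
    using u(2) v(2) by (simp only: count_list_snoc)
  moreover have "lattice_word (v @ [i])" using v lu by (simp add: lattice_word_snoc)
  moreover have "box_col (v @ [i]) l \<le> box_col (v @ [i]) m" if "l \<le> m" "m < length (v @ [i])" for l m
  proof (cases "m < length v")
    case True
    then show ?thesis using that v(3) by (simp add: box_col_append)
  next
    case False
    then have m: "m = length v" using that by simp
    have "inc (count_list v) i = ?f" using cv by (simp only: count_list_snoc)
    then have "?f i = Suc (count_list v i)" by (metis fun_upd_same inc_def)
    then have last: "box_col (v @ [i]) m = ?f 0 - 1" using i m by simp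
    show ?thesis
    proof (cases "l = m")
      case False
      then have l: "l < length v" using that m by simp
      then have "box_col (v @ [i]) l < count_list v (v ! l)"
        using box_col_less_count by (simp add: box_col_append)
      also have "\<dots> \<le> count_list (v @ [i]) (v ! l)" by simp
      also have "\<dots> \<le> ?f 0" unfolding cv using le0 .
      finally show ?thesis using last by simp
    qed simp
  qed
  ultimately show ?case by blast
qed

section \<open>Point sets in a grid and dominance of partitions\<close>

lemma antimono_less_iff_card:
  fixes f :: "nat \<Rightarrow> nat"
  assumes "antimono f" "finite {i. J < f i}"
  shows "J < f i \<longleftrightarrow> i < card {i. J < f i}"
proof -
  obtain c where "\<not> J < f c" using assms(2) infinite_UNIV_nat
    by (metis (mono_tags, lifting) UNIV_eq_I mem_Collect_eq)
  define c where "c = (LEAST c. \<not> J < f c)"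
  have c: "\<not> J < f c" "\<And>i. i < c \<Longrightarrow> J < f i"
    unfolding c_def using LeastI[of "\<lambda>c. \<not> J < f c"] \<open>\<not> J < f _\<close> not_less_Least by blast+
  have "J < f i \<longleftrightarrow> i < c" for i
    using c antimonoD[OF assms(1), of c i] by (metis leI le_less_trans not_le)
  then show ?thesis by simp
qed

lemma card_eq_sum_rows:
  fixes P :: "(nat \<times> nat) set"
  assumes "finite P" "P \<subseteq> {..<N} \<times> UNIV"
  shows "card P = (\<Sum>i<N. card {j. (i, j) \<in> P})"
proof -
  have fin: "finite {j. (i, j) \<in> P}" for i
    by (rule finite_subset[of _ "snd ` P"]) (use assms(1) in force)+
  have "P = (SIGMA i:{..<N}. {j. (i, j) \<in> P})" using assms(2) by auto
  then have "card P = card (SIGMA i:{..<N}. {j. (i, j) \<in> P})" by simp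
  then show ?thesis using fin by simp
qed

lemma card_eq_sum_cols:
  fixes P :: "(nat \<times> nat) set"
  assumes "finite P" "P \<subseteq> UNIV \<times> {..<N}"
  shows "card P = (\<Sum>j<N. card {i. (i, j) \<in> P})"
  using card_eq_sum_rows[of "P\<inverse>" N] assms by (simp add: card_inverse) auto

lemma finite_cells:
  assumes "\<And>i. i \<ge> N \<Longrightarrow> f i = 0"
  shows "finite (cells f)"
proof (rule finite_subset)
  show "cells f \<subseteq> (SIGMA i:{..<N}. {..<f i})"
    using assms by (auto simp: cells_def) (metis less_nat_zero_code not_less)
qed simp

context
  fixes P :: "(nat \<times> nat) set" and f g :: "nat \<Rightarrow> nat" and N :: nat
  assumes fin: "finite P"
    and rows: "\<And>i. card {j. (i, j) \<in> P} = f i"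
    and cols: "\<And>j. card {i. (i, j) \<in> P} = card {i. (i, j) \<in> cells g}"
    and suppf: "\<And>i. i \<ge> N \<Longrightarrow> f i = 0" and suppg: "\<And>i. i \<ge> N \<Longrightarrow> g i = 0"
begin

text \<open>Both sides count points in the first \<open>J\<close> columns row by row, the left one
  for the diagram of \<open>g\<close>, the right one for \<open>P\<close>; the two sets have equal
  column counts.\<close>

lemma sum_min_eq_card:
  "(\<Sum>i<N. min (g i) J) = (\<Sum>i<N. card {j. (i, j) \<in> P \<and> j < J})"
proof -
  have finr: "finite {j. (i, j) \<in> P}" for i
    by (rule finite_subset[of _ "snd ` P"]) (use fin in force)+
  have PN: "i < N" if "(i, j) \<in> P" for i j
  proof (rule ccontr)
    assume "\<not> i < N"
    then have "card {j. (i, j) \<in> P} = 0" using rows suppf by simp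
    then show False using finr[of i] that by auto
  qed
  have "(\<Sum>i<N. min (g i) J) = (\<Sum>i<N. card {j. (i, j) \<in> cells g \<inter> UNIV \<times> {..<J}})"
  proof (intro sum.cong refl)
    fix i
    have "{j. (i, j) \<in> cells g \<inter> UNIV \<times> {..<J}} = {..<min (g i) J}" by (auto simp: cells_def)
    then show "min (g i) J = card {j. (i, j) \<in> cells g \<inter> UNIV \<times> {..<J}}" by simp
  qed
  also have "\<dots> = card (cells g \<inter> UNIV \<times> {..<J})"
    using suppg by (intro card_eq_sum_rows[symmetric] finite_Int disjI1 finite_cells[of N])
      (auto simp: cells_def intro: ccontr)
  also have "\<dots> = (\<Sum>j<J. card {i. (i, j) \<in> cells g \<inter> UNIV \<times> {..<J}})"
    using suppg by (intro card_eq_sum_cols finite_Int disjI1 finite_cells[of N]) auto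
  also have "\<dots> = (\<Sum>j<J. card {i. (i, j) \<in> P \<inter> UNIV \<times> {..<J}})"
    using cols by (intro sum.cong refl) simp
  also have "\<dots> = card (P \<inter> UNIV \<times> {..<J})"
    using fin by (intro card_eq_sum_cols[symmetric]) auto
  also have "\<dots> = (\<Sum>i<N. card {j. (i, j) \<in> P \<inter> UNIV \<times> {..<J}})"
    using fin PN by (intro card_eq_sum_rows) auto
  finally show ?thesis by simp
qed

lemma card_row_le: "card {j. (i, j) \<in> P \<and> j < J} \<le> min (f i) J"
proof -
  have finr: "finite {j. (i, j) \<in> P}"
    by (rule finite_subset[of _ "snd ` P"]) (use fin in force)+
  have "card {j. (i, j) \<in> P \<and> j < J} \<le> card {j. (i, j) \<in> P}"
    using finr by (intro card_mono) auto
  moreover have "card {j. (i, j) \<in> P \<and> j < J} \<le> card {..<J}"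
    by (intro card_mono) auto
  ultimately show ?thesis using rows by simp
qed

lemma dominance: "(\<Sum>i<N. min (g i) J) \<le> (\<Sum>i<N. min (f i) J)"
  unfolding sum_min_eq_card by (intro sum_mono card_row_le)

text \<open>With \<open>f = g\<close> the upper bounds of \<open>card_row_le\<close> add up to the
  actual total, so each of them is attained, for every \<open>J\<close>. Comparing
  \<open>J = j\<close> with \<open>J = Suc j\<close> in row \<open>i\<close> then decides whether
  \<open>(i, j)\<close> is a point.\<close>

lemma points_eq_cells:
  assumes "f = g"
  shows "P = cells f"
proof -
  have eq: "card {j. (i, j) \<in> P \<and> j < J} = min (f i) J" if "i < N" for i J
  proof (rule ccontr)
    assume "card {j. (i, j) \<in> P \<and> j < J} \<noteq> min (f i) J"
    then have "card {j. (i, j) \<in> P \<and> j < J} < min (f i) J"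
      using card_row_le[of i J] le_neq_implies_less by blast
    then have "(\<Sum>i<N. card {j. (i, j) \<in> P \<and> j < J}) < (\<Sum>i<N. min (f i) J)"
      using that card_row_le by (intro sum_strict_mono_ex1) auto
    then show False using sum_min_eq_card assms by simp
  qed
  have "(i, j) \<in> P \<longleftrightarrow> j < f i" for i j
  proof (cases "i < N")
    case True
    have split: "{j'. (i, j') \<in> P \<and> j' < Suc j} =
        {j'. (i, j') \<in> P \<and> j' < j} \<union> (if (i, j) \<in> P then {j} else {})"
      by (auto simp: less_Suc_eq)
    have "card {j'. (i, j') \<in> P \<and> j' < Suc j} =
        card {j'. (i, j') \<in> P \<and> j' < j} + (if (i, j) \<in> P then 1 else 0)"
      unfolding split by (subst card_Un_disjoint) auto
    then have "min (f i) (Suc j) = min (f i) j + (if (i, j) \<in> P then 1 else 0)"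
      using eq[OF True] by simp
    then show ?thesis by (auto split: if_splits)
  next
    case False
    then have "card {j. (i, j) \<in> P} = 0" using rows suppf by simp
    moreover have "finite {j. (i, j) \<in> P}"
      by (rule finite_subset[of _ "snd ` P"]) (use fin in force)+
    ultimately show ?thesis using suppf[of i] False by auto
  qed
  then show ?thesis by (auto simp: cells_def)
qed

end

text \<open>Raising \<open>J\<close> by one raises the sum by the number of rows longer than
  \<open>J\<close>, which is a column length. Columns are initial segments of the rows, so their
  lengths determine the partition.\<close>

lemma sum_min_eq_imp_eq:
  fixes f g :: "nat \<Rightarrow> nat"
  assumes "antimono f" "antimono g"
    and suppf: "\<And>i. i \<ge> N \<Longrightarrow> f i = 0" and suppg: "\<And>i. i \<ge> N \<Longrightarrow> g i = 0"
    and eq: "\<And>J. (\<Sum>i<N. min (g i) J) = (\<Sum>i<N. min (f i) J)"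
  shows "f = g"
proof -
  have step: "(\<Sum>i<N. min (h i) (Suc J)) = (\<Sum>i<N. min (h i) J) + card {i. J < h i}"
    and fin: "finite {i. J < h i}"
    if supp: "\<And>i. i \<ge> N \<Longrightarrow> h i = 0" for h :: "nat \<Rightarrow> nat" and J
  proof -
    have sub: "{i. J < h i} \<subseteq> {..<N}" using supp by (auto simp: not_less) (metis less_nat_zero_code not_less)
    then show "finite {i. J < h i}" using finite_subset by blast
    have "(\<Sum>i<N. min (h i) (Suc J)) = (\<Sum>i<N. min (h i) J + (if J < h i then 1 else 0))"
      by (intro sum.cong) auto
    also have "\<dots> = (\<Sum>i<N. min (h i) J) + card ({..<N} \<inter> {i. J < h i})"
      by (simp add: sum.distrib sum.If_cases)
    also have "{..<N} \<inter> {i. J < h i} = {i. J < h i}" using sub by blast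
    finally show "(\<Sum>i<N. min (h i) (Suc J)) = (\<Sum>i<N. min (h i) J) + card {i. J < h i}" .
  qed
  have card: "card {i. J < f i} = card {i. J < g i}" for J
    using step[of f J, OF suppf] step[of g J, OF suppg] eq[of J] eq[of "Suc J"] by linarith
  have "J < f i \<longleftrightarrow> J < g i" for i J
  proof -
    have "J < f i \<longleftrightarrow> i < card {i. J < f i}"
      by (rule antimono_less_iff_card[OF assms(1) fin[OF suppf]])
    also have "\<dots> \<longleftrightarrow> i < card {i. J < g i}" by (simp only: card)
    also have "\<dots> \<longleftrightarrow> J < g i"
      by (rule antimono_less_iff_card[OF assms(2) fin[OF suppg], symmetric])
    finally show ?thesis .
  qed
  then have "f i = g i" for i by (metis linorder_neqE_nat less_irrefl_nat)
  then show ?thesis by blast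
qed

section \<open>Jucys--Murphy elements acting on functions\<close>

text \<open>Only relations between transpositions are assumed, so left and right multiplication on
  the symmetric group are both instances. Letters are counted from 0; closure of \<open>G\<close>
  holds for letters below \<open>N\<close>, whence bounds such as \<open>Suc m < N\<close>
  below.\<close>

locale transposition_action =
  fixes N :: nat and G :: "'g set" and t :: "nat \<Rightarrow> nat \<Rightarrow> 'g \<Rightarrow> 'g"
  assumes finite_G: "finite G"
    and t_closed: "i < N \<Longrightarrow> j < N \<Longrightarrow> g \<in> G \<Longrightarrow> t i j g \<in> G"
    and t_t: "t i j (t i j g) = g"
    and t_conj: "t i j (t k l g) = t (transpose i j k) (transpose i j l) (t i j g)"
begin

definition JM :: "nat \<Rightarrow> ('g \<Rightarrow> 'a::comm_ring_1) \<Rightarrow> 'g \<Rightarrow> 'a" where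
  "JM m x = (\<lambda>g. \<Sum>i<m. x (t i m g))"

definition swap :: "nat \<Rightarrow> ('g \<Rightarrow> 'a::comm_ring_1) \<Rightarrow> 'g \<Rightarrow> 'a" where
  "swap m x = (\<lambda>g. x (t m (Suc m) g))"

text \<open>Bilinear over the complex numbers too; where a Hermitian product is wanted, the second
  argument is conjugated explicitly.\<close>

definition ip :: "('g \<Rightarrow> 'a::comm_ring_1) \<Rightarrow> ('g \<Rightarrow> 'a) \<Rightarrow> 'a" where
  "ip x y = (\<Sum>g\<in>G. x g * y g)"

definition supported :: "('g \<Rightarrow> 'a::comm_ring_1) \<Rightarrow> bool" where
  "supported x \<longleftrightarrow> (\<forall>g. g \<notin> G \<longrightarrow> x g = 0)"

definition eigen :: "nat \<Rightarrow> 'a::comm_ring_1 \<Rightarrow> ('g \<Rightarrow> 'a) \<Rightarrow> bool" where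
  "eigen m c x \<longleftrightarrow> JM m x = (\<lambda>g. c * x g)"

definition weight :: "nat list \<Rightarrow> ('g \<Rightarrow> real) \<Rightarrow> bool" where
  "weight u x \<longleftrightarrow> (\<forall>m<length u. eigen m (box_content u m) x)"

lemma t_closed_iff: "i < N \<Longrightarrow> j < N \<Longrightarrow> t i j g \<in> G \<longleftrightarrow> g \<in> G"
  using t_closed t_t by metis

text \<open>Conjugation by \<open>(i j)\<close> with \<open>i, j < r\<close> fixes \<open>r\<close>
  and permutes the transpositions \<open>(k r)\<close> with \<open>k < r\<close>. Hence a
  Jucys-Murphy element commutes with all permutations of smaller letters.\<close>

lemma sum_t_commute:
  assumes "i < r" "j < r"
  shows "(\<Sum>k<r. x (t i j (t k r g))) = (\<Sum>k<r. x (t k r (t i j g)))"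
proof -
  have "transpose i j permutes {..<r}" using assms by (intro permutes_swap_id) auto
  moreover have "transpose i j r = r" using assms by (simp add: transpose_def)
  ultimately have "(\<Sum>k<r. x (t k r (t i j g))) = (\<Sum>k<r. x (t (transpose i j k) r (t i j g)))"
    using sum.permute[of "transpose i j" "{..<r}" "\<lambda>k. x (t k r (t i j g))"] by (simp add: o_def)
  also have "\<dots> = (\<Sum>k<r. x (t i j (t k r g)))"
    using \<open>transpose i j r = r\<close> by (subst t_conj) simp
  finally show ?thesis by simp
qed

lemma JM_commute: "JM a (JM b x) = JM b (JM a x)"
proof -
  have less: "JM a (JM b x) = JM b (JM a x)" if "a < b" for a b and x :: "'g \<Rightarrow> 'b::comm_ring_1"
  proof
    fix g
    have "JM a (JM b x) g = (\<Sum>i<a. \<Sum>k<b. x (t k b (t i a g)))" by (simp add: JM_def)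
    also have "\<dots> = (\<Sum>i<a. \<Sum>k<b. x (t i a (t k b g)))"
      using that by (intro sum.cong refl sum_t_commute[symmetric]) auto
    also have "\<dots> = JM b (JM a x) g" by (subst sum.swap) (simp add: JM_def)
    finally show "JM a (JM b x) g = JM b (JM a x) g" .
  qed
  show ?thesis using less[of a b x] less[of b a x] by (cases a b rule: linorder_cases) auto
qed

lemma swap_swap [simp]: "swap m (swap m x) = x"
  by (simp add: swap_def t_t)

lemma t_conj_Suc: "i < m \<Longrightarrow> t m (Suc m) (t i (Suc m) g) = t i m (t m (Suc m) g)"
  by (subst t_conj) simp

lemma t_conj_Suc': "i < m \<Longrightarrow> t m (Suc m) (t i m g) = t i (Suc m) (t m (Suc m) g)"
  by (subst t_conj) simp

text \<open>This and the next lemma are the relations of the degenerate affine Hecke algebra. The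
  swap conjugates \<open>(i, Suc m)\<close> into \<open>(i, m)\<close> for \<open>i < m\<close>; the
  remaining summand \<open>(m, Suc m)\<close> undoes the swap and leaves \<open>x\<close>.\<close>

lemma JM_Suc_swap: "JM (Suc m) (swap m x) = (\<lambda>g. swap m (JM m x) g + x g)"
  by (simp add: JM_def swap_def fun_eq_iff t_t t_conj_Suc)

lemma JM_swap: "JM m (swap m x) = (\<lambda>g. swap m (JM (Suc m) x) g - x g)"
  by (simp add: JM_def swap_def fun_eq_iff t_t t_conj_Suc')

lemma JM_swap_commute:
  assumes "r \<noteq> m" "r \<noteq> Suc m"
  shows "JM r (swap m x) = swap m (JM r x)"
proof (cases "r < m")
  case True
  have "t m (Suc m) (t i r g) = t i r (t m (Suc m) g)" if "i < r" for i g
    using True that by (subst t_conj) (simp add: transpose_def)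
  then show ?thesis by (simp add: JM_def swap_def)
next
  case False
  then show ?thesis using assms sum_t_commute[of m r "Suc m" x] by (simp add: JM_def swap_def)
qed

lemma swap_braid: "swap m (swap (Suc m) (swap m x)) = swap (Suc m) (swap m (swap (Suc m) x))"
proof
  fix g
  have "t m (Suc m) (t (Suc m) (Suc (Suc m)) h) = t m (Suc (Suc m)) (t m (Suc m) h)" for h
    by (subst t_conj) (simp add: transpose_def)
  moreover have "t (Suc m) (Suc (Suc m)) (t m (Suc m) h) =
      t m (Suc (Suc m)) (t (Suc m) (Suc (Suc m)) h)" for h
    by (subst t_conj) (simp add: transpose_def)
  ultimately show "swap m (swap (Suc m) (swap m x)) g =
      swap (Suc m) (swap m (swap (Suc m) x)) g"
    by (simp add: swap_def t_t)
qed

lemma sum_t_adjoint: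
  assumes "i < N" "j < N"
  shows "(\<Sum>g\<in>G. x (t i j g) * y g) = (\<Sum>g\<in>G. x g * (y (t i j g) :: 'b::comm_ring_1))"
  by (rule sum.reindex_bij_witness[of _ "t i j" "t i j"]) (use assms in \<open>auto simp: t_t t_closed\<close>)

lemma swap_adjoint: "Suc m < N \<Longrightarrow> ip (swap m x) y = ip x (swap m y)"
  unfolding ip_def swap_def by (rule sum_t_adjoint) auto

lemma JM_adjoint:
  assumes "m < N"
  shows "ip (JM m x) y = ip x (JM m y)"
proof -
  have "ip (JM m x) y = (\<Sum>i<m. \<Sum>g\<in>G. x (t i m g) * y g)"
    unfolding ip_def JM_def sum_distrib_right by (rule sum.swap)
  also have "\<dots> = (\<Sum>i<m. \<Sum>g\<in>G. x g * y (t i m g))"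
    using assms by (intro sum.cong refl sum_t_adjoint) auto
  also have "\<dots> = ip x (JM m y)"
    unfolding ip_def JM_def sum_distrib_left by (rule sum.swap)
  finally show ?thesis .
qed

lemma ip_lin: "ip (\<lambda>g. c * x g + d * y g) z = c * ip x z + d * ip y z"
  by (simp add: ip_def algebra_simps sum.distrib sum_distrib_left)

lemma ip_scale_left: "ip (\<lambda>g. c * x g) z = c * ip x z"
  by (simp add: ip_def algebra_simps sum_distrib_left)

lemma ip_scale_right: "ip z (\<lambda>g. c * x g) = c * ip z x"
  by (simp add: ip_def algebra_simps sum_distrib_left)

lemma ip_diff_left: "ip (\<lambda>g. x g - y g) z = ip x z - ip y z"
  by (simp add: ip_def algebra_simps sum_subtractf)

lemma ip_self_eq_0:
  fixes x :: "'g \<Rightarrow> real"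
  assumes "supported x" "ip x x = 0"
  shows "x = (\<lambda>_. 0)"
proof -
  have "\<forall>g\<in>G. x g * x g = 0"
    using assms(2) unfolding ip_def by (subst (asm) sum_nonneg_eq_0_iff) (auto simp: finite_G)
  then show ?thesis using assms(1) by (auto simp: supported_def)
qed

lemma supported_swap: "Suc m < N \<Longrightarrow> supported x \<Longrightarrow> supported (swap m x)"
  by (auto simp: supported_def swap_def t_closed_iff)

lemma supported_JM: "m < N \<Longrightarrow> supported x \<Longrightarrow> supported (JM m x)"
  by (auto simp: supported_def JM_def t_closed_iff intro!: sum.neutral)

lemma swap_scale: "swap m (\<lambda>g. c * x g) = (\<lambda>g. c * swap m x g)"
  by (simp add: swap_def)

lemma JM_lin: "JM m (\<lambda>g. c * x g + d * y g) = (\<lambda>g. c * JM m x g + d * JM m y g)"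
  by (simp add: JM_def sum.distrib sum_distrib_left)

lemma JM_diff: "JM m (\<lambda>g. x g - c * y g) = (\<lambda>g. JM m x g - c * JM m y g)"
  by (simp add: JM_def sum_subtractf sum_distrib_left)

section \<open>Eigenfunctions of two consecutive Jucys-Murphy operators\<close>

lemma eigen_swap_commute:
  assumes "eigen r c x" "r \<noteq> m" "r \<noteq> Suc m"
  shows "eigen r c (\<lambda>g. swap m x g - d * x g)"
  using assms(1) JM_swap_commute[OF assms(2,3), of x]
  by (simp add: eigen_def JM_diff swap_scale algebra_simps)

context
  fixes m :: nat and a b :: real and x :: "'g \<Rightarrow> real"
  assumes ea: "eigen m a x" and eb: "eigen (Suc m) b x"
begin

lemma JM_swap_eigen: "JM m (swap m x) = (\<lambda>g. b * swap m x g - x g)"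
  using eb by (simp add: JM_swap eigen_def swap_scale)

lemma JM_Suc_swap_eigen: "JM (Suc m) (swap m x) = (\<lambda>g. a * swap m x g + x g)"
  using ea by (simp add: JM_Suc_swap eigen_def swap_scale)

text \<open>On the span of \<open>x\<close> and \<open>swap m x\<close>, \<open>JM m\<close> is
  triangular with diagonal \<open>a\<close>, \<open>b\<close>. An ansatz
  \<open>swap m x - c * x\<close> with eigenvalue \<open>b\<close> requires
  \<open>1 + c * a = c * b\<close>, which is the origin of \<open>1 / (b - a)\<close>.\<close>

lemma eigen_intertwiner:
  assumes "a \<noteq> b"
  shows "eigen m b (\<lambda>g. swap m x g - 1 / (b - a) * x g)"
    and "eigen (Suc m) a (\<lambda>g. swap m x g - 1 / (b - a) * x g)"
proof -
  have *: "1 / (b - a) * b = 1 + 1 / (b - a) * a"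
    using assms by (simp add: field_simps)
  have "b * y - z - 1 / (b - a) * (a * z) = b * (y - 1 / (b - a) * z)" for y z
  proof -
    have "b * (y - 1 / (b - a) * z) = b * y - (1 / (b - a) * b) * z" by (simp add: algebra_simps)
    then show ?thesis unfolding * by (simp add: algebra_simps)
  qed
  then show "eigen m b (\<lambda>g. swap m x g - 1 / (b - a) * x g)"
    using ea unfolding eigen_def by (simp only: JM_diff JM_swap_eigen)
  have "a * y + z - 1 / (b - a) * (b * z) = a * (y - 1 / (b - a) * z)" for y z
  proof -
    have "1 / (b - a) * (b * z) = (1 / (b - a) * b) * z" by simp
    then show ?thesis unfolding * by (simp add: algebra_simps)
  qed
  then show "eigen (Suc m) a (\<lambda>g. swap m x g - 1 / (b - a) * x g)"
    using eb unfolding eigen_def by (simp only: JM_diff JM_Suc_swap_eigen)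
qed

text \<open>For \<open>a = b\<close> the triangular matrix would be a Jordan block, which a
  symmetric operator excludes: evaluating \<open>ip (JM m (swap m x)) x\<close> in two ways leaves
  \<open>ip x x = 0\<close>.\<close>

lemma eigen_equal_imp_zero:
  assumes "a = b" "Suc m < N" "supported x"
  shows "x = (\<lambda>_. 0)"
proof (rule ip_self_eq_0[OF assms(3)])
  have "ip (JM m (swap m x)) x = ip (swap m x) (\<lambda>g. a * x g)"
    using assms(2) ea by (simp add: JM_adjoint eigen_def)
  then have "b * ip (swap m x) x - ip x x = a * ip (swap m x) x"
    by (simp only: JM_swap_eigen ip_diff_left ip_scale_left ip_scale_right)
  then show "ip x x = 0" using assms(1) by simp
qed

text \<open>The intertwined function \<open>z\<close> has eigenvalue \<open>b\<close> for
  \<open>JM m\<close>, so it is orthogonal to \<open>x\<close>. Because \<open>e = b - a\<close>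
  squares to 1, the swap also maps \<open>z\<close> to \<open>- e * z\<close>, so \<open>z\<close>
  is orthogonal to \<open>swap m x\<close> as well, hence to itself.\<close>

lemma swap_eigen_adjacent:
  assumes "(b - a)\<^sup>2 = 1" "Suc m < N" "supported x"
  shows "swap m x = (\<lambda>g. (b - a) * x g)"
proof -
  define e where "e = b - a"
  have ee: "e * e = 1" using assms(1) by (simp add: e_def power2_eq_square)
  then have e0: "e \<noteq> 0" by auto
  then have ie: "1 / (b - a) = e" using ee by (simp add: e_def field_simps)
  define z where "z = (\<lambda>g. swap m x g - e * x g)"
  have ez: "eigen m b z"
    using eigen_intertwiner(1) e0 unfolding ie z_def e_def by simp
  have "a * ip x z = b * ip x z"
    using JM_adjoint[of m x z] assms(2) ea ez
    by (simp add: eigen_def ip_scale_left ip_scale_right)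
  then have xz: "ip x z = 0" using e0 by (simp add: e_def)
  have "swap m z = (\<lambda>g. x g - e * swap m x g)"
    using swap_swap[of m x] by (simp add: z_def swap_def fun_eq_iff)
  also have "\<dots> = (\<lambda>g. - e * z g)"
  proof
    fix g
    have "- e * z g = - e * swap m x g + (e * e) * x g" by (simp add: z_def algebra_simps)
    then show "x g - e * swap m x g = - e * z g" by (simp add: ee)
  qed
  finally have sz: "swap m z = (\<lambda>g. - e * z g)" .
  have "ip (swap m x) z = - e * ip x z"
    using assms(2) by (simp only: swap_adjoint sz ip_scale_right)
  moreover have "ip z z = ip (swap m x) z - e * ip x z"
    by (subst z_def) (simp only: ip_diff_left ip_scale_left)
  ultimately have "ip z z = 0" using xz by simp
  moreover have "supported z"
    using supported_swap[OF assms(2,3)] assms(3) by (simp add: supported_def z_def)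
  ultimately have "z = (\<lambda>_. 0)" by (rule ip_self_eq_0[rotated])
  then show ?thesis by (simp add: z_def e_def fun_eq_iff)
qed

text \<open>If the intertwiner kills \<open>x\<close>, then \<open>x\<close> is an eigenfunction of
  the swap for \<open>1 / (b - a)\<close>; the swap is an involution, so this number would have to
  be 1 or -1.\<close>

lemma intertwiner_inj:
  assumes "a \<noteq> b" "(b - a)\<^sup>2 \<noteq> 1" "(\<lambda>g. swap m x g - 1 / (b - a) * x g) = (\<lambda>_. 0)"
  shows "x = (\<lambda>_. 0)"
proof -
  define c where "c = 1 / (b - a)"
  have s: "swap m x = (\<lambda>g. c * x g)" using assms(3) by (simp add: c_def fun_eq_iff)
  have "x = swap m (swap m x)" by simp
  also have "\<dots> = (\<lambda>g. c * (c * x g))" by (simp only: s swap_scale)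
  finally have "x g = c * c * x g" for g by (metis mult.assoc)
  moreover have "c * c \<noteq> 1"
    using assms(1,2) by (auto simp: c_def power2_eq_square field_simps)
  ultimately show ?thesis by (metis mult_cancel_right1)
qed

end

text \<open>The two swaps act on \<open>x\<close> by opposite signs \<open>e\<close> and
  \<open>- e\<close>. The braid relation equates the products of the two signs over its two sides,
  and these products are opposite.\<close>

lemma no_alternating_weight:
  assumes "eigen m a x" "eigen (Suc m) b x" "eigen (Suc (Suc m)) a x"
    and "(b - a)\<^sup>2 = 1" "Suc (Suc m) < N" "supported x"
  shows "x = (\<lambda>_. 0 :: real)"
proof -
  define e where "e = b - a"
  have e: "e * e = 1" using assms(4) by (simp add: e_def power2_eq_square)
  have 1: "swap m x = (\<lambda>g. e * x g)"
    using swap_eigen_adjacent[OF assms(1,2,4)] assms(5,6) by (simp add: e_def)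
  have "swap (Suc m) x = (\<lambda>g. (a - b) * x g)"
    using swap_eigen_adjacent[OF assms(2,3)] assms(4,5,6) by (simp add: power2_commute)
  then have 2: "swap (Suc m) x = (\<lambda>g. - e * x g)" by (simp add: e_def)
  show ?thesis
  proof
    fix g
    have "e * (- e * (e * x g)) = - e * (e * (- e * x g))"
      using fun_cong[OF swap_braid[of m x], of g] by (simp only: 1 2 swap_scale mult_ac)
    then have "- (e * e) * (e * x g) = (e * e) * (e * x g)" by (simp add: algebra_simps)
    then have "e * x g = 0" by (simp add: e)
    then show "x g = 0" using e by auto
  qed
qed

end

section \<open>Transport of joint eigenfunctions between tableaux of one shape\<close>

lemma content_swap:
  assumes "i \<noteq> j"
  shows "box_content (v @ [j, i] @ z) (length v) = box_content (v @ [i, j] @ z) (Suc (length v))"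
    and "box_content (v @ [i, j] @ z) (length v) = real (count_list v i) - real i"
    and "m \<noteq> length v \<Longrightarrow> m \<noteq> Suc (length v) \<Longrightarrow> box_content (v @ [j, i] @ z) m = box_content (v @ [i, j] @ z) m"
proof -
  show "box_content (v @ [j, i] @ z) (length v) = box_content (v @ [i, j] @ z) (Suc (length v))"
    and "box_content (v @ [i, j] @ z) (length v) = real (count_list v i) - real i"
    using assms by (simp_all add: box_content_def box_col_def nth_append)
  assume m: "m \<noteq> length v" "m \<noteq> Suc (length v)"
  show "box_content (v @ [j, i] @ z) m = box_content (v @ [i, j] @ z) m"
  proof (cases "m < length v")
    case True
    then show ?thesis by (simp add: box_content_append)
  next
    case False
    then have "m = length v + Suc (Suc (m - length v - 2))" using m by simp
    then obtain r where "m = length v + Suc (Suc r)" by blast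
    then show ?thesis by (simp add: box_content_def box_col_def nth_append count_list_append)
  qed
qed

context transposition_action
begin

text \<open>Precisely the closure that keeps intertwiners inside \<open>K\<close>. The set
  \<open>K\<close> can thus record further eigenvalue conditions which survive the
  transport.\<close>

definition swap_closed :: "nat \<Rightarrow> ('g \<Rightarrow> real) set \<Rightarrow> bool" where
  "swap_closed n K \<longleftrightarrow>
    (\<forall>x\<in>K. \<forall>m c. Suc m < n \<longrightarrow> (\<lambda>g. swap m x g - c * x g) \<in> K)"

definition lin_comb :: "real \<Rightarrow> ('g \<Rightarrow> real) \<Rightarrow> real \<Rightarrow> ('g \<Rightarrow> real) \<Rightarrow> 'g \<Rightarrow> real" where
  "lin_comb c x d y = (\<lambda>g. c * x g + d * y g)"

lemma eigen_lin_comb: "eigen m a x \<Longrightarrow> eigen m a y \<Longrightarrow> eigen m a (lin_comb c x d y)"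
  unfolding eigen_def lin_comb_def by (simp add: JM_lin algebra_simps)

text \<open>Both exchanged boxes are addable to the shape of the common prefix, so their contents
  differ by at least 2 and the intertwiner is injective. Two functions are carried by the same
  linear map, so that a linear relation found at the target can be pulled back; uniqueness rests on
  this.\<close>

lemma transport_step:
  assumes step: "swap_step u u'" and K: "swap_closed (length u) K"
    and x: "x \<in> K" "weight u x" and y: "y \<in> K" "weight u y"
  shows "\<exists>x'\<in>K. \<exists>y'\<in>K. weight u' x' \<and> weight u' y' \<and>
    (\<forall>c d. lin_comb c x' d y' = (\<lambda>_. 0) \<longrightarrow> lin_comb c x d y = (\<lambda>_. 0))"
proof -
  obtain v i j z where ij: "i \<noteq> j" and u: "u = v @ [i, j] @ z" and u': "u' = v @ [j, i] @ z"
    and lu: "lattice_word u" "lattice_word u'"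
    using step unfolding swap_step_def by blast
  define l where "l = length v"
  define a where "a = box_content u l"
  define b where "b = box_content u (Suc l)"
  have b: "box_content u' l = b" and a: "box_content u' (Suc l) = a"
    and others: "m \<noteq> l \<Longrightarrow> m \<noteq> Suc l \<Longrightarrow> box_content u' m = box_content u m" for m
    using content_swap[OF ij] content_swap[OF ij[symmetric]]
    by (simp_all only: a_def b_def u u' l_def)
  have add: "i \<in> addable (count_list v)" "j \<in> addable (count_list v)"
    and am: "antimono (count_list v)"
    using lu lattice_word_append[of "v @ [i]" "j # z"] lattice_word_append[of "v @ [j]" "i # z"]
    by (auto simp: u u' lattice_word_snoc lattice_word_antimono)
  have "a = real (count_list v i) - real i" "b = real (count_list v j) - real j"
    using content_swap(2)[OF ij, of v z] content_swap(2)[OF ij[symmetric], of v z] b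
    by (simp_all add: a_def u u' l_def)
  then have diff: "\<bar>b - a\<bar> \<ge> 2" using addable_content_diff[OF am add ij] by simp
  then have ab: "a \<noteq> b" "(b - a)\<^sup>2 \<noteq> 1"
    by (auto simp: power2_eq_1_iff)
  define \<Phi> where "\<Phi> x = (\<lambda>g. swap l x g - 1 / (b - a) * x g)" for x :: "'g \<Rightarrow> real"
  have len: "length u' = length u" "Suc l < length u" by (simp_all add: u u' l_def)
  have eigens: "eigen l a x" "eigen (Suc l) b x" if "weight u x" for x
    using that len by (simp_all add: weight_def a_def b_def)
  have w: "weight u' (\<Phi> x)" if "weight u x" for x
    unfolding weight_def
  proof (intro allI impI)
    fix m assume m: "m < length u'"
    note e = eigen_intertwiner[OF eigens[OF that] ab(1)]
    have oth: "eigen m (box_content u m) (\<Phi> x)" if "m \<noteq> l" "m \<noteq> Suc l"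
      unfolding \<Phi>_def using \<open>weight u x\<close> m len that
      by (intro eigen_swap_commute) (simp_all add: weight_def)
    show "eigen m (box_content u' m) (\<Phi> x)"
      using e b a others oth by (cases "m = l"; cases "m = Suc l") (simp_all add: \<Phi>_def)
  qed
  have inK: "\<Phi> x \<in> K" if "x \<in> K" for x
    using K that len unfolding swap_closed_def \<Phi>_def by blast
  have lin: "lin_comb c (\<Phi> x) d (\<Phi> y) = \<Phi> (lin_comb c x d y)" for c d
    by (simp add: \<Phi>_def lin_comb_def swap_def fun_eq_iff algebra_simps)
  have "lin_comb c x d y = (\<lambda>_. 0)" if "lin_comb c (\<Phi> x) d (\<Phi> y) = (\<lambda>_. 0)" for c d
  proof (rule intertwiner_inj)
    show "eigen l a (lin_comb c x d y)" "eigen (Suc l) b (lin_comb c x d y)"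
      using eigens x(2) y(2) eigen_lin_comb by blast+
    show "(\<lambda>g. swap l (lin_comb c x d y) g - 1 / (b - a) * lin_comb c x d y g) = (\<lambda>_. 0)"
      using that unfolding lin unfolding \<Phi>_def .
  qed (use ab in auto)
  then show ?thesis using w x y inK by blast
qed

lemma transport:
  assumes "swap_step\<^sup>*\<^sup>* u u'" and K: "swap_closed (length u) K"
    and x: "x \<in> K" "weight u x" and y: "y \<in> K" "weight u y"
  shows "\<exists>x'\<in>K. \<exists>y'\<in>K. weight u' x' \<and> weight u' y' \<and>
    (\<forall>c d. lin_comb c x' d y' = (\<lambda>_. 0) \<longrightarrow> lin_comb c x d y = (\<lambda>_. 0))"
  using assms(1)
proof (induction rule: rtranclp_induct)
  case base
  then show ?case using x y by blast
next
  case (step v w)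
  then obtain x' y' where *: "x' \<in> K" "y' \<in> K" "weight v x'" "weight v y'"
    "\<forall>c d. lin_comb c x' d y' = (\<lambda>_. 0) \<longrightarrow> lin_comb c x d y = (\<lambda>_. 0)" by blast
  have "length v = length u"
    using count_list_eq_imp_length[OF swap_steps_count[OF step(1)]] .
  then obtain x'' y'' where "x'' \<in> K" "y'' \<in> K" "weight w x''" "weight w y''"
    "\<forall>c d. lin_comb c x'' d y'' = (\<lambda>_. 0) \<longrightarrow> lin_comb c x' d y' = (\<lambda>_. 0)"
    using transport_step[OF step(2), of K x' y'] K * by auto
  then show ?case using *(5) by blast
qed

lemma transport_nonzero:
  assumes "lattice_word u" "lattice_word u'" "count_list u = count_list u'"
    and "swap_closed (length u) K" "x \<in> K" "weight u x" "x \<noteq> (\<lambda>_. 0)"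
  shows "\<exists>x'\<in>K. weight u' x' \<and> x' \<noteq> (\<lambda>_. 0)"
proof -
  \<comment> \<open>The pair \<open>x\<close>, \<open>x\<close> is transported; with coefficients 1
    and 0 the partner \<open>y'\<close> drops out.\<close>
  obtain x' where x': "x' \<in> K" "weight u' x'"
    "\<forall>c d. \<exists>y'. lin_comb c x' d y' = (\<lambda>_. 0) \<longrightarrow> lin_comb c x d x = (\<lambda>_. 0)"
    using transport[OF swap_steps_connected[OF assms(1-3)] assms(4-6) assms(5,6)] by blast
  have "x' \<noteq> (\<lambda>_. 0)"
  proof
    assume "x' = (\<lambda>_. 0)"
    then have "lin_comb 1 x 0 x = (\<lambda>_. 0)"
      using x'(3)[rule_format, of 1 0] by (simp add: lin_comb_def)
    then show False using assms(7) by (simp add: lin_comb_def)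
  qed
  then show ?thesis using x' by blast
qed

text \<open>If the next content is not that of an addable box, transporting the tableau on the first
  entries makes three consecutive contents alternate.\<close>

lemma alternating_imp_zero:
  assumes u: "lattice_word u" and p: "p \<in> removable (count_list u)"
    and x: "supported x" "weight u x" "eigen (length u) a x" "eigen (Suc (length u)) b x"
    and N: "Suc (length u) < N"
    and b: "real (count_list u p) - 1 - real p = b" and ab: "(b - a)\<^sup>2 = 1"
  shows "x = (\<lambda>_. 0)"
proof (rule ccontr)
  assume nz: "x \<noteq> (\<lambda>_. 0)"
  obtain v where v: "lattice_word (v @ [p])" "count_list (v @ [p]) = count_list u"
    using removable_exchange[OF u p] by blast
  have len: "length u = Suc (length v)" using count_list_eq_imp_length[OF v(2)] by simp
  \<comment> \<open>These two conditions concern letters beyond the swaps used in the transport, so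
    they commute with them. The transported tableau ends in the corner \<open>p\<close> of content
    \<open>b\<close>, which produces the consecutive contents \<open>b, a, b\<close>.\<close>
  define K where "K = {x. supported x \<and> eigen (length u) a x \<and> eigen (Suc (length u)) b x}"
  have "swap_closed (length u) K"
    unfolding swap_closed_def
  proof (intro ballI allI impI)
    fix x m and c :: real assume "x \<in> K" "Suc m < length u"
    then show "(\<lambda>g. swap m x g - c * x g) \<in> K"
      using N supported_swap[of m x] eigen_swap_commute[of "length u" a x m c]
        eigen_swap_commute[of "Suc (length u)" b x m c]
      by (simp add: K_def supported_def)
  qed
  then obtain x' where x': "x' \<in> K" "weight (v @ [p]) x'" "x' \<noteq> (\<lambda>_. 0)"
    using transport_nonzero[OF u v(1) v(2)[symmetric]] x nz unfolding K_def by blast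
  have "inc (count_list v) p = count_list u" using v(2) by (simp only: count_list_snoc)
  then have "count_list u p = Suc (count_list v p)" by (metis fun_upd_same inc_def)
  then have "box_content (v @ [p]) (length v) = b" using b by simp
  moreover have "eigen (length v) (box_content (v @ [p]) (length v)) x'"
    using x'(2) unfolding weight_def by (simp del: box_content_snoc_length)
  ultimately have "eigen (length v) b x'" by simp
  moreover have "(a - b)\<^sup>2 = 1" using ab by (simp add: power2_commute)
  ultimately show False
    using no_alternating_weight[of "length v" b x' a] x' N len by (simp add: K_def)
qed

text \<open>Induction on the number of eigenvalues. Let the word found so far end in
  \<open>i\<close>, with content \<open>a k\<close>, and let \<open>b\<close> be the next
  eigenvalue. If they are not adjacent, an intertwiner moves \<open>b\<close> one place forward, and
  the induction hypothesis shows that a box of content \<open>b\<close> was addable already before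
  \<open>i\<close>. If \<open>b\<close> is \<open>a k + 1\<close> or \<open>a k - 1\<close>, the box
  to add is to the right of or below the last one; were it not addable,
  \<open>alternating_imp_zero\<close> would apply.\<close>

theorem eigen_imp_lattice_word:
  assumes "n \<le> N" "supported x" "x \<noteq> (\<lambda>_. 0 :: real)" "\<And>m. m < n \<Longrightarrow> eigen m (a m) x"
  shows "\<exists>w. lattice_word w \<and> length w = n \<and> (\<forall>m<n. box_content w m = a m)"
  using assms
proof (induction n arbitrary: a x)
  case 0
  then show ?case by (intro exI[of _ "[]"]) (simp add: antimono_def)
next
  case (Suc n)
  obtain w where w: "lattice_word w" "length w = n" "\<forall>m<n. box_content w m = a m"
    using Suc.IH[of x a] Suc.prems by auto
  show ?case
  proof (cases w rule: rev_cases)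
    case Nil
    then have "n = 0" using w by simp
    obtain g where "x g \<noteq> 0" using Suc.prems(3) by auto
    \<comment> \<open>\<open>JM 0\<close> is an empty sum, so the first eigenvalue is 0, the content
      of the corner box.\<close>
    moreover have "eigen 0 (a 0) x" using Suc.prems(4) by simp
    then have "a 0 * x g = 0" by (metis (mono_tags) JM_def eigen_def lessThan_0 sum.empty)
    ultimately have "a 0 = 0" by simp
    moreover have "lattice_word [0]" by (simp add: lattice_from_single addable_def antimono_def)
    ultimately show ?thesis
      using \<open>n = 0\<close> by (intro exI[of _ "[0]"]) (simp add: box_content_def box_col_def)
  next
    case (snoc u i)
    have n: "n = Suc (length u)" using snoc w by simp
    define k where "k = length u"
    have lu: "lattice_word u" and i: "i \<in> addable (count_list u)"
      using w(1) by (simp_all add: snoc lattice_word_snoc)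
    have am: "antimono (count_list u)" using lattice_word_antimono lu by blast
    have ak: "a k = real (count_list u i) - real i"
      using w(3) n snoc by (auto simp: k_def)
    define b where "b = a n"
    have ek: "eigen k (a k) x" and en: "eigen (Suc k) b x"
      using Suc.prems(4)[of k] Suc.prems(4)[of n] n by (simp_all add: b_def k_def)
    have kN: "Suc k < N" using Suc.prems(1) n by (simp add: k_def)
    have cu: "box_content u m = a m" if "m < k" for m
      using w(3) that n box_content_append[of m u "[i]"] by (simp add: snoc k_def)
    have wu: "weight u x"
      unfolding weight_def using Suc.prems(4) cu n by (simp add: k_def)
    have extend: ?thesis
      if "j \<in> addable (count_list w)" "real (count_list w j) - real j = b" for j
    proof (intro exI conjI allI impI)
      show "lattice_word (w @ [j])" using w(1) that by (simp add: lattice_word_snoc)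
      show "length (w @ [j]) = Suc n" using w by simp
      fix m assume "m < Suc n"
      then show "box_content (w @ [j]) m = a m"
        using w that(2) box_content_append[of m w "[j]"] box_content_snoc_length[of w j]
        by (cases "m = n") (auto simp: b_def)
    qed
    have alt: False
      if "p \<in> removable (count_list u)" "real (count_list u p) - 1 - real p = b" "(b - a k)\<^sup>2 = 1" for p
      using alternating_imp_zero[OF lu that(1) Suc.prems(2) wu _ _ _ that(2,3)] ek en kN Suc.prems(3)
      by (simp add: k_def)
    have neq: "b \<noteq> a k"
      using eigen_equal_imp_zero[OF ek en] kN Suc.prems(2,3) by auto
    consider "(b - a k)\<^sup>2 \<noteq> 1" | "b = a k + 1" | "b = a k - 1"
      by (cases "(b - a k)\<^sup>2 = 1") (auto simp: power2_eq_1_iff)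
    then show ?thesis
    proof cases
      case 1
      \<comment> \<open>\<open>z\<close> has the same eigenvalues as \<open>x\<close> before
        \<open>k\<close>, so the word obtained for it has the prefix \<open>u\<close> again; its
        last letter \<open>j\<close> is the box of content \<open>b\<close>, and a row other than
        \<open>i\<close> stays addable after \<open>i\<close>.\<close>
      define z where "z = (\<lambda>g. swap k x g - 1 / (b - a k) * x g)"
      have nz: "z \<noteq> (\<lambda>_. 0)"
        using intertwiner_inj[OF ek en _ 1] neq Suc.prems(3) unfolding z_def by auto
      have sz: "supported z"
        using supported_swap[OF kN Suc.prems(2)] Suc.prems(2) by (simp add: z_def supported_def)
      have "eigen m ((a(k := b)) m) z" if "m < n" for m
        using that eigen_intertwiner(1)[OF ek en] neq
          eigen_swap_commute[OF Suc.prems(4)[of m], of k "1 / (b - a k)"] n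
        by (auto simp: z_def k_def)
      then obtain w' where w': "lattice_word w'" "length w' = n"
        "\<forall>m<n. box_content w' m = (a(k := b)) m"
        using Suc.IH[of z "a(k := b)"] Suc.prems(1) sz nz by auto
      then obtain u' j where u': "w' = u' @ [j]" using n by (cases w' rule: rev_cases) auto
      have "u' = u"
      proof (rule lattice_word_content_inj)
        show "lattice_word u'" using w' u' by (simp add: lattice_word_snoc)
        show len: "length u' = length u" using w' u' n by simp
        fix m assume "m < length u'"
        then show "box_content u' m = box_content u m"
          using w'(3) cu[of m] n len box_content_append[of m u' "[j]"] u' by (auto simp: k_def)
      qed (rule lu)
      then have j: "j \<in> addable (count_list u)" "real (count_list u j) - real j = b"
        using w' u' n box_content_snoc_length[of u j] by (auto simp: lattice_word_snoc k_def)
      then have "i \<noteq> j" using neq ak by auto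
      then show ?thesis
        using extend[of j] addable_inc[OF j(1), of i] j(2) by (simp add: snoc count_list_snoc[symmetric])
    next
      case 2
      have "i \<in> addable (count_list w)"
      proof (rule ccontr)
        assume "i \<notin> addable (count_list w)"
        then have i0: "i > 0" and "count_list u (i - 1) \<le> Suc (count_list u i)"
          by (auto simp: addable_def snoc)
        then have eq: "count_list u (i - 1) = Suc (count_list u i)"
          using i by (auto simp: addable_def)
        \<comment> \<open>The row above is longer by exactly one before \<open>i\<close> is added,
          so it ends in a corner of content \<open>a k + 1 = b\<close>.\<close>
        have "i - 1 \<in> removable (count_list u)" using eq i0 by (simp add: removable_def)
        moreover have "real (count_list u (i - 1)) - 1 - real (i - 1) = b"
          using eq i0 2 ak by (simp add: of_nat_diff)
        ultimately show False using alt 2 by simp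
      qed
      then show ?thesis using extend[of i] 2 ak snoc by simp
    next
      case 3
      have le: "count_list u (Suc i) \<le> count_list u i"
        using am unfolding antimono_iff_le_Suc by blast
      \<comment> \<open>Otherwise row \<open>i\<close>, before it grows, ends in a corner of content
        \<open>a k - 1 = b\<close>.\<close>
      have "count_list u (Suc i) = count_list u i"
      proof (rule ccontr)
        assume "count_list u (Suc i) \<noteq> count_list u i"
        then have "i \<in> removable (count_list u)" using le by (simp add: removable_def)
        then show False using alt[of i] 3 ak by simp
      qed
      then show ?thesis using extend[of "Suc i"] 3 ak snoc by (simp add: addable_def)
    qed
  qed
qed

end

section \<open>Simultaneous left and right weights\<close>

lemma content_same_row:
  "u ! m = u ! Suc m \<Longrightarrow> Suc m < length u \<Longrightarrow> box_content u (Suc m) = box_content u m + 1"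
  by (simp add: box_content_def box_col_def take_Suc_conv_app_nth)

text \<open>A box is added only below a filled one, so two consecutive boxes in one column are
  vertically adjacent: the second row is not above the first, and a row skipped between them would
  be too short.\<close>

lemma content_same_col:
  assumes "lattice_word v" "Suc m < length v" "box_col v m = box_col v (Suc m)"
  shows "box_content v (Suc m) = box_content v m - 1"
proof -
  define u where "u = take m v"
  define r where "r = v ! m"
  define r' where "r' = v ! Suc m"
  have v: "v = u @ [r, r'] @ drop (Suc (Suc m)) v"
    using assms(2) by (simp add: u_def r_def r'_def Cons_nth_drop_Suc)
  have lat: "lattice_word (u @ [r])" "r' \<in> addable (count_list (u @ [r]))" "lattice_word u"
    using assms(1) lattice_word_append[of "u @ [r, r']"] lattice_word_snoc[of "u @ [r]" r'] v
      lattice_word_snoc[of u r] by (metis append_Cons append_Nil append_assoc)+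
  have c: "count_list u r = count_list (u @ [r]) r'"
    using assms(2,3) by (simp add: box_col_def u_def r_def r'_def take_Suc_conv_app_nth)
  have am: "antimono (count_list u)" "antimono (count_list (u @ [r]))"
    using lat lattice_word_antimono by blast+
  have "r < r'"
  proof (rule ccontr)
    assume "\<not> r < r'"
    then have "count_list (u @ [r]) r \<le> count_list (u @ [r]) r'"
      using am(2) antimonoD by (metis leI)
    then show False using c by simp
  qed
  moreover have "\<not> Suc r < r'"
  proof
    assume *: "Suc r < r'"
    then have "count_list (u @ [r]) r' < count_list (u @ [r]) (Suc r)"
      by (rule addable_antimono_less[OF am(2) lat(2)])
    moreover have "count_list u (Suc r) \<le> count_list u r"
      using am(1) unfolding antimono_iff_le_Suc by blast
    ultimately show False using c by simp
  qed
  ultimately have "r' = Suc r" by simp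
  then show ?thesis using assms(3) by (simp add: box_content_def r_def r'_def)
qed

text \<open>Conjugating by adjacent transpositions writes \<open>(i j)\<close> as a product of an
  odd number of them, so the sign \<open>e\<close> appears to an odd power.\<close>

lemma (in transposition_action) block_sign:
  fixes x :: "'g \<Rightarrow> real"
  assumes "\<And>k. i \<le> k \<Longrightarrow> k < j \<Longrightarrow> swap k x = (\<lambda>g. e * x g)" "e * e = 1" "i < j"
  shows "x (t i j g) = e * x g"
  using assms(3,1)
proof (induction j arbitrary: g)
  case (Suc j)
  have s: "x (t j (Suc j) h) = e * x h" for h
    using fun_cong[OF Suc.prems(2)[of j], of h] Suc.prems(1) by (simp add: swap_def)
  show ?case
  proof (cases "i = j")
    case False
    then have ij: "i < j" using Suc.prems by simp
    have "x (t i (Suc j) g) = x (t j (Suc j) (t i j (t j (Suc j) g)))"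
      using t_conj_Suc'[OF ij, of "t j (Suc j) g"] by (simp add: t_t)
    also have "\<dots> = e * (e * (e * x g))"
      using Suc.IH[OF ij] Suc.prems(2) by (simp add: s)
    finally show ?thesis using assms(2) by (metis mult.assoc mult_1)
  qed (use s in simp)
qed simp

text \<open>A Young subgroup is generated by the transpositions within its blocks, the fibres of
  \<open>f\<close>: if \<open>p\<close> moves \<open>m\<close>, then
  \<open>transpose m (p m) \<circ> p\<close> fixes \<open>m\<close> and moves fewer points.\<close>

lemma block_perm_induct [consumes 2, case_names finite id transpose]:
  assumes "p permutes S" "\<forall>i\<in>S. f (p i) = f i" and "finite S"
    and "P id"
    and "\<And>i j p. i \<in> S \<Longrightarrow> j \<in> S \<Longrightarrow> i \<noteq> j \<Longrightarrow> f i = f j \<Longrightarrow> P p \<Longrightarrow> P (transpose i j \<circ> p)"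
  shows "P p"
  using assms(1,2)
proof (induction "card {i. p i \<noteq> i}" arbitrary: p rule: less_induct)
  case less
  have fin: "finite {i. p i \<noteq> i}"
    by (rule finite_subset[of _ S]) (use less.prems assms(3) in \<open>auto simp: permutes_def\<close>)
  show ?case
  proof (cases "p = id")
    case True
    then show ?thesis using assms(4) by simp
  next
    case False
    then obtain m where m: "p m \<noteq> m" by (auto simp: fun_eq_iff)
    then have mS: "m \<in> S" "p m \<in> S"
      using less.prems(1) by (auto simp: permutes_def permutes_in_image[OF less.prems(1)])
    define q where "q = transpose m (p m) \<circ> p"
    have pq: "p = transpose m (p m) \<circ> q" by (simp add: q_def o_assoc)
    have pinj: "inj p" using less.prems(1) permutes_inj by blast
    have "{i. q i \<noteq> i} \<subset> {i. p i \<noteq> i}"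
    proof
      show "{i. q i \<noteq> i} \<subseteq> {i. p i \<noteq> i}"
        using m injD[OF pinj] by (fastforce simp: q_def transpose_def split: if_splits)
      show "{i. q i \<noteq> i} \<noteq> {i. p i \<noteq> i}"
      proof -
        have "m \<notin> {i. q i \<noteq> i}" by (simp add: q_def)
        then show ?thesis using m by blast
      qed
    qed
    then have "card {i. q i \<noteq> i} < card {i. p i \<noteq> i}" using fin psubset_card_mono by blast
    moreover have "q permutes S"
      unfolding q_def using less.prems(1) mS by (intro permutes_compose permutes_swap_id)
    moreover have "\<forall>i\<in>S. f (q i) = f i"
    proof
      fix i assume that: "i \<in> S"
      show "f (q i) = f i"
      using less.prems(2)[rule_format, OF that] less.prems(2)[rule_format, OF mS(1)]
        by (auto simp: q_def transpose_def)
    qed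
    ultimately have "P q" using less.hyps by blast
    then show ?thesis
      using assms(5)[OF mS] m less.prems(2)[rule_format, OF mS(1)] pq by metis
  qed
qed

lemma card_slice:
  assumes "inj_on (\<lambda>m. (a m, b m)) S"
  shows "card {j. (i, j) \<in> (\<lambda>m. (a m, b m)) ` S} = card {m \<in> S. a m = i}"
    and "card {j. (j, i) \<in> (\<lambda>m. (a m, b m)) ` S} = card {m \<in> S. b m = i}"
proof -
  have "{j. (i, j) \<in> (\<lambda>m. (a m, b m)) ` S} = b ` {m \<in> S. a m = i}"
    "{j. (j, i) \<in> (\<lambda>m. (a m, b m)) ` S} = a ` {m \<in> S. b m = i}" by auto
  moreover have "inj_on b {m \<in> S. a m = i}" "inj_on a {m \<in> S. b m = i}"
    using assms by (auto simp: inj_on_def)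
  ultimately show "card {j. (i, j) \<in> (\<lambda>m. (a m, b m)) ` S} = card {m \<in> S. a m = i}"
    and "card {j. (j, i) \<in> (\<lambda>m. (a m, b m)) ` S} = card {m \<in> S. b m = i}"
    by (simp_all add: card_image)
qed

text \<open>The general setting counts letters from 0, permutations act on \<open>{1..n}\<close>;
  hence \<open>Suc\<close>.\<close>

definition left_act :: "nat \<Rightarrow> nat \<Rightarrow> (nat \<Rightarrow> nat) \<Rightarrow> nat \<Rightarrow> nat" where
  "left_act i j g = transpose (Suc i) (Suc j) \<circ> g"

definition right_act :: "nat \<Rightarrow> nat \<Rightarrow> (nat \<Rightarrow> nat) \<Rightarrow> nat \<Rightarrow> nat" where
  "right_act i j g = g \<circ> transpose (Suc i) (Suc j)"

lemma transpose_conj: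
  "transpose i j \<circ> transpose k l = transpose (transpose i j k) (transpose i j l) \<circ> transpose i j"
  by (auto simp: fun_eq_iff transpose_def)

lemma transpose_conj_Suc:
  "transpose (Suc i) (Suc j) \<circ> transpose (Suc k) (Suc l) =
    transpose (Suc (transpose i j k)) (Suc (transpose i j l)) \<circ> transpose (Suc i) (Suc j)"
  by (subst transpose_conj) (simp add: transpose_def)

locale regular_rep =
  fixes n :: nat
begin

definition G :: "(nat \<Rightarrow> nat) set" where
  "G = {g. g permutes {1..n}}"

sublocale L: transposition_action n G left_act
proof
  show "left_act i j g \<in> G" if "i < n" "j < n" "g \<in> G" for i j g
    using that unfolding left_act_def G_def mem_Collect_eq
    by (intro permutes_compose permutes_swap_id) auto
  show "left_act i j (left_act k l g) =
      left_act (transpose i j k) (transpose i j l) (left_act i j g)" for i j k l g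
    unfolding left_act_def o_assoc transpose_conj_Suc[of i j k l] ..
qed (simp_all add: G_def left_act_def o_assoc finite_permutations)

sublocale R: transposition_action n G right_act
proof
  show "right_act i j g \<in> G" if "i < n" "j < n" "g \<in> G" for i j g
    using that unfolding right_act_def G_def mem_Collect_eq
    by (intro permutes_compose permutes_swap_id) auto
  show "right_act i j (right_act k l g) =
      right_act (transpose i j k) (transpose i j l) (right_act i j g)" for i j k l g
  proof -
    \<comment> \<open>Right multiplication reverses products, so the conjugation rule is used on the
      already conjugated transposition, where conjugating once more restores the original.\<close>
    have e: "transpose (Suc k) (Suc l) \<circ> transpose (Suc i) (Suc j) = transpose (Suc i) (Suc j) \<circ>
      transpose (Suc (transpose i j k)) (Suc (transpose i j l))"
      using transpose_conj_Suc[of i j "transpose i j k" "transpose i j l"]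
      by (simp only: transpose_involutory)
    show ?thesis unfolding right_act_def o_assoc[symmetric] e ..
  qed
qed (simp_all add: G_def right_act_def o_assoc[symmetric] finite_permutations)

text \<open>One support condition serves both sides, since \<open>supported\<close> depends only on
  \<open>G\<close>.\<close>

definition biweight :: "nat list \<Rightarrow> nat list \<Rightarrow> ((nat \<Rightarrow> nat) \<Rightarrow> real) \<Rightarrow> bool" where
  "biweight u v x \<longleftrightarrow> L.supported x \<and> L.weight u x \<and> R.weight v x"

lemma biweight_permutes: "biweight u v x \<Longrightarrow> x g \<noteq> 0 \<Longrightarrow> g permutes {1..n}"
  unfolding biweight_def L.supported_def unfolding G_def by blast

lemma act_commute: "left_act i j (right_act k l g) = right_act k l (left_act i j g)"
  by (simp add: left_act_def right_act_def o_assoc)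

lemma JM_LR_commute: "L.JM a (R.JM b x) = R.JM b (L.JM a x)"
  unfolding L.JM_def R.JM_def act_commute by (subst sum.swap) simp

text \<open>Left and right multiplication commute, so the left tableau can be moved while the right
  weight is kept; \<open>swap_closed_L\<close> is the mirror image.\<close>

lemma swap_closed_R: "L.swap_closed n {x. L.supported x \<and> R.weight v x}"
  unfolding L.swap_closed_def
proof (intro ballI allI impI)
  fix x m and c :: real assume x: "x \<in> {x. L.supported x \<and> R.weight v x}" and m: "Suc m < n"
  have "R.JM k (L.swap m x) = L.swap m (R.JM k x)" for k
    by (simp add: R.JM_def L.swap_def act_commute)
  then have "R.weight v (\<lambda>g. L.swap m x g - c * x g)"
    using x by (simp add: R.weight_def R.eigen_def R.JM_diff L.swap_scale right_diff_distrib mult.left_commute)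
  then show "(\<lambda>g. L.swap m x g - c * x g) \<in> {x. L.supported x \<and> R.weight v x}"
    using x L.supported_swap[OF m, of x] by (simp add: L.supported_def)
qed

lemma swap_closed_L: "R.swap_closed n {x. L.supported x \<and> L.weight u x}"
  unfolding R.swap_closed_def
proof (intro ballI allI impI)
  fix x m and c :: real assume x: "x \<in> {x. L.supported x \<and> L.weight u x}" and m: "Suc m < n"
  have "L.JM k (R.swap m x) = R.swap m (L.JM k x)" for k
    by (simp add: L.JM_def R.swap_def act_commute)
  then have "L.weight u (\<lambda>g. R.swap m x g - c * x g)"
    using x by (simp add: L.weight_def L.eigen_def L.JM_diff R.swap_scale right_diff_distrib mult.left_commute)
  then show "(\<lambda>g. R.swap m x g - c * x g) \<in> {x. L.supported x \<and> L.weight u x}"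
    using x R.supported_swap[OF m, of x] by (simp add: L.supported_def)
qed

lemma transport_biweight:
  assumes "lattice_word u" "lattice_word u'" "count_list u = count_list u'" "length u = n"
    and "lattice_word v" "lattice_word v'" "count_list v = count_list v'" "length v = n"
    and x: "biweight u v x" and y: "biweight u v y"
  shows "\<exists>x' y'. biweight u' v' x' \<and> biweight u' v' y' \<and>
    (\<forall>c d. L.lin_comb c x' d y' = (\<lambda>_. 0) \<longrightarrow> L.lin_comb c x d y = (\<lambda>_. 0))"
proof -
  obtain x1 y1 where 1: "biweight u' v x1" "biweight u' v y1"
    "\<forall>c d. L.lin_comb c x1 d y1 = (\<lambda>_. 0) \<longrightarrow> L.lin_comb c x d y = (\<lambda>_. 0)"
    using L.transport[OF swap_steps_connected[OF assms(1-3)], of "{x. L.supported x \<and> R.weight v x}" x y]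
      swap_closed_R[of v] assms(4) x y by (auto simp: biweight_def)
  obtain x2 y2 where 2: "biweight u' v' x2" "biweight u' v' y2"
    "\<forall>c d. L.lin_comb c x2 d y2 = (\<lambda>_. 0) \<longrightarrow> L.lin_comb c x1 d y1 = (\<lambda>_. 0)"
    using R.transport[OF swap_steps_connected[OF assms(5-7)], of "{x. L.supported x \<and> L.weight u' x}" x1 y1]
      swap_closed_L[of u'] assms(8) 1 by (auto simp: biweight_def)
  show ?thesis using 1 2 by blast
qed

section \<open>Row symmetry on the left against column antisymmetry on the right\<close>

lemma card_positions:
  fixes w :: "nat list" assumes "length w = n"
  shows "card {m \<in> {1..n}. w ! (m - 1) = i} = card {j. (i, j) \<in> cells (count_list w)}"
    and "card {m \<in> {1..n}. box_col w (m - 1) = i} = card {j. (j, i) \<in> cells (count_list w)}"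
proof -
  have "bij_betw (\<lambda>m. m - 1) {1..n} {..<n}"
    by (rule bij_betw_byWitness[of _ Suc]) auto
  then have "bij_betw ((\<lambda>m. (w ! m, box_col w m)) \<circ> (\<lambda>m. m - 1)) {1..n} (cells (count_list w))"
    using bij_betw_trans bij_betw_box[of w] assms by blast
  then have inj: "inj_on (\<lambda>m. (w ! (m - 1), box_col w (m - 1))) {1..n}"
    and im: "cells (count_list w) = (\<lambda>m. (w ! (m - 1), box_col w (m - 1))) ` {1..n}"
    by (simp_all add: bij_betw_def o_def)
  show "card {m \<in> {1..n}. w ! (m - 1) = i} = card {j. (i, j) \<in> cells (count_list w)}"
    and "card {m \<in> {1..n}. box_col w (m - 1) = i} = card {j. (j, i) \<in> cells (count_list w)}"
    unfolding im by (simp_all only: card_slice[OF inj])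
qed

lemma count_list_ge_n: "lattice_word w \<Longrightarrow> length w = n \<Longrightarrow> i \<ge> n \<Longrightarrow> count_list w i = 0"
  using set_lattice_word[of w] by (force simp: count_list_0_iff)

context
  fixes u v :: "nat list"
  assumes u: "lattice_word u" "length u = n" "sorted u"
    and v: "lattice_word v" "length v = n"
    and v_sorted: "\<And>l m. l \<le> m \<Longrightarrow> m < n \<Longrightarrow> box_col v l \<le> box_col v m"
begin

text \<open>\<open>rw\<close> is meant for the values of a permutation, which left multiplication
  permutes, \<open>cl\<close> for its positions, which right multiplication permutes. Both count
  from 1.\<close>

definition "rw p = u ! (p - 1)"

definition "cl p = box_col v (p - 1)"

text \<open>In a sorted word the entries of one row are consecutive and their contents increase by
  1, so each swap inside the row fixes \<open>x\<close>.\<close>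

lemma row_invariant:
  assumes x: "biweight u v x" and ij: "i \<in> {1..n}" "j \<in> {1..n}" "rw i = rw j"
  shows "x (transpose i j \<circ> h) = x h"
proof -
  have l: "x (transpose i j \<circ> h) = x h"
    if ij: "1 \<le> i" "i < j" "j \<le> n" "rw i = rw j" for i j
  proof -
    have "L.swap k x = (\<lambda>g. 1 * x g)" if k: "i - 1 \<le> k" "k < j - 1" for k
    proof -
      have kn: "Suc k < n" using k ij by linarith
      have "u ! (i - 1) \<le> u ! k" "u ! k \<le> u ! Suc k" "u ! Suc k \<le> u ! (j - 1)"
        using u k ij kn by (auto intro!: sorted_nth_mono)
      then have eq: "u ! k = u ! Suc k" using ij(4) by (simp add: rw_def)
      have e: "L.eigen k (box_content u k) x" "L.eigen (Suc k) (box_content u (Suc k)) x"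
        using x u kn by (simp_all add: biweight_def L.weight_def)
      show ?thesis
        using L.swap_eigen_adjacent[OF e] content_same_row[OF eq] kn u x
        by (simp add: biweight_def)
    qed
    then have "x (left_act (i - 1) (j - 1) h) = 1 * x h"
      using ij by (intro L.block_sign) auto
    then show ?thesis using ij by (simp add: left_act_def)
  qed
  show ?thesis
  proof (cases i j rule: linorder_cases)
    case less
    then show ?thesis using l ij by simp
  next
    case greater
    then show ?thesis using l[of j i] ij by (simp add: transpose_commute)
  qed simp
qed

text \<open>When the columns are read in order, the entries of one column are consecutive and their
  contents decrease by 1, so each swap inside the column changes the sign.\<close>

lemma col_sign:
  assumes x: "biweight u v x" and ij: "i \<in> {1..n}" "j \<in> {1..n}" "cl i = cl j" "i \<noteq> j"
  shows "x (h \<circ> transpose i j) = - x h"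
proof -
  have less: "x (h \<circ> transpose i j) = - x h"
    if ij: "1 \<le> i" "i < j" "j \<le> n" "cl i = cl j" for i j
  proof -
    have "R.swap k x = (\<lambda>g. -1 * x g)" if k: "i - 1 \<le> k" "k < j - 1" for k
    proof -
      have kn: "Suc k < n" using k ij by linarith
      have "box_col v (i - 1) \<le> box_col v k" "box_col v k \<le> box_col v (Suc k)"
        "box_col v (Suc k) \<le> box_col v (j - 1)"
        using v_sorted k ij kn by auto
      then have eq: "box_col v k = box_col v (Suc k)" using ij(4) by (simp add: cl_def)
      have e: "R.eigen k (box_content v k) x" "R.eigen (Suc k) (box_content v (Suc k)) x"
        using x v kn by (simp_all add: biweight_def R.weight_def)
      show ?thesis
        using R.swap_eigen_adjacent[OF e] content_same_col[OF v(1) _ eq] kn v x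
        by (simp add: biweight_def)
    qed
    then have "x (right_act (i - 1) (j - 1) h) = -1 * x h"
      using ij by (intro R.block_sign) auto
    then show ?thesis using ij by (simp add: right_act_def)
  qed
  show ?thesis
  proof (cases "i < j")
    case True
    then show ?thesis using less ij by simp
  next
    case False
    then show ?thesis using less[of j i] ij by (simp add: transpose_commute)
  qed
qed

text \<open>If two positions in one column carry values in one row, exchanging the positions is the
  same as exchanging the values; one description changes the sign of \<open>x g\<close>, the other
  does not.\<close>

lemma points_inj:
  assumes x: "biweight u v x" and g: "x g \<noteq> 0"
  shows "inj_on (\<lambda>m. (rw (g m), cl m)) {1..n}"
proof (rule inj_onI, rule ccontr)
  fix i j assume ij: "i \<in> {1..n}" "j \<in> {1..n}" "(rw (g i), cl i) = (rw (g j), cl j)" "i \<noteq> j"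
  have gG: "g permutes {1..n}" using biweight_permutes[OF x g] .
  have "transpose (g i) (g j) \<circ> g = g \<circ> transpose i j"
    using permutes_inj[OF gG] by (auto simp: fun_eq_iff transpose_def inj_eq)
  moreover have "x (transpose (g i) (g j) \<circ> g) = x g"
    using ij permutes_in_image[OF gG] by (intro row_invariant[OF x]) auto
  moreover have "x (g \<circ> transpose i j) = - x g"
    using ij by (intro col_sign[OF x]) auto
  ultimately show False using g by simp
qed

text \<open>A permutation takes each value once, so each row is met as often as in the diagram of
  \<open>u\<close>; the columns belong to the positions and are independent of
  \<open>g\<close>.\<close>

lemma points_card:
  assumes "g permutes {1..n}" and inj: "inj_on (\<lambda>m. (rw (g m), cl m)) {1..n}"
  shows "card {j. (i, j) \<in> (\<lambda>m. (rw (g m), cl m)) ` {1..n}} = count_list u i"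
    and "card {j. (j, i) \<in> (\<lambda>m. (rw (g m), cl m)) ` {1..n}} =
      card {j. (j, i) \<in> cells (count_list v)}"
proof -
  have "bij_betw g {m \<in> {1..n}. rw (g m) = i} {m \<in> {1..n}. rw m = i}"
    using permutes_in_image[OF assms(1)] permutes_in_image[OF permutes_inv[OF assms(1)]]
      permutes_inverses[OF assms(1)]
    by (intro bij_betw_byWitness[of _ "inv_into UNIV g"]) auto
  then have "card {m \<in> {1..n}. rw (g m) = i} = card {m \<in> {1..n}. rw m = i}"
    by (rule bij_betw_same_card)
  also have "\<dots> = count_list u i"
    using card_positions(1)[OF u(2), of i] by (simp add: rw_def cells_def)
  finally show "card {j. (i, j) \<in> (\<lambda>m. (rw (g m), cl m)) ` {1..n}} = count_list u i"
    by (simp only: card_slice[OF inj])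
  show "card {j. (j, i) \<in> (\<lambda>m. (rw (g m), cl m)) ` {1..n}} =
      card {j. (j, i) \<in> cells (count_list v)}"
    unfolding card_slice(2)[OF inj] unfolding cl_def by (rule card_positions(2)[OF v(2)])
qed

lemma biweight_dominance:
  assumes "biweight u v x" "x \<noteq> (\<lambda>_. 0)"
  shows "(\<Sum>i<n. min (count_list v i) J) \<le> (\<Sum>i<n. min (count_list u i) J)"
proof -
  obtain g where g: "x g \<noteq> 0" using assms(2) by auto
  then have gG: "g permutes {1..n}" using biweight_permutes[OF assms(1)] by blast
  note inj = points_inj[OF assms(1) g]
  show ?thesis
    by (rule dominance[OF _ points_card[OF gG inj]]) (use count_list_ge_n u v in auto)
qed

text \<open>By \<open>points_eq_cells\<close> both permutations fill the whole diagram with their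
  points. Matching equal points gives \<open>q\<close>, which preserves columns, and what remains on
  the left is \<open>p\<close>, which preserves rows.\<close>

lemma ex_double_coset:
  assumes g: "g permutes {1..n}" "inj_on (\<lambda>m. (rw (g m), cl m)) {1..n}"
    and h: "h permutes {1..n}" "inj_on (\<lambda>m. (rw (h m), cl m)) {1..n}"
    and uv: "count_list u = count_list v"
  shows "\<exists>p q. p permutes {1..n} \<and> q permutes {1..n} \<and> h = p \<circ> g \<circ> q \<and>
    (\<forall>i\<in>{1..n}. rw (p i) = rw i) \<and> (\<forall>i\<in>{1..n}. cl (q i) = cl i)"
proof -
  let ?F = "\<lambda>g m. (rw (g m), cl m)"
  have im: "?F g ` {1..n} = cells (count_list u)" if "g permutes {1..n}" "inj_on (?F g) {1..n}" for g
    by (rule points_eq_cells[OF _ points_card[OF that], where N = n])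
      (use count_list_ge_n u v uv in auto)
  define q0 where "q0 m = inv_into {1..n} (?F g) (?F h m)" for m
  have q0: "q0 m \<in> {1..n}" "?F g (q0 m) = ?F h m" if "m \<in> {1..n}" for m
  proof -
    have 1: "?F h m \<in> ?F g ` {1..n}" using im[OF g] im[OF h] that by blast
    show "q0 m \<in> {1..n}" unfolding q0_def by (rule inv_into_into[OF 1])
    show "?F g (q0 m) = ?F h m" unfolding q0_def using f_inv_into_f[OF 1] .
  qed
  have "inj_on q0 {1..n}"
  proof (rule inj_onI)
    fix a b assume ab: "a \<in> {1..n}" "b \<in> {1..n}" "q0 a = q0 b"
    then have "?F h a = ?F h b" using q0 by metis
    then show "a = b" using h(2) ab by (meson inj_onD)
  qed
  moreover have "q0 ` {1..n} \<subseteq> {1..n}" using q0 by blast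
  ultimately have "bij_betw q0 {1..n} {1..n}"
    by (simp add: bij_betw_def card_image card_subset_eq)
  define q where "q m = (if m \<in> {1..n} then q0 m else m)" for m
  have q: "q permutes {1..n}"
  proof (rule bij_imp_permutes)
    show "bij_betw q {1..n} {1..n}"
      using \<open>bij_betw q0 {1..n} {1..n}\<close> by (rule bij_betw_cong[THEN iffD1, rotated]) (simp add: q_def)
  qed (simp only: q_def if_False)
  define p where "p = h \<circ> inv_into UNIV q \<circ> inv_into UNIV g"
  have p: "p permutes {1..n}"
    unfolding p_def using g(1) h(1) q by (intro permutes_compose permutes_inv)
  have "h = p \<circ> g \<circ> q"
    using permutes_inv_o[OF g(1)] permutes_inv_o[OF q] by (simp add: p_def o_assoc[symmetric])
  moreover have "rw (p i) = rw i" if "i \<in> {1..n}" for i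
  proof -
    define m where "m = inv_into UNIV q (inv_into UNIV g i)"
    have m: "m \<in> {1..n}" "g (q m) = i"
      using that permutes_inverses[OF g(1)] permutes_inverses[OF q]
        permutes_in_image[OF permutes_inv[OF g(1)]] permutes_in_image[OF permutes_inv[OF q]]
      by (simp_all add: m_def)
    have "p i = h m" by (simp add: p_def m_def)
    then show ?thesis using q0(2)[OF m(1)] m by (simp add: q_def)
  qed
  moreover have "cl (q i) = cl i" if "i \<in> {1..n}" for i
    using q0(2)[OF that] that by (simp add: q_def)
  ultimately show ?thesis using p q by blast
qed

text \<open>Where one of the functions is nonzero, both values are those at the fixed
  \<open>g\<close> times a common factor, by the double coset decomposition. The combination with
  coefficients \<open>y g\<close> and \<open>- x g\<close> therefore vanishes everywhere.\<close>

lemma biweight_sorted_dependent: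
  assumes x: "biweight u v x" and y: "biweight u v y" and uv: "count_list u = count_list v"
  shows "\<exists>c d. (c, d) \<noteq> (0, 0) \<and> L.lin_comb c x d y = (\<lambda>_. 0)"
proof (cases "x = (\<lambda>_. 0)")
  case True
  then show ?thesis by (intro exI[of _ 1] exI[of _ 0]) (simp add: L.lin_comb_def)
next
  case False
  then obtain g where g: "x g \<noteq> 0" by auto
  note G = biweight_permutes
  have "y g * x h + - x g * y h = 0" for h
  proof (cases "x h = 0 \<and> y h = 0")
    case False
    then have h: "h permutes {1..n}" "inj_on (\<lambda>m. (rw (h m), cl m)) {1..n}"
      using G[OF x] G[OF y] points_inj[OF x] points_inj[OF y] by blast+
    obtain p q where p: "p permutes {1..n}" "\<forall>i\<in>{1..n}. rw (p i) = rw i"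
      and q: "q permutes {1..n}" "\<forall>i\<in>{1..n}. cl (q i) = cl i" and hpq: "h = p \<circ> g \<circ> q"
      using ex_double_coset[OF G[OF x g] points_inj[OF x g] h uv]
      by (elim exE conjE, intro that)
    have left: "\<forall>x h. biweight u v x \<longrightarrow> x (p \<circ> h) = x h"
      using p
    proof (induction p rule: block_perm_induct)
      case (transpose i j p)
      then show ?case using row_invariant by (metis o_assoc)
    qed auto
    \<comment> \<open>The factor is quantified before the function: it depends only on
      \<open>q\<close>, so \<open>x\<close> and \<open>y\<close> share it.\<close>
    have "\<exists>s. \<forall>x h. biweight u v x \<longrightarrow> x (h \<circ> q) = s * x h"
      using q
    proof (induction q rule: block_perm_induct)
      case id
      then show ?case by (intro exI[of _ 1]) simp
    next
      case (transpose i j q)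
      then obtain s where s: "\<forall>x h. biweight u v x \<longrightarrow> x (h \<circ> q) = s * x h" by blast
      have "x (h \<circ> (transpose i j \<circ> q)) = - s * x h" if "biweight u v x" for x h
      proof -
        have "x (h \<circ> (transpose i j \<circ> q)) = s * x (h \<circ> transpose i j)"
          using s that by (simp only: o_assoc)
        then show ?thesis using col_sign[OF that transpose(1,2,4,3), of h] by simp
      qed
      then show ?case by blast
    qed simp
    then obtain s where s: "\<forall>x h. biweight u v x \<longrightarrow> x (h \<circ> q) = s * x h" by blast
    have "x h = s * x g" "y h = s * y g"
      using s left x y by (simp_all add: hpq comp_assoc)
    then show ?thesis by simp
  qed simp
  then have "L.lin_comb (y g) x (- x g) y = (\<lambda>_. 0)" by (simp add: L.lin_comb_def)
  then show ?thesis using g by (intro exI[of _ "y g"] exI[of _ "- x g"]) simp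
qed

end

text \<open>Inversion of permutations interchanges the two actions. This makes the dominance
  inequality available in both directions.\<close>

lemma ex_biweight_inverse:
  assumes x: "biweight u v x" "x \<noteq> (\<lambda>_. 0)" and len: "length u = n" "length v = n"
  shows "\<exists>y. biweight v u y \<and> y \<noteq> (\<lambda>_. 0)"
proof -
  define y where "y g = (if g \<in> G then x (inv_into UNIV g) else 0)" for g
  have supp: "L.supported y" unfolding L.supported_def by (simp add: y_def)
  have inv: "y (inv_into UNIV g) = x g" if "g \<in> G" for g
    using that permutes_inv[of g "{1..n}"] permutes_inv_inv[of g "{1..n}"] by (simp add: y_def G_def)
  have invG: "inv_into UNIV g \<in> G" if "g \<in> G" for g
    using that permutes_inv by (auto simp: G_def)
  have inv_inv: "inv_into UNIV (inv_into UNIV g) = g" if "g \<in> G" for g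
    using that permutes_inv_inv by (auto simp: G_def)
  have act: "inv_into UNIV (left_act i j g) = right_act i j (inv_into UNIV g)" if "g \<in> G" for i j g
    using that permutes_bij[of g "{1..n}"]
    by (simp add: left_act_def right_act_def G_def o_inv_distrib)
  have act': "inv_into UNIV (right_act i j g) = left_act i j (inv_into UNIV g)" if "g \<in> G" for i j g
    using that permutes_bij[of g "{1..n}"]
    by (simp add: left_act_def right_act_def G_def o_inv_distrib)
  have L: "L.eigen m c y" if "R.eigen m c x" "m < n" for m c
    unfolding L.eigen_def
  proof
    fix g
    show "L.JM m y g = c * y g"
    proof (cases "g \<in> G")
      case True
      have "L.JM m y g = R.JM m x (inv_into UNIV g)"
        unfolding L.JM_def R.JM_def
        using that True by (intro sum.cong refl) (simp add: y_def L.t_closed act)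
      then show ?thesis using that True by (simp add: R.eigen_def y_def)
    next
      case False
      then show ?thesis using L.supported_JM[OF that(2) supp] supp by (simp add: L.supported_def)
    qed
  qed
  have R: "R.eigen m c y" if "L.eigen m c x" "m < n" for m c
    unfolding R.eigen_def
  proof
    fix g
    show "R.JM m y g = c * y g"
    proof (cases "g \<in> G")
      case True
      have "R.JM m y g = L.JM m x (inv_into UNIV g)"
        unfolding L.JM_def R.JM_def
        using that True by (intro sum.cong refl) (simp add: y_def R.t_closed act')
      then show ?thesis using that True by (simp add: L.eigen_def y_def)
    next
      case False
      then show ?thesis using R.supported_JM[OF that(2) supp] supp by (simp add: L.supported_def)
    qed
  qed
  have "biweight v u y"
    using x(1) len supp L R by (simp add: biweight_def L.weight_def R.weight_def)
  moreover obtain g where "x g \<noteq> 0" using x(2) by auto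
  then have "y (inv_into UNIV g) \<noteq> 0"
    using inv[of g] biweight_permutes[OF x(1)] by (simp add: G_def)
  ultimately show ?thesis by (metis (no_types))
qed

text \<open>Transport to the two sorted words keeps both shapes and keeps the function nonzero, so
  \<open>biweight_dominance\<close> becomes applicable.\<close>

lemma biweight_sum_min_le:
  assumes u: "lattice_word u" "length u = n" and v: "lattice_word v" "length v = n"
    and x: "biweight u v x" "x \<noteq> (\<lambda>_. 0)"
  shows "(\<Sum>i<n. min (count_list v i) J) \<le> (\<Sum>i<n. min (count_list u i) J)"
proof -
  obtain u' where u': "lattice_word u'" "count_list u' = count_list u" "sorted u'"
    using ex_row_sorted_word u by blast
  obtain v' where v': "lattice_word v'" "count_list v' = count_list v"
    "\<forall>l m. l \<le> m \<longrightarrow> m < length v' \<longrightarrow> box_col v' l \<le> box_col v' m"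
    using ex_col_sorted_word v by blast
  have len: "length u' = n" "length v' = n"
    using count_list_eq_imp_length[OF u'(2)] count_list_eq_imp_length[OF v'(2)] u v by simp_all
  obtain x' where x': "biweight u' v' x'"
    "\<forall>c d. \<exists>y'. L.lin_comb c x' d y' = (\<lambda>_. 0) \<longrightarrow> L.lin_comb c x d x = (\<lambda>_. 0)"
    using transport_biweight[OF u(1) u'(1) u'(2)[symmetric] u(2) v(1) v'(1) v'(2)[symmetric] v(2) x(1) x(1)]
    by blast
  have "x' \<noteq> (\<lambda>_. 0)"
  proof
    assume "x' = (\<lambda>_. 0)"
    then have "L.lin_comb 1 x 0 x = (\<lambda>_. 0)"
      using x'(2)[rule_format, of 1 0] by (simp add: L.lin_comb_def)
    then show False using x(2) by (simp add: L.lin_comb_def)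
  qed
  then show ?thesis
    using biweight_dominance[OF u'(1) len(1) u'(3) v'(1) len(2) _ x'(1)] v'(3) len
    by (simp add: u'(2) v'(2))
qed

theorem biweight_same_shape:
  assumes u: "lattice_word u" "length u = n" and v: "lattice_word v" "length v = n"
    and x: "biweight u v x" "x \<noteq> (\<lambda>_. 0)"
  shows "count_list u = count_list v"
proof -
  obtain y where y: "biweight v u y" "y \<noteq> (\<lambda>_. 0)"
    using ex_biweight_inverse[OF x u(2) v(2)] by blast
  show ?thesis
    by (rule sum_min_eq_imp_eq[where N = n])
      (use lattice_word_antimono count_list_ge_n u v
        biweight_sum_min_le[OF u v x] biweight_sum_min_le[OF v u y] in \<open>auto intro: antisym\<close>)
qed

theorem biweight_unique:
  assumes u: "lattice_word u" "length u = n" and v: "lattice_word v" "length v = n"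
    and uv: "count_list u = count_list v"
    and x: "biweight u v x" "x \<noteq> (\<lambda>_. 0)" and y: "biweight u v y"
  shows "\<exists>c. y = (\<lambda>g. c * x g)"
proof -
  obtain u' where u': "lattice_word u'" "count_list u' = count_list u" "sorted u'"
    using ex_row_sorted_word u by blast
  obtain v' where v': "lattice_word v'" "count_list v' = count_list v"
    "\<forall>l m. l \<le> m \<longrightarrow> m < length v' \<longrightarrow> box_col v' l \<le> box_col v' m"
    using ex_col_sorted_word v by blast
  have len: "length u' = n" "length v' = n"
    using count_list_eq_imp_length[OF u'(2)] count_list_eq_imp_length[OF v'(2)] u v by simp_all
  obtain x' y' where xy': "biweight u' v' x'" "biweight u' v' y'"
    "\<forall>c d. L.lin_comb c x' d y' = (\<lambda>_. 0) \<longrightarrow> L.lin_comb c x d y = (\<lambda>_. 0)"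
    using transport_biweight[OF u(1) u'(1) u'(2)[symmetric] u(2) v(1) v'(1) v'(2)[symmetric] v(2) x(1) y]
    by blast
  obtain c d where cd: "(c, d) \<noteq> (0, 0)" "L.lin_comb c x' d y' = (\<lambda>_. 0)"
    using biweight_sorted_dependent[OF u'(1) len(1) u'(3) v'(1) len(2) _ xy'(1,2)] v'(3) len uv
    by (auto simp: u'(2) v'(2))
  then have lc: "c * x g + d * y g = 0" for g
    using xy'(3) by (metis L.lin_comb_def)
  have "d \<noteq> 0"
  proof
    assume "d = 0"
    then have "x = (\<lambda>_. 0)" using lc cd(1) by auto
    then show False using x(2) by blast
  qed
  then have "y g = - c / d * x g" for g
    using lc[of g] by (simp add: field_simps)
  then show ?thesis by blast
qed

end

section \<open>Completeness of the joint eigenfunctions\<close>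

context
  fixes A :: "('g \<Rightarrow> complex) \<Rightarrow> 'g \<Rightarrow> complex"
  assumes lin: "\<And>c x d y. A (\<lambda>g. c * x g + d * y g) = (\<lambda>g. c * A x g + d * A y g)"
begin

lemma lin_zero: "A (\<lambda>_. 0) = (\<lambda>_. 0)"
  using lin[of 0 "\<lambda>_. 0" 0 "\<lambda>_. 0"] by simp

text \<open>The polynomial \<open>p\<close> evaluated at the operator \<open>A\<close> and applied
  to \<open>v\<close>, by Horner's scheme.\<close>

definition poly_op :: "('g \<Rightarrow> complex) \<Rightarrow> complex poly \<Rightarrow> 'g \<Rightarrow> complex" where
  "poly_op v p = fold_coeffs (\<lambda>a f g. a * v g + A f g) p (\<lambda>_. 0)"

lemma poly_op_0: "poly_op v 0 = (\<lambda>_. 0)"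
  by (simp add: poly_op_def)

lemma poly_op_pCons: "poly_op v (pCons a p) = (\<lambda>g. a * v g + A (poly_op v p) g)"
  by (cases "p = 0 \<and> a = 0") (auto simp: poly_op_def lin_zero)

lemma poly_op_lin: "poly_op v (Polynomial.smult c p + Polynomial.smult d q) = (\<lambda>g. c * poly_op v p g + d * poly_op v q g)"
proof (induction p q rule: poly_induct2)
  case 0
  then show ?case by (simp add: poly_op_0)
next
  case (pCons a p b q)
  then show ?case by (simp add: poly_op_pCons lin algebra_simps)
qed

lemma poly_op_factor: "poly_op v ([:- z, 1:] * p) = (\<lambda>g. A (poly_op v p) g - z * poly_op v p g)"
proof -
  have "[:- z, 1:] * p = Polynomial.smult 1 (pCons 0 p) + Polynomial.smult (- z) p" by simp
  then show ?thesis using poly_op_lin[of v 1 "pCons 0 p" "- z" p] by (simp add: poly_op_pCons)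
qed

lemma poly_op_Poly:
  "poly_op v (Poly cs) = (\<lambda>g. \<Sum>i<length cs. cs ! i * (A ^^ i) v g)"
proof (induction cs)
  case (Cons c cs)
  have sum: "A (\<lambda>g. \<Sum>i<m. f i * y i g) = (\<lambda>g. \<Sum>i<m. f i * A (y i) g)"
    for f and y :: "nat \<Rightarrow> 'g \<Rightarrow> complex" and m
  proof (induction m)
    case (Suc m)
    then show ?case using lin[of 1 "\<lambda>g. \<Sum>i<m. f i * y i g" "f m" "y m"] by simp
  qed (simp add: lin_zero)
  show ?case
    by (simp add: poly_op_pCons Cons.IH sum sum.lessThan_Suc_shift del: sum.lessThan_Suc)
qed (simp add: poly_op_0)

lemma ex_annihilating_poly:
  assumes fin: "finite S" and supp: "\<And>i g. g \<notin> S \<Longrightarrow> (A ^^ i) v g = 0"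
  shows "\<exists>p. p \<noteq> 0 \<and> poly_op v p = (\<lambda>_. 0)"
proof -
  define N where "N = card S"
  obtain e where e: "bij_betw e {0..<N} S" using ex_bij_betw_nat_finite[OF fin] N_def by blast
  \<comment> \<open>The columns are \<open>v\<close>, \<open>A v\<close>, and so on, one more than
    the points of \<open>S\<close>. A zero row makes the matrix square, so its determinant vanishes
    and a kernel vector gives the coefficients.\<close>
  define M where "M = mat\<^sub>r (Suc N) (Suc N)
    (\<lambda>i. if i = N then 0\<^sub>v (Suc N) else vec (Suc N) (\<lambda>j. (A ^^ j) v (e i)))"
  have M: "M \<in> carrier_mat (Suc N) (Suc N)" by (simp add: M_def)
  have "det M = 0" unfolding M_def by (rule det_row_0) auto
  then obtain z where z: "z \<in> carrier_vec (Suc N)" "z \<noteq> 0\<^sub>v (Suc N)" "M *\<^sub>v z = 0\<^sub>v (Suc N)"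
    using det_0_iff_vec_prod_zero_field[OF M] by blast
  define cs where "cs = map (\<lambda>i. z $ i) [0..<Suc N]"
  obtain i where i: "i < Suc N" "z $ i \<noteq> 0" using z(1,2) by (metis carrier_vecD eq_vecI index_zero_vec)
  have "coeff (Poly cs) i = z $ i"
    using i(1) by (simp add: coeff_Poly_eq cs_def nth_default_def del: upt_Suc)
  then have "Poly cs \<noteq> 0" using i(2) by (metis coeff_0)
  moreover have "poly_op v (Poly cs) g = 0" for g
  proof (cases "g \<in> S")
    case True
    then obtain k where k: "k < N" "g = e k" using e by (auto simp: bij_betw_def)
    have "poly_op v (Poly cs) g = (\<Sum>i<Suc N. z $ i * (A ^^ i) v (e k))"
      unfolding poly_op_Poly k by (intro sum.cong) (simp_all add: cs_def del: upt_Suc)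
    also have "\<dots> = (M *\<^sub>v z) $ k"
      using k z(1) by (simp add: M_def scalar_prod_def atLeast0LessThan mult.commute del: sum.lessThan_Suc)
    also have "\<dots> = 0" using z(3) k by simp
    finally show ?thesis .
  next
    case False
    then show ?thesis unfolding poly_op_Poly using supp by simp
  qed
  ultimately show ?thesis by blast
qed

text \<open>In an annihilating polynomial of least degree, split off a root \<open>z\<close>: by
  minimality the cofactor does not annihilate \<open>v\<close>, and what it produces from
  \<open>v\<close> is an eigenvector for \<open>z\<close> that stays in \<open>K\<close>.\<close>

lemma ex_eigenvector:
  assumes fin: "finite S" and supp: "\<And>x g. x \<in> K \<Longrightarrow> g \<notin> S \<Longrightarrow> x g = 0"
    and K: "\<And>x y c d. x \<in> K \<Longrightarrow> y \<in> K \<Longrightarrow> (\<lambda>g. c * x g + d * y g) \<in> K"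
    and AK: "\<And>x. x \<in> K \<Longrightarrow> A x \<in> K"
    and v: "v \<in> K" "v \<noteq> (\<lambda>_. 0)"
  shows "\<exists>w\<in>K. w \<noteq> (\<lambda>_. 0) \<and> (\<exists>c. A w = (\<lambda>g. c * w g))"
proof -
  have zero: "(\<lambda>_. 0) \<in> K" using K[OF v(1) v(1), of 0 0] by simp
  have opK: "poly_op v p \<in> K" for p
  proof (induction p)
    case (pCons a p)
    then show ?case using K[OF v(1) AK[OF pCons(2)], of a 1] by (simp add: poly_op_pCons)
  qed (simp add: poly_op_0 zero)
  have "(A ^^ i) v \<in> K" for i by (induction i) (auto simp: v AK)
  then have "\<exists>p. p \<noteq> 0 \<and> poly_op v p = (\<lambda>_. 0)"
    using ex_annihilating_poly[OF fin] supp by blast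
  then obtain p where p: "p \<noteq> 0 \<and> poly_op v p = (\<lambda>_. 0)"
    and min: "\<And>q. q \<noteq> 0 \<and> poly_op v q = (\<lambda>_. 0) \<Longrightarrow> degree p \<le> degree q"
    using ex_has_least_nat[of "\<lambda>p. p \<noteq> 0 \<and> poly_op v p = (\<lambda>_. 0)" _ degree] by metis
  have "degree p \<noteq> 0"
  proof
    assume "degree p = 0"
    then obtain c where c: "p = [:c:]" using degree_eq_zeroE by blast
    then have "poly_op v p = (\<lambda>g. c * v g)"
      by (simp add: poly_op_pCons poly_op_0 lin_zero)
    then show False using p c v(2) by (auto simp: fun_eq_iff)
  qed
  then have "\<not> constant (poly p)" by (simp add: constant_degree)
  then obtain z where "poly p z = 0"
    using fundamental_theorem_of_algebra by blast
  then obtain q where q: "p = [:- z, 1:] * q" using poly_eq_0_iff_dvd by (metis dvdE)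
  then have q0: "q \<noteq> 0" using p by auto
  then have "degree p = Suc (degree q)" using q by (simp add: degree_mult_eq del: mult_pCons_left)
  then have "poly_op v q \<noteq> (\<lambda>_. 0)" using min[of q] q0 by auto
  moreover have "A (poly_op v q) = (\<lambda>g. z * poly_op v q g)"
    using p poly_op_factor[of v z q] unfolding q by (auto simp: fun_eq_iff)
  ultimately show ?thesis using opK by blast
qed

end

lemma ex_joint_eigenvector:
  fixes As :: "(('g \<Rightarrow> complex) \<Rightarrow> 'g \<Rightarrow> complex) list"
  assumes "finite S"
    and "\<And>A c x d y. A \<in> set As \<Longrightarrow> A (\<lambda>g. c * x g + d * y g) = (\<lambda>g. c * A x g + d * A y g)"
    and "\<And>A B x. A \<in> set As \<Longrightarrow> B \<in> set As \<Longrightarrow> A (B x) = B (A x)"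
    and "\<And>x g. x \<in> K \<Longrightarrow> g \<notin> S \<Longrightarrow> x g = 0"
    and "\<And>x y c d. x \<in> K \<Longrightarrow> y \<in> K \<Longrightarrow> (\<lambda>g. c * x g + d * y g) \<in> K"
    and "\<And>A x. A \<in> set As \<Longrightarrow> x \<in> K \<Longrightarrow> A x \<in> K"
    and "v \<in> K" "v \<noteq> (\<lambda>_. 0)"
  shows "\<exists>w\<in>K. w \<noteq> (\<lambda>_. 0) \<and> (\<forall>A\<in>set As. \<exists>c. A w = (\<lambda>g. c * w g))"
  using assms(2-)
proof (induction As arbitrary: K v)
  case (Cons A As)
  obtain w c where w: "w \<in> K" "w \<noteq> (\<lambda>_. 0)" "A w = (\<lambda>g. c * w g)"
    using ex_eigenvector[of A S K v] assms(1) Cons.prems by auto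
  \<comment> \<open>An eigenspace of \<open>A\<close> within \<open>K\<close> is invariant under the
    operators commuting with \<open>A\<close>, so the search continues inside it.\<close>
  define K' where "K' = {x \<in> K. A x = (\<lambda>g. c * x g)}"
  have "\<exists>w\<in>K'. w \<noteq> (\<lambda>_. 0) \<and> (\<forall>A\<in>set As. \<exists>c. A w = (\<lambda>g. c * w g))"
  proof (rule Cons.IH[of K' w])
    show "B x \<in> K'" if "B \<in> set As" "x \<in> K'" for B x
    proof -
      have "A (B x) = B (A x)" using Cons.prems(2)[of A B] that by simp
      also have "\<dots> = B (\<lambda>g. c * x g + 0 * x g)" using that by (simp add: K'_def)
      also have "\<dots> = (\<lambda>g. c * B x g)" using Cons.prems(1)[of B c x 0 x] that by simp
      finally show ?thesis using Cons.prems(5)[of B x] that by (simp add: K'_def)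
    qed
    show "(\<lambda>g. a * x g + b * y g) \<in> K'" if "x \<in> K'" "y \<in> K'" for x y a b
      using that Cons.prems(1)[of A a x b y] Cons.prems(4)[of x y a b]
      by (simp add: K'_def algebra_simps)
  qed (use Cons.prems w in \<open>auto simp: K'_def\<close>)
  then show ?case by (auto simp: K'_def)
next
  case Nil
  then show ?case by (metis empty_iff empty_set)
qed

section \<open>From complex back to real eigenfunctions\<close>

lemma (in transposition_action) JM_of_real:
  "JM m (\<lambda>g. complex_of_real (y g)) = (\<lambda>g. of_real (JM m y g))"
  by (simp add: JM_def)

text \<open>The operators are real and symmetric: pairing \<open>w\<close> with its conjugate shows
  that \<open>a\<close> equals its own conjugate, and a real operator with real eigenvalue respects
  real and imaginary parts.\<close>

lemma (in transposition_action) eigen_complex_real: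
  fixes w :: "'g \<Rightarrow> complex"
  assumes "eigen m a w" "m < N" "supported w" "w \<noteq> (\<lambda>_. 0)"
  shows "a \<in> \<real>" "eigen m (Re a) (\<lambda>g. Re (w g))" "eigen m (Re a) (\<lambda>g. Im (w g))"
proof -
  obtain h where h: "w h \<noteq> 0" "h \<in> G"
    using assms(3,4) unfolding supported_def by (meson ext)
  have norm: "ip w (\<lambda>g. cnj (w g)) = of_real (\<Sum>g\<in>G. (cmod (w g))\<^sup>2)"
    by (simp add: ip_def complex_norm_square[symmetric])
  have "(\<Sum>g\<in>G. (cmod (w g))\<^sup>2) > 0"
    using h by (intro sum_pos2[OF finite_G]) auto
  then have nz: "ip w (\<lambda>g. cnj (w g)) \<noteq> 0"
    unfolding norm of_real_eq_0_iff by simp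
  have "JM m (\<lambda>g. cnj (w g)) = (\<lambda>g. cnj (JM m w g))" by (simp add: JM_def)
  then have "a * ip w (\<lambda>g. cnj (w g)) = cnj a * ip w (\<lambda>g. cnj (w g))"
    using JM_adjoint[OF assms(2), of w "\<lambda>g. cnj (w g)"] assms(1)
    by (simp add: eigen_def ip_scale_left ip_scale_right)
  then have "a = cnj a" using nz by simp
  then show "a \<in> \<real>" by (simp add: Reals_cnj_iff)
  then have "Im a = 0" by (simp add: complex_is_Real_iff)
  moreover have "JM m (\<lambda>g. Re (w g)) = (\<lambda>g. Re (JM m w g))"
    "JM m (\<lambda>g. Im (w g)) = (\<lambda>g. Im (JM m w g))" by (simp_all add: JM_def)
  ultimately show "eigen m (Re a) (\<lambda>g. Re (w g))" "eigen m (Re a) (\<lambda>g. Im (w g))"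
    using assms(1) by (simp_all add: eigen_def)
qed

context regular_rep
begin

text \<open>The functions orthogonal to all joint eigenfunctions form an invariant subspace, which
  would contain a joint eigenfunction if it were nonzero.\<close>

theorem biweights_complete:
  fixes x :: "(nat \<Rightarrow> nat) \<Rightarrow> complex"
  assumes supp: "L.supported x"
    and orth: "\<And>u v y. lattice_word u \<Longrightarrow> length u = n \<Longrightarrow> lattice_word v \<Longrightarrow> length v = n \<Longrightarrow>
      biweight u v y \<Longrightarrow> (\<Sum>g\<in>G. x g * of_real (y g)) = 0"
  shows "x = (\<lambda>_. 0)"
proof (rule ccontr)
  assume nz: "x \<noteq> (\<lambda>_. 0)"
  define K :: "((nat \<Rightarrow> nat) \<Rightarrow> complex) set" where
    "K = {x. L.supported x \<and> (\<forall>u v y. lattice_word u \<longrightarrow> length u = n \<longrightarrow> lattice_word v \<longrightarrow>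
      length v = n \<longrightarrow> biweight u v y \<longrightarrow> L.ip x (\<lambda>g. of_real (y g)) = 0)}"
  have lin: "(\<lambda>g. c * x g + d * y g) \<in> K" if "x \<in> K" "y \<in> K" for x y c d
    using that unfolding K_def mem_Collect_eq L.supported_def by (simp add: L.ip_lin)
  have LK: "L.JM m x \<in> K" if "m < n" "x \<in> K" for m x
  proof -
    have "L.ip (L.JM m x) (\<lambda>g. of_real (y g)) = of_real (box_content u m) * L.ip x (\<lambda>g. of_real (y g))"
      if "biweight u v y" "length u = n" for u v y
    proof -
      have "L.JM m y = (\<lambda>g. box_content u m * y g)"
        using that \<open>m < n\<close> by (simp add: biweight_def L.weight_def L.eigen_def)
      then show ?thesis
        using \<open>m < n\<close> by (simp add: L.JM_adjoint L.JM_of_real L.ip_scale_right)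
    qed
    then show ?thesis using that L.supported_JM[OF that(1), of x] unfolding K_def by simp
  qed
  have RK: "R.JM m x \<in> K" if "m < n" "x \<in> K" for m x
  proof -
    have "L.ip (R.JM m x) (\<lambda>g. of_real (y g)) = of_real (box_content v m) * L.ip x (\<lambda>g. of_real (y g))"
      if "biweight u v y" "length v = n" for u v y
    proof -
      have "R.JM m y = (\<lambda>g. box_content v m * y g)"
        using that \<open>m < n\<close> by (simp add: biweight_def R.weight_def R.eigen_def)
      then show ?thesis
        using \<open>m < n\<close> by (simp add: R.JM_adjoint R.JM_of_real L.ip_scale_right)
    qed
    then show ?thesis using that R.supported_JM[OF that(1), of x] unfolding K_def by simp
  qed
  have xK: "x \<in> K" using supp orth by (simp add: K_def L.ip_def)
  define As :: "(((nat \<Rightarrow> nat) \<Rightarrow> complex) \<Rightarrow> (nat \<Rightarrow> nat) \<Rightarrow> complex) list" where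
    "As = map L.JM [0..<n] @ map R.JM [0..<n]"
  have As: "A \<in> set As \<longleftrightarrow> (\<exists>m<n. A = L.JM m \<or> A = R.JM m)" for A
    by (auto simp: As_def)
  have "\<exists>w\<in>K. w \<noteq> (\<lambda>_. 0) \<and> (\<forall>A\<in>set As. \<exists>c. A w = (\<lambda>g. c * w g))"
  proof (rule ex_joint_eigenvector[OF L.finite_G _ _ _ lin _ xK nz])
    show "A (B y) = B (A y)" if "A \<in> set As" "B \<in> set As" for A B y
    proof -
      from that obtain i j where "A = L.JM i \<or> A = R.JM i" "B = L.JM j \<or> B = R.JM j"
        unfolding As by blast
      then show ?thesis
        by (elim disjE; simp only: L.JM_commute R.JM_commute JM_LR_commute)
    qed
  qed (use LK RK in \<open>auto simp: As L.JM_lin R.JM_lin K_def L.supported_def\<close>)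
  then obtain w where w: "w \<in> K" "w \<noteq> (\<lambda>_. 0)" "\<forall>A\<in>set As. \<exists>c. A w = (\<lambda>g. c * w g)" by blast
  have sw: "L.supported w" using w by (simp add: K_def)
  have "\<forall>m. \<exists>c. m < n \<longrightarrow> L.eigen m c w" using w(3) As by (metis L.eigen_def)
  then obtain a where a: "\<And>m. m < n \<Longrightarrow> L.eigen m (a m) w" by metis
  have "\<forall>m. \<exists>c. m < n \<longrightarrow> R.eigen m c w" using w(3) As by (metis R.eigen_def)
  then obtain b where b: "\<And>m. m < n \<Longrightarrow> R.eigen m (b m) w" by metis
  \<comment> \<open>Meant for the real and the imaginary part of \<open>w\<close>. Each is zero or,
    since its eigenvalues are contents of lattice words, a biweight, and members of \<open>K\<close>
    are orthogonal to biweights.\<close>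
  have part: "L.ip w (\<lambda>g. of_real (y g)) = 0"
    if sy: "L.supported y" and ay: "\<And>m. m < n \<Longrightarrow> L.eigen m (Re (a m)) y"
      and by': "\<And>m. m < n \<Longrightarrow> R.eigen m (Re (b m)) y" for y
  proof (cases "y = (\<lambda>_. 0)")
    case True
    then show ?thesis by (simp add: L.ip_def)
  next
    case False
    obtain u where u: "lattice_word u" "length u = n" "\<forall>m<n. box_content u m = Re (a m)"
      using L.eigen_imp_lattice_word[of n y "\<lambda>m. Re (a m)"] sy False ay by blast
    obtain v where v: "lattice_word v" "length v = n" "\<forall>m<n. box_content v m = Re (b m)"
      using R.eigen_imp_lattice_word[of n y "\<lambda>m. Re (b m)"] sy False by' by blast
    have "biweight u v y"
      using u v sy ay by' by (simp add: biweight_def L.weight_def R.weight_def)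
    then show ?thesis using w(1) u v unfolding K_def by blast
  qed
  have re: "L.ip w (\<lambda>g. of_real (Re (w g))) = 0"
    using sw w(2) L.eigen_complex_real[OF a] R.eigen_complex_real[OF b]
    by (intro part) (auto simp: L.supported_def)
  have im: "L.ip w (\<lambda>g. of_real (Im (w g))) = 0"
    using sw w(2) L.eigen_complex_real[OF a] R.eigen_complex_real[OF b]
    by (intro part) (auto simp: L.supported_def)
  \<comment> \<open>The conjugate of \<open>w\<close> is a combination of the two parts, so the
    squared norm of \<open>w\<close> is zero.\<close>
  have "complex_of_real (\<Sum>g\<in>G. (cmod (w g))\<^sup>2) = (\<Sum>g\<in>G. w g * cnj (w g))"
    by (simp add: complex_norm_square[symmetric])
  also have "\<dots> = (\<Sum>g\<in>G. w g * of_real (Re (w g)) - \<i> * (w g * of_real (Im (w g))))"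
    by (intro sum.cong refl) (simp add: complex_eq_iff algebra_simps)
  also have "\<dots> = L.ip w (\<lambda>g. of_real (Re (w g))) - \<i> * L.ip w (\<lambda>g. of_real (Im (w g)))"
    by (simp add: L.ip_def sum_subtractf sum_distrib_left)
  also have "\<dots> = 0" by (simp add: re im)
  finally have "(\<Sum>g\<in>G. (cmod (w g))\<^sup>2) = 0" by (simp only: of_real_eq_0_iff)
  then have "\<forall>g\<in>G. w g = 0"
    by (subst (asm) sum_nonneg_eq_0_iff) (auto simp: L.finite_G)
  then show False using sw w(2) unfolding L.supported_def by (meson ext)
qed

end

section \<open>The spectrum in terms of lattice words\<close>

lemma proots_linear_factors: "proots (\<Prod>a\<leftarrow>as. [:- a, 1:]) = mset (as :: complex list)"
proof (induction as)
  case (Cons a as)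
  have "(\<Prod>a\<leftarrow>as. [:- a, 1:]) \<noteq> (0 :: complex poly)"
    by (auto simp: prod_list_zero_iff)
  then have "proots ([:- a, 1:] * (\<Prod>a\<leftarrow>as. [:- a, 1:])) = proots [:- a, 1:] + proots (\<Prod>a\<leftarrow>as. [:- a, 1:])"
    by (intro proots_mult) auto
  then show ?case using Cons.IH by simp
qed simp

text \<open>The columns of \<open>X\<close> are eigenvectors, so \<open>X\<close> conjugates
  \<open>M\<close> to a diagonal matrix. Equal eigenvalues in several columns are thereby counted
  with multiplicity.\<close>

lemma proots_char_poly_eigenbasis:
  fixes M X :: "complex mat"
  assumes M: "M \<in> carrier_mat N N" and X: "X \<in> carrier_mat N N" and det: "det X \<noteq> 0"
    and eigen: "\<And>i j. i < N \<Longrightarrow> j < N \<Longrightarrow> (\<Sum>k<N. M $$ (i, k) * X $$ (k, j)) = c j * X $$ (i, j)"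
  shows "proots (char_poly M) = image_mset c (mset_set {..<N})"
proof -
  define D where "D = mat N N (\<lambda>(i, j). if i = j then c i else 0)"
  have D: "D \<in> carrier_mat N N" by (simp add: D_def)
  obtain Y where Y: "Y \<in> carrier_mat N N" "X * Y = 1\<^sub>m N" "Y * X = 1\<^sub>m N"
    using det_non_zero_imp_unit[OF X det, of "()"] unfolding Units_def ring_mat_def by auto
  have "M * X = X * D"
  proof (rule eq_matI)
    fix i j assume "i < dim_row (X * D)" "j < dim_col (X * D)"
    then have ij: "i < N" "j < N" using X D by auto
    have "(M * X) $$ (i, j) = (\<Sum>k<N. M $$ (i, k) * X $$ (k, j))"
      using ij M X by (simp add: scalar_prod_def atLeast0LessThan)
    also have "\<dots> = (\<Sum>k<N. if k = j then X $$ (i, k) * c k else 0)"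
      using ij by (simp add: eigen mult.commute)
    also have "\<dots> = (\<Sum>k<N. X $$ (i, k) * (if k = j then c k else 0))"
      by (intro sum.cong) auto
    also have "\<dots> = (X * D) $$ (i, j)"
      using ij X by (simp add: D_def scalar_prod_def atLeast0LessThan)
    finally show "(M * X) $$ (i, j) = (X * D) $$ (i, j)" .
  qed (use M X D in auto)
  then have "X * D * Y = M * X * Y" by simp
  also have "\<dots> = M" using M X Y by (simp add: assoc_mult_mat[of _ N N _ N _ N])
  finally have XDY: "X * D * Y = M" .
  have dim: "dim_row M = N" and carr: "{M, D, X, Y} \<subseteq> carrier_mat N N" using M D X Y by auto
  have "similar_mat M D"
    unfolding similar_mat_def similar_mat_wit_def Let_def dim
    using carr Y(2,3) XDY[symmetric] by blast
  then have "char_poly M = char_poly D" by (rule char_poly_similar)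
  also have "\<dots> = (\<Prod>a\<leftarrow>diag_mat D. [:- a, 1:])"
    by (rule char_poly_upper_triangular[OF D]) (auto simp: D_def)
  also have "diag_mat D = map c [0..<N]" by (auto simp: diag_mat_def D_def intro: map_cong)
  finally show ?thesis
    by (simp only: proots_linear_factors mset_map mset_upt atLeast0LessThan)
qed

lemma transpose_eq_transpose_iff:
  assumes "i < j" "k < (l::nat)"
  shows "transpose i j = transpose k l \<longleftrightarrow> i = k \<and> j = l"
proof
  assume eq: "transpose i j = transpose k l"
  have "transpose k l i = j" "transpose k l j = i" using eq by (metis transpose_apply_first transpose_apply_second)+
  then show "i = k \<and> j = l" using assms by (auto simp: transpose_def split: if_splits)
qed simp

definition word_eig :: "nat \<Rightarrow> nat \<Rightarrow> nat list \<Rightarrow> real" where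
  "word_eig n k v = 1 / real n + (real n - 1) / real n * (2 / (real k * (2 * real n - (real k + 1)))) *
    (\<Sum>m\<in>{n - k..<n}. box_content v m)"

context regular_rep
begin

text \<open>Grouping the admissible transpositions by their larger letter gives the last
  \<open>k\<close> Jucys-Murphy operators of the right action.\<close>

lemma sum_star_trans:
  assumes g: "g \<in> G" and k: "k \<le> n"
  shows "(\<Sum>h\<in>G. star_trans n k g h * x h) = 1 / real n * x g +
    (real n - 1) / real n * (2 / (real k * (2 * real n - (real k + 1)))) * (\<Sum>m\<in>{n - k..<n}. R.JM m x g)"
proof -
  define C where "C = (real n - 1) / real n * (2 / (real k * (2 * real n - (real k + 1))))"
  define P where "P = (SIGMA m:{n - k..<n}. {..<m})"
  \<comment> \<open>The transposition \<open>(i j)\<close> corresponds to the pair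
    \<open>(j - 1, i - 1)\<close>; the condition \<open>n - k + 1 \<le> j \<le> n\<close> becomes
    \<open>m \<in> {n - k..<n}\<close>.\<close>
  define \<tau> where "\<tau> = (\<lambda>(m, i). transpose (Suc i) (Suc m))"
  have gp: "g permutes {1..n}" using g by (simp add: G_def)
  have "(\<Sum>h\<in>G. star_trans n k g h * x h) = (\<Sum>\<sigma>\<in>G. star_step n k \<sigma> * x (g \<circ> \<sigma>))"
  proof (rule sum.reindex_bij_witness[of _ "\<lambda>\<sigma>. g \<circ> \<sigma>" "\<lambda>h. inv_into UNIV g \<circ> h"])
    fix h :: "nat \<Rightarrow> nat"
    show "g \<circ> (inv_into UNIV g \<circ> h) = h" "inv_into UNIV g \<circ> (g \<circ> h) = h"
      using permutes_inv_o[OF gp] by (simp_all add: o_assoc)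
    then show "star_step n k (inv_into UNIV g \<circ> h) * x (g \<circ> (inv_into UNIV g \<circ> h)) =
        star_trans n k g h * x h"
      by (simp add: star_trans_def)
    assume "h \<in> G"
    then show "inv_into UNIV g \<circ> h \<in> G" "g \<circ> h \<in> G"
      using gp permutes_compose permutes_inv unfolding G_def by blast+
  qed
  also have "\<dots> = (\<Sum>\<sigma>\<in>insert id (\<tau> ` P). star_step n k \<sigma> * x (g \<circ> \<sigma>))"
  proof (rule sum.mono_neutral_right)
    show "finite G" by (rule R.finite_G)
    show "insert id (\<tau> ` P) \<subseteq> G"
      by (auto simp: G_def \<tau>_def P_def permutes_id intro!: permutes_swap_id)
    show "\<forall>\<sigma>\<in>G - insert id (\<tau> ` P). star_step n k \<sigma> * x (g \<circ> \<sigma>) = 0"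
    proof
      fix \<sigma> assume \<sigma>: "\<sigma> \<in> G - insert id (\<tau> ` P)"
      have neg: "\<not> (\<exists>i j. 1 \<le> i \<and> i < j \<and> n - k + 1 \<le> j \<and> j \<le> n \<and> \<sigma> = transpose i j)"
      proof
        assume "\<exists>i j. 1 \<le> i \<and> i < j \<and> n - k + 1 \<le> j \<and> j \<le> n \<and> \<sigma> = transpose i j"
        then obtain i j where ij: "1 \<le> i" "i < j" "n - k + 1 \<le> j" "j \<le> n" "\<sigma> = transpose i j" by blast
        then have "\<sigma> = \<tau> (j - 1, i - 1)" "(j - 1, i - 1) \<in> P" by (auto simp: \<tau>_def P_def)
        then show False using \<sigma> by blast
      qed
      have "\<sigma> \<noteq> id" using \<sigma> by blast
      then show "star_step n k \<sigma> * x (g \<circ> \<sigma>) = 0"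
        by (simp only: star_step_def neg if_False mult_zero_left)
    qed
  qed
  also have "\<dots> = star_step n k id * x (g \<circ> id) + (\<Sum>\<sigma>\<in>\<tau> ` P. star_step n k \<sigma> * x (g \<circ> \<sigma>))"
  proof (rule sum.insert)
    show "finite (\<tau> ` P)" by (simp add: P_def)
    show "id \<notin> \<tau> ` P"
    proof
      assume "id \<in> \<tau> ` P"
      then obtain m i where im: "i < m" "id = transpose (Suc i) (Suc m)" by (auto simp: \<tau>_def P_def)
      show False using fun_cong[OF im(2), of "Suc i"] im(1) by simp
    qed
  qed
  also have "(\<Sum>\<sigma>\<in>\<tau> ` P. star_step n k \<sigma> * x (g \<circ> \<sigma>)) = (\<Sum>p\<in>P. C * x (g \<circ> \<tau> p))"
  proof (subst sum.reindex)
    show "inj_on \<tau> P"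
      by (rule inj_onI) (auto simp: \<tau>_def P_def transpose_eq_transpose_iff)
    show "sum ((\<lambda>\<sigma>. star_step n k \<sigma> * x (g \<circ> \<sigma>)) \<circ> \<tau>) P = (\<Sum>p\<in>P. C * x (g \<circ> \<tau> p))"
    proof (rule sum.cong)
      fix p assume "p \<in> P"
      then obtain m i where p: "p = (m, i)" "n - k \<le> m" "m < n" "i < m" by (auto simp: P_def)
      have "\<tau> p (Suc i) \<noteq> Suc i" using p by (simp add: \<tau>_def)
      then have nid: "\<tau> p \<noteq> id" by auto
      have ex: "\<exists>i j. 1 \<le> i \<and> i < j \<and> n - k + 1 \<le> j \<and> j \<le> n \<and> \<tau> p = transpose i j"
        by (rule exI[of _ "Suc i"], rule exI[of _ "Suc m"]) (use p in \<open>auto simp: \<tau>_def\<close>)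
      show "((\<lambda>\<sigma>. star_step n k \<sigma> * x (g \<circ> \<sigma>)) \<circ> \<tau>) p = C * x (g \<circ> \<tau> p)"
        by (simp only: o_apply star_step_def C_def nid ex if_False if_True)
    qed simp
  qed
  also have "\<dots> = C * (\<Sum>(m, i)\<in>P. x (right_act i m g))"
    by (simp add: sum_distrib_left right_act_def \<tau>_def case_prod_beta)
  also have "(\<Sum>(m, i)\<in>P. x (right_act i m g)) = (\<Sum>m\<in>{n - k..<n}. R.JM m x g)"
    unfolding P_def R.JM_def by (rule sum.Sigma[symmetric]) auto
  finally show ?thesis
    unfolding C_def by (simp only: star_step_def refl if_True comp_id)
qed

lemma biweight_star_trans:
  assumes "g \<in> G" "k \<le> n" "biweight u v x" "length v = n"
  shows "(\<Sum>h\<in>G. star_trans n k g h * x h) = word_eig n k v * x g"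
proof -
  have "R.JM m x g = box_content v m * x g" if "m < n" for m
    using assms(3,4) that by (simp add: biweight_def R.weight_def R.eigen_def)
  then have "(\<Sum>m\<in>{n - k..<n}. R.JM m x g) = (\<Sum>m\<in>{n - k..<n}. box_content v m) * x g"
    by (simp add: sum_distrib_right)
  then show ?thesis
    unfolding sum_star_trans[OF assms(1,2)] by (simp add: word_eig_def algebra_simps)
qed

text \<open>A vector orthogonal to the chosen function of every pair is orthogonal to all biweights:
  those for words of different shapes vanish, the others are multiples of the chosen one.
  Completeness makes the vector zero, and as there are \<open>fact n\<close> pairs, the choices form
  an invertible square matrix.\<close>

theorem spectrum_star_matrix:
  assumes k: "k \<le> n" and e: "bij_betw e {..<fact n} {x. x permutes {1..n}}"
  shows "spectrum_mset (star_matrix n k e) =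
    image_mset (\<lambda>(u, v). complex_of_real (word_eig n k v)) (mset_set (word_pairs n))"
proof -
  let ?N = "fact n :: nat"
  have eG: "bij_betw e {..<?N} G" using e by (simp add: G_def)
  obtain q where q: "bij_betw q {..<?N} (word_pairs n)"
    using ex_bij_betw_nat_finite[OF finite_word_pairs[of n]]
    by (auto simp: card_word_pairs atLeast0LessThan)
  define good where "good u v x \<longleftrightarrow> biweight u v x \<and>
    (x \<noteq> (\<lambda>_. 0) \<or> (\<forall>y. biweight u v y \<longrightarrow> y = (\<lambda>_. 0)))" for u v x
  define b where "b = (\<lambda>(u, v). SOME x. good u v x)"
  have b: "biweight u v (b (u, v)) \<and>
    (b (u, v) \<noteq> (\<lambda>_. 0) \<or> (\<forall>y. biweight u v y \<longrightarrow> y = (\<lambda>_. 0)))" for u v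
  proof -
    have "biweight u v (\<lambda>_. 0)"
      by (simp add: biweight_def L.supported_def L.weight_def R.weight_def L.eigen_def R.eigen_def
          L.JM_def R.JM_def)
    then have "\<exists>x. good u v x" unfolding good_def by blast
    then have "good u v (SOME x. good u v x)" by (rule someI_ex)
    then show ?thesis by (simp only: b_def prod.case good_def)
  qed
  define X where "X = mat ?N ?N (\<lambda>(a, j). complex_of_real (b (q j) (e a)))"
  have X: "X \<in> carrier_mat ?N ?N" by (simp add: X_def)
  have "det X \<noteq> 0"
  proof
    assume "det X = 0"
    \<comment> \<open>The transpose is used so that a kernel vector becomes a function on the group
      orthogonal to all columns of \<open>X\<close>.\<close>
    then have "det (transpose_mat X) = 0" using det_transpose[OF X] by simp
    then obtain z where z: "z \<in> carrier_vec ?N" "z \<noteq> 0\<^sub>v ?N" "transpose_mat X *\<^sub>v z = 0\<^sub>v ?N"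
      using det_0_iff_vec_prod_zero_field[of "transpose_mat X" ?N] X by auto
    define x where "x g = (if g \<in> G then z $ (inv_into {..<?N} e g) else 0)" for g
    have xe: "x (e a) = z $ a" if "a < ?N" for a
      using that eG by (auto simp: x_def bij_betw_def inv_into_f_f)
    have orth: "(\<Sum>g\<in>G. x g * of_real (b (u, v) g)) = 0" if "(u, v) \<in> word_pairs n" for u v
    proof -
      from that have "(u, v) \<in> q ` {..<?N}" using q by (simp add: bij_betw_def)
      then obtain j where j: "j < ?N" "q j = (u, v)" by (metis imageE lessThan_iff)
      have "(\<Sum>g\<in>G. x g * of_real (b (u, v) g)) = (\<Sum>a<?N. x (e a) * of_real (b (u, v) (e a)))"
        by (rule sum.reindex_bij_betw[OF eG, symmetric])
      also have "\<dots> = (transpose_mat X *\<^sub>v z) $ j"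
        using j z(1) by (simp add: X_def xe scalar_prod_def atLeast0LessThan mult.commute)
      also have "\<dots> = 0" using z(3) j by simp
      finally show ?thesis .
    qed
    have "x = (\<lambda>_. 0)"
    proof (rule biweights_complete)
      show "L.supported x" unfolding L.supported_def by (simp add: x_def)
      fix u v y
      assume u: "lattice_word u" "length u = n" and v: "lattice_word v" "length v = n"
        and y: "biweight u v y"
      show "(\<Sum>g\<in>G. x g * of_real (y g)) = 0"
      proof (cases "y = (\<lambda>_. 0)")
        case False
        then have uv: "count_list u = count_list v" using biweight_same_shape[OF u v y] by blast
        have "b (u, v) \<noteq> (\<lambda>_. 0)" using b[of u v] y False by blast
        then obtain c where "y = (\<lambda>g. c * b (u, v) g)"
          using biweight_unique[OF u v uv _ _ y] b[of u v] by blast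
        then have "(\<Sum>g\<in>G. x g * of_real (y g)) = c * (\<Sum>g\<in>G. x g * of_real (b (u, v) g))"
          by (simp add: sum_distrib_left mult_ac)
        then show ?thesis using orth[of u v] u v uv by (simp add: word_pairs_def lattice_words_def)
      qed simp
    qed
    then have "z $ a = 0" if "a < ?N" for a using xe[OF that] by simp
    then have "z = 0\<^sub>v ?N" using z(1) by (intro eq_vecI) auto
    then show False using z(2) by blast
  qed
  moreover have "(\<Sum>c<?N. star_matrix n k e $$ (a, c) * X $$ (c, j)) =
      of_real (word_eig n k (snd (q j))) * X $$ (a, j)" if aj: "a < ?N" "j < ?N" for a j
  proof -
    obtain u v where uv: "q j = (u, v)" by (cases "q j")
    have "(u, v) \<in> word_pairs n" using q aj uv by (force simp: bij_betw_def)
    then have len: "length v = n" by (simp add: word_pairs_def lattice_words_def)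
    have eaG: "e a \<in> G" using eG aj by (auto simp: bij_betw_def)
    have "(\<Sum>c<?N. star_matrix n k e $$ (a, c) * X $$ (c, j)) =
        of_real (\<Sum>c<?N. star_trans n k (e a) (e c) * b (u, v) (e c))"
      using aj by (simp add: star_matrix_def X_def uv)
    also have "(\<Sum>c<?N. star_trans n k (e a) (e c) * b (u, v) (e c)) =
        (\<Sum>h\<in>G. star_trans n k (e a) h * b (u, v) h)"
      by (rule sum.reindex_bij_betw[OF eG])
    also have "\<dots> = word_eig n k v * b (u, v) (e a)"
      using biweight_star_trans[OF eaG k _ len] b by blast
    finally show ?thesis using aj by (simp add: X_def uv)
  qed
  ultimately have "proots (char_poly (star_matrix n k e)) =
      image_mset (\<lambda>j. of_real (word_eig n k (snd (q j)))) (mset_set {..<?N})"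
    by (intro proots_char_poly_eigenbasis[OF _ X]) (simp_all add: star_matrix_def)
  also have "\<dots> = image_mset (\<lambda>(u, v). of_real (word_eig n k v)) (image_mset q (mset_set {..<?N}))"
    by (simp add: multiset.map_comp o_def case_prod_beta)
  also have "image_mset q (mset_set {..<?N}) = mset_set (word_pairs n)"
    using q by (simp add: bij_betw_def image_mset_mset_set)
  finally show ?thesis by (simp add: spectrum_mset_def)
qed

end

section \<open>Standard tableaux and lattice words\<close>

definition skew_words :: "(nat \<Rightarrow> nat) \<Rightarrow> (nat \<Rightarrow> nat) \<Rightarrow> nat list set" where
  "skew_words g f = {v. lattice_from g v \<and> (\<lambda>i. g i + count_list v i) = f}"

text \<open>Boxes are indexed from 1 in \<^const>\<open>diagram\<close> and from 0 in \<^const>\<open>cells\<close>.\<close>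

definition boxes :: "(nat \<Rightarrow> nat) \<Rightarrow> (nat \<times> nat) set" where
  "boxes f = {(i, j). 1 \<le> i \<and> 1 \<le> j \<and> j \<le> f (i - 1)}"

lemma boxes_eq_cells: "boxes f = (\<lambda>(i, j). (Suc i, Suc j)) ` cells f"
proof (intro Set.set_eqI iffI)
  fix b assume "b \<in> boxes f"
  then obtain i j where "b = (Suc i, Suc j)" "j < f i"
    by (cases b; cases "fst b"; cases "snd b") (auto simp: boxes_def)
  then show "b \<in> (\<lambda>(i, j). (Suc i, Suc j)) ` cells f" by (force simp: cells_def)
qed (auto simp: boxes_def cells_def)

lemma boxes_subset_iff: "boxes g \<subseteq> boxes f \<longleftrightarrow> (\<forall>i. g i \<le> f i)"
proof
  assume *: "boxes g \<subseteq> boxes f"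
  show "\<forall>i. g i \<le> f i"
  proof
    fix i
    show "g i \<le> f i"
    proof (cases "g i = 0")
      case False
      then have "(Suc i, g i) \<in> boxes g" by (simp add: boxes_def)
      then have "(Suc i, g i) \<in> boxes f" using * by blast
      then show ?thesis by (simp add: boxes_def)
    qed simp
  qed
next
  assume *: "\<forall>i. g i \<le> f i"
  show "boxes g \<subseteq> boxes f"
  proof
    fix b assume "b \<in> boxes g"
    then show "b \<in> boxes f" using *[rule_format, of "fst b - 1"] by (auto simp: boxes_def)
  qed
qed

lemma boxes_dec: "f i > 0 \<Longrightarrow> boxes (dec f i) = boxes f - {(Suc i, f i)}"
  by (auto simp: boxes_def dec_def split: if_splits)

lemma standard_tableaux_empty: "standard_tableaux {} = {\<lambda>_. undefined}"
  by (auto simp: standard_tableaux_def bij_betw_def)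

lemma standard_tableaux_row:
  "T \<in> standard_tableaux D \<Longrightarrow> (i, j) \<in> D \<Longrightarrow> (i, j') \<in> D \<Longrightarrow> j < j' \<Longrightarrow> T (i, j) < T (i, j')"
  by (auto simp: standard_tableaux_def)

lemma standard_tableaux_col:
  "T \<in> standard_tableaux D \<Longrightarrow> (i, j) \<in> D \<Longrightarrow> (i', j) \<in> D \<Longrightarrow> i < i' \<Longrightarrow> T (i, j) < T (i', j)"
  by (auto simp: standard_tableaux_def)

context
  fixes f g :: "nat \<Rightarrow> nat" and k :: nat
  assumes f: "antimono f" and g: "antimono g" and gf: "\<And>i. g i \<le> f i"
    and card: "card (boxes f - boxes g) = Suc k"
begin

lemma finite_skew_boxes: "finite (boxes f - boxes g)"
  by (rule card_ge_0_finite) (simp add: card)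

lemma last_box_mem: "g i < f i \<Longrightarrow> (Suc i, f i) \<in> boxes f - boxes g"
  by (auto simp: boxes_def)

lemma remove_box:
  assumes "g i < f i"
  shows "boxes (dec f i) - boxes g = (boxes f - boxes g) - {(Suc i, f i)}"
    and "card (boxes (dec f i) - boxes g) = k"
proof -
  show *: "boxes (dec f i) - boxes g = (boxes f - boxes g) - {(Suc i, f i)}"
    using boxes_dec[of f i] assms by auto
  show "card (boxes (dec f i) - boxes g) = k"
    unfolding * using card last_box_mem[OF assms] finite_skew_boxes by simp
qed

lemma skew_words_decomp:
  "skew_words g f =
    (\<Union>i\<in>{i \<in> removable f. g i < f i}. (\<lambda>u. u @ [i]) ` skew_words g (dec f i))"
proof (intro Set.set_eqI iffI)
  fix w assume w: "w \<in> skew_words g f"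
  have "w \<noteq> []"
  proof
    assume "w = []"
    then have "f = g" using w by (auto simp: skew_words_def)
    then show False using card by simp
  qed
  then obtain u i where ui: "w = u @ [i]" by (metis rev_exhaust)
  have lu: "lattice_from g u" "i \<in> addable (\<lambda>j. g j + count_list u j)"
    using w unfolding ui skew_words_def lattice_from_snoc mem_Collect_eq by blast+
  have f_eq: "f = inc (\<lambda>j. g j + count_list u j) i"
    using w unfolding ui skew_words_def by (auto simp: inc_def)
  have "i \<in> removable f"
    unfolding f_eq by (rule inc_in_removable[OF lattice_from_antimono[OF lu(1)]])
  moreover have "g i < f i" unfolding f_eq by (simp add: inc_def)
  moreover have "u \<in> skew_words g (dec f i)"
    using lu(1) by (simp add: skew_words_def f_eq)
  ultimately show "w \<in> (\<Union>i\<in>{i \<in> removable f. g i < f i}. (\<lambda>u. u @ [i]) ` skew_words g (dec f i))"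
    using ui by blast
next
  fix w assume "w \<in> (\<Union>i\<in>{i \<in> removable f. g i < f i}. (\<lambda>u. u @ [i]) ` skew_words g (dec f i))"
  then obtain i u where i: "i \<in> removable f" and w: "w = u @ [i]"
    and u: "lattice_from g u" "(\<lambda>j. g j + count_list u j) = dec f i"
    by (auto simp: skew_words_def)
  have "lattice_from g w"
    unfolding w lattice_from_snoc u(2) using u(1) addable_dec[OF f i] by blast
  moreover have "(\<lambda>j. g j + count_list w j) = f"
  proof -
    have "(\<lambda>j. g j + count_list w j) = inc (\<lambda>j. g j + count_list u j) i"
      by (auto simp: w inc_def)
    then show ?thesis using u(2) inc_dec[OF i] by simp
  qed
  ultimately show "w \<in> skew_words g f" by (simp add: skew_words_def)
qed

text \<open>The largest entry \<open>Suc k\<close> has nothing to its right or below it, so it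
  occupies a corner of \<open>f\<close> outside \<open>g\<close>; conversely any such corner can
  receive it.\<close>

lemma standard_tableaux_decomp:
  "standard_tableaux (boxes f - boxes g) =
    (\<Union>i\<in>{i \<in> removable f. g i < f i}.
      (\<lambda>T. T((Suc i, f i) := Suc k)) ` standard_tableaux (boxes (dec f i) - boxes g))"
proof (intro Set.set_eqI iffI)
  let ?D = "boxes f - boxes g"
  fix T assume T: "T \<in> standard_tableaux ?D"
  then have bij: "bij_betw T ?D {1..Suc k}" and ext: "T \<in> extensional ?D"
    using card by (auto simp: standard_tableaux_def)
  then obtain b where b: "b \<in> ?D" "T b = Suc k"
    by (metis atLeastAtMost_iff bij_betw_iff_bijections le_add1 order_refl plus_1_eq_Suc)
  have le: "T d \<le> Suc k" if "d \<in> ?D" for d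
    using bij_betw_apply[OF bij that] by simp
  obtain i j where ij: "b = (Suc i, j)" "1 \<le> j" "j \<le> f i" "g i < j"
    using b(1) by (cases b; cases "fst b") (auto simp: boxes_def)
  then have gi: "g i < f i" by simp
  have "j = f i"
  proof (rule ccontr)
    assume "j \<noteq> f i"
    then have "T (Suc i, j) < T (Suc i, f i)"
      using standard_tableaux_row[OF T _ last_box_mem[OF gi]] ij b(1) by simp
    then show False using le[OF last_box_mem[OF gi]] b(2) ij(1) by simp
  qed
  then have b_eq: "b = (Suc i, f i)" using ij by simp
  have "f (Suc i) < f i"
  proof (rule ccontr)
    assume "\<not> f (Suc i) < f i"
    \<comment> \<open>As \<open>g\<close> decreases weakly, the box below the one in question would
      also lie outside \<open>g\<close>, hence in the skew shape.\<close>
    moreover have "g (Suc i) \<le> g i" using g unfolding antimono_iff_le_Suc by blast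
    ultimately have mem: "(Suc (Suc i), f i) \<in> ?D" using gi by (auto simp: boxes_def)
    have "T (Suc i, f i) < T (Suc (Suc i), f i)"
      using standard_tableaux_col[OF T last_box_mem[OF gi] mem] by simp
    then show False using le[OF mem] b(2) b_eq by simp
  qed
  then have i: "i \<in> {i \<in> removable f. g i < f i}" using gi by (simp add: removable_def)
  \<comment> \<open>Fillings are \<open>undefined\<close> off their domain, so the vacated box has
    to be reset.\<close>
  define T' where "T' = T(b := undefined)"
  have "T' \<in> standard_tableaux (boxes (dec f i) - boxes g)"
    unfolding standard_tableaux_def remove_box(2)[OF gi]
    unfolding remove_box(1)[OF gi] b_eq[symmetric] mem_Collect_eq
  proof (intro conjI)
    show "T' \<in> extensional (?D - {b})" using ext by (auto simp: T'_def extensional_def)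
    have "bij_betw T (?D - {b}) ({1..Suc k} - {T b})"
      using bij b(1) by (auto simp: bij_betw_def inj_on_def)
    moreover have "{1..Suc k} - {T b} = {1..k}" using b(2) by auto
    ultimately have "bij_betw T (?D - {b}) {1..k}" by simp
    then show "bij_betw T' (?D - {b}) {1..k}"
      by (rule bij_betw_cong[THEN iffD1, rotated]) (simp add: T'_def)
  qed (use standard_tableaux_row[OF T] standard_tableaux_col[OF T] in \<open>auto simp: T'_def\<close>)
  moreover have "T = T'((Suc i, f i) := Suc k)" using b b_eq by (auto simp: T'_def)
  ultimately show "T \<in> (\<Union>i\<in>{i \<in> removable f. g i < f i}.
      (\<lambda>T. T((Suc i, f i) := Suc k)) ` standard_tableaux (boxes (dec f i) - boxes g))"
    using i by blast
next
  let ?D = "boxes f - boxes g"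
  fix T assume "T \<in> (\<Union>i\<in>{i \<in> removable f. g i < f i}.
      (\<lambda>T. T((Suc i, f i) := Suc k)) ` standard_tableaux (boxes (dec f i) - boxes g))"
  then obtain i T' where i: "i \<in> removable f" "g i < f i" and T: "T = T'((Suc i, f i) := Suc k)"
    and T': "T' \<in> standard_tableaux (boxes (dec f i) - boxes g)" by blast
  define b where "b = (Suc i, f i)"
  have bD: "b \<in> ?D" using last_box_mem[OF i(2)] by (simp add: b_def)
  have ext: "T' \<in> extensional (?D - {b})" and bij: "bij_betw T' (?D - {b}) {1..k}"
    and row: "\<And>i j j'. (i, j) \<in> ?D - {b} \<Longrightarrow> (i, j') \<in> ?D - {b} \<Longrightarrow> j < j' \<Longrightarrow> T' (i, j) < T' (i, j')"
    and col: "\<And>i i' j. (i, j) \<in> ?D - {b} \<Longrightarrow> (i', j) \<in> ?D - {b} \<Longrightarrow> i < i' \<Longrightarrow> T' (i, j) < T' (i', j)"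
    using T' remove_box[OF i(2)] unfolding standard_tableaux_def b_def by auto
  have le: "T' d < Suc k" if "d \<in> ?D - {b}" for d
    using bij_betw_apply[OF bij that] by simp
  have max_row: "\<not> f i < j'" if "(Suc i, j') \<in> ?D" for j'
    using that by (auto simp: boxes_def)
  have max_col: "\<not> Suc i < i'" if "(i', f i) \<in> ?D" for i'
  proof
    assume "Suc i < i'"
    then have "f (i' - 1) \<le> f (Suc i)" using f by (intro antimonoD[of f]) auto
    also have "\<dots> < f i" using i by (simp add: removable_def)
    finally show False using that by (auto simp: boxes_def)
  qed
  show "T \<in> standard_tableaux ?D"
    unfolding standard_tableaux_def card mem_Collect_eq
  proof (intro conjI allI impI)
    show "T \<in> extensional ?D" using ext bD by (auto simp: T b_def extensional_def)
    have "bij_betw T ((?D - {b}) \<union> {b}) ({1..k} \<union> {T b})"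
    proof (rule notIn_Un_bij_betw)
      show "bij_betw T (?D - {b}) {1..k}"
        using bij by (rule bij_betw_cong[THEN iffD1, rotated]) (auto simp: T b_def)
    qed (auto simp: T b_def)
    moreover have "(?D - {b}) \<union> {b} = ?D" using bD by blast
    moreover have "{1..k} \<union> {T b} = {1..Suc k}" by (auto simp: T b_def)
    ultimately show "bij_betw T ?D {1..Suc k}" by simp
  next
    fix r c c' assume rc: "(r, c) \<in> ?D" "(r, c') \<in> ?D" "c < c'"
    have "(r, c) \<noteq> b" using max_row[of c'] rc unfolding b_def by auto
    then show "T (r, c) < T (r, c')"
      using row[of r c c'] le[of "(r, c)"] rc by (auto simp: T b_def)
  next
    fix r r' c assume rc: "(r, c) \<in> ?D" "(r', c) \<in> ?D" "r < r'"
    have "(r, c) \<noteq> b" using max_col[of r'] rc unfolding b_def by auto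
    then show "T (r, c) < T (r', c)"
      using col[of r c r'] le[of "(r, c)"] rc by (auto simp: T b_def)
  qed
qed

lemma finite_removable_skew: "finite {i \<in> removable f. g i < f i}"
proof (rule finite_subset)
  show "{i \<in> removable f. g i < f i} \<subseteq> (\<lambda>b. fst b - 1) ` (boxes f - boxes g)"
    using last_box_mem by force
qed (simp add: finite_skew_boxes)

end

text \<open>Fillings and words obey the same recursion over the corners of \<open>f\<close> outside
  \<open>g\<close>: the box of the largest entry corresponds to the last letter.\<close>

theorem card_standard_tableaux:
  assumes "antimono f" "antimono g" "\<And>i. g i \<le> f i" "finite (boxes f)"
  shows "finite (standard_tableaux (boxes f - boxes g)) \<and> finite (skew_words g f) \<and>
    card (standard_tableaux (boxes f - boxes g)) = card (skew_words g f)"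
  using assms
proof (induction "card (boxes f - boxes g)" arbitrary: f)
  case 0
  then have D: "boxes f - boxes g = {}" by simp
  then have "boxes f \<subseteq> boxes g" by blast
  then have "f = g" using 0(4) boxes_subset_iff by (metis antisym ext)
  have "skew_words g f = {[]}"
  proof (intro Set.set_eqI iffI)
    fix v assume "v \<in> skew_words g f"
    then have "(\<lambda>i. g i + count_list v i) = g" by (simp add: skew_words_def \<open>f = g\<close>)
    then have "g i + count_list v i = g i" for i by (metis (no_types))
    then have "i \<notin> set v" for i by (simp add: count_list_0_iff)
    then show "v \<in> {[]}" by (cases v) auto
  qed (use 0 in \<open>auto simp: skew_words_def \<open>f = g\<close>\<close>)
  then show ?case by (simp add: D standard_tableaux_empty)
next
  case (Suc k)
  note ctx = Suc.prems(1-3) Suc.hyps(2)[symmetric]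
  let ?I = "{i \<in> removable f. g i < f i}"
  let ?ST = "\<lambda>i. (\<lambda>T. T((Suc i, f i) := Suc k)) ` standard_tableaux (boxes (dec f i) - boxes g)"
  let ?SW = "\<lambda>i. (\<lambda>u. u @ [i]) ` skew_words g (dec f i)"
  have IH: "finite (standard_tableaux (boxes (dec f i) - boxes g)) \<and> finite (skew_words g (dec f i)) \<and>
    card (standard_tableaux (boxes (dec f i) - boxes g)) = card (skew_words g (dec f i))"
    if "i \<in> ?I" for i
  proof (rule Suc.hyps(1))
    show "k = card (boxes (dec f i) - boxes g)" using remove_box(2)[OF ctx] that by simp
    show "antimono (dec f i)" using antimono_dec Suc.prems(1) that by blast
    show "g j \<le> dec f i j" for j using that Suc.prems(3)[of j] by (auto simp: dec_def)
    show "finite (boxes (dec f i))" using boxes_dec[of f i] that Suc.prems(4) by simp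
  qed (rule Suc.prems)
  have finI: "finite ?I" using finite_removable_skew[OF ctx] .
  have inj: "inj_on (\<lambda>T. T((Suc i, f i) := Suc k)) (standard_tableaux (boxes (dec f i) - boxes g))"
    if "i \<in> ?I" for i
  proof (rule inj_onI)
    fix S T assume S: "S \<in> standard_tableaux (boxes (dec f i) - boxes g)"
      and T: "T \<in> standard_tableaux (boxes (dec f i) - boxes g)"
      and eq: "S((Suc i, f i) := Suc k) = T((Suc i, f i) := Suc k)"
    have "S (Suc i, f i) = undefined" "T (Suc i, f i) = undefined"
      using S T that remove_box(1)[OF ctx, of i] by (auto simp: standard_tableaux_def extensional_def)
    then show "S = T" using eq by (metis fun_upd_triv fun_upd_upd)
  qed
  \<comment> \<open>The value \<open>Suc k\<close> occurs in exactly one box, so its position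
    reveals the corner.\<close>
  have disj: "?ST i \<inter> ?ST j = {}" if "i \<in> ?I" "j \<in> ?I" "i \<noteq> j" for i j
  proof (rule ccontr)
    assume "?ST i \<inter> ?ST j \<noteq> {}"
    then obtain S T where S: "S \<in> standard_tableaux (boxes (dec f i) - boxes g)"
      and eq: "S((Suc i, f i) := Suc k) = T((Suc j, f j) := Suc k)" by blast
    have mem: "(Suc j, f j) \<in> boxes (dec f i) - boxes g"
      using that remove_box(1)[OF ctx, of i] last_box_mem[OF ctx, of j] by auto
    have "S (Suc j, f j) = Suc k"
      using fun_cong[OF eq, of "(Suc j, f j)"] that(3) by simp
    moreover have "S (Suc j, f j) \<in> {1..k}"
      using S mem remove_box(2)[OF ctx, of i] that bij_betw_apply
      unfolding standard_tableaux_def by fastforce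
    ultimately show False by simp
  qed
  have "card (standard_tableaux (boxes f - boxes g)) = (\<Sum>i\<in>?I. card (?ST i))"
    unfolding standard_tableaux_decomp[OF ctx]
    by (rule card_UN_disjoint) (use finI IH disj in auto)
  also have "\<dots> = (\<Sum>i\<in>?I. card (?SW i))"
  proof (rule sum.cong)
    fix i assume i: "i \<in> ?I"
    have "inj_on (\<lambda>u. u @ [i]) (skew_words g (dec f i))" by (auto intro: inj_onI)
    then show "card (?ST i) = card (?SW i)"
      using IH[OF i] inj[OF i] by (simp add: card_image)
  qed simp
  also have "\<dots> = card (skew_words g f)"
    unfolding skew_words_decomp[OF ctx]
    by (rule card_UN_disjoint[symmetric]) (use finI IH in auto)
  finally have "card (standard_tableaux (boxes f - boxes g)) = card (skew_words g f)" .
  moreover have "finite (standard_tableaux (boxes f - boxes g))"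
    unfolding standard_tableaux_decomp[OF ctx] using finI IH by auto
  moreover have "finite (skew_words g f)"
    unfolding skew_words_decomp[OF ctx] using finI IH by auto
  ultimately show ?case by blast
qed

section \<open>Partitions as lists and as row length functions\<close>

definition parts :: "nat list \<Rightarrow> nat \<Rightarrow> nat" where
  "parts p i = (if i < length p then p ! i else 0)"

definition part_list :: "(nat \<Rightarrow> nat) \<Rightarrow> nat list" where
  "part_list f = map f [0..<card {i. 0 < f i}]"

lemma diagram_eq_boxes: "diagram p = boxes (parts p)"
proof (intro Set.set_eqI iffI)
  fix b assume "b \<in> diagram p"
  then show "b \<in> boxes (parts p)" by (auto simp: diagram_def boxes_def parts_def)
next
  fix b assume "b \<in> boxes (parts p)"
  then show "b \<in> diagram p" by (auto simp: diagram_def boxes_def parts_def split: if_splits)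
qed

lemma finite_boxes_parts: "finite (boxes (parts p))"
  unfolding boxes_eq_cells
  by (intro finite_imageI finite_cells[of "length p"]) (simp add: parts_def)

lemma antimono_parts: "partition_of n p \<Longrightarrow> antimono (parts p)"
  unfolding antimono_iff_le_Suc
  by (auto simp: parts_def partition_of_def sorted_wrt_iff_nth_less)

text \<open>Padding with zeros hides the length of the list; it is recovered because the parts of a
  partition are positive.\<close>

lemma parts_inj:
  assumes "partition_of n p" "partition_of m q" "parts p = parts q"
  shows "p = q"
proof -
  have le: "length q \<le> length p" if "partition_of m q" "parts p = parts q" for p q m
  proof (rule ccontr)
    assume *: "\<not> length q \<le> length p"
    then have "parts q (length p) > 0"
      using that(1) by (auto simp: parts_def partition_of_def)
    moreover have "parts p (length p) = 0" by (simp add: parts_def)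
    ultimately show False using that(2) by simp
  qed
  have "length p = length q"
    using le[OF assms(2,3)] le[OF assms(1) assms(3)[symmetric]] by simp
  moreover have "p ! i = q ! i" if "i < length p" for i
    using fun_cong[OF assms(3), of i] that \<open>length p = length q\<close> by (simp add: parts_def)
  ultimately show ?thesis by (simp add: nth_equalityI)
qed

lemma
  assumes w: "lattice_word w"
  shows parts_part_list: "parts (part_list (count_list w)) = count_list w"
    and partition_of_part_list: "partition_of (length w) (part_list (count_list w))"
proof -
  define c where "c = card {i. 0 < count_list w i}"
  have am: "antimono (count_list w)" using w by (rule lattice_word_antimono)
  have "0 < count_list w i \<longleftrightarrow> i \<in> set w" for i
    using count_list_0_iff[of w i] by (cases "count_list w i") auto
  then have pos: "{i. 0 < count_list w i} = set w" by simp
  have iff: "0 < count_list w i \<longleftrightarrow> i < c" for i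
    unfolding c_def by (rule antimono_less_iff_card[OF am]) (simp add: pos)
  have "parts (part_list (count_list w)) i = count_list w i" for i
    using iff[of i] by (auto simp: parts_def part_list_def c_def[symmetric])
  then show "parts (part_list (count_list w)) = count_list w" by blast
  have "set w \<subseteq> {..<c}" using iff pos by blast
  then have "(\<Sum>i<c. count_list w i) = length w" by (intro sum_count_set) auto
  then have "sum_list (part_list (count_list w)) = length w"
    by (simp add: part_list_def c_def[symmetric] interv_sum_list_conv_sum_set_nat atLeast0LessThan)
  moreover have "sorted_wrt (\<ge>) (part_list (count_list w))"
    using antimonoD[OF am] by (auto simp: part_list_def sorted_wrt_iff_nth_less)
  moreover have "\<forall>m\<in>set (part_list (count_list w)). 0 < m"
    using iff by (auto simp: part_list_def c_def[symmetric])
  ultimately show "partition_of (length w) (part_list (count_list w))"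
    by (simp add: partition_of_def)
qed

lemma part_list_count_eq_iff:
  assumes "lattice_word w" "partition_of n p"
  shows "part_list (count_list w) = p \<longleftrightarrow> count_list w = parts p"
  using parts_part_list[OF assms(1)] partition_of_part_list[OF assms(1)] parts_inj assms(2) by metis

lemma num_skew_syt_eq:
  assumes "partition_of n p" "partition_of m q" "diagram q \<subseteq> diagram p"
  shows "num_skew_syt p q = card (skew_words (parts q) (parts p))"
  using card_standard_tableaux[OF antimono_parts[OF assms(1)] antimono_parts[OF assms(2)]]
    assms(3) finite_boxes_parts boxes_subset_iff
  by (simp add: num_skew_syt_def diagram_eq_boxes)

lemma num_syt_eq:
  assumes "partition_of n p"
  shows "num_syt p = card (words_of (parts p))"
proof -
  have empty: "diagram [] = {}" by (auto simp: diagram_def)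
  then have "num_syt p = num_skew_syt p []" by (simp add: num_syt_def num_skew_syt_def)
  also have "\<dots> = card (skew_words (parts []) (parts p))"
    by (rule num_skew_syt_eq[OF assms, of 0]) (simp_all add: partition_of_def empty)
  also have "parts [] = (\<lambda>_. 0)" by (simp add: parts_def fun_eq_iff)
  then have "skew_words (parts []) (parts p) = words_of (parts p)"
    by (simp add: skew_words_def words_of_def)
  finally show ?thesis .
qed

text \<open>Counting boxes from 1 instead of 0 shifts row and column alike, so the difference is the
  same.\<close>

lemma sum_content:
  assumes "count_list w = parts p"
  shows "(\<Sum>m<length w. box_content w m) = real_of_int (Diag p)"
proof -
  have "(\<Sum>m<length w. box_content w m) = (\<Sum>(i, j)\<in>cells (parts p). real j - real i)"
    using sum.reindex_bij_betw[OF bij_betw_box[of w], of "\<lambda>(i, j). real j - real i"]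
    by (simp add: box_content_def assms)
  also have "\<dots> = (\<Sum>(i, j)\<in>diagram p. real j - real i)"
    unfolding diagram_eq_boxes boxes_eq_cells
    by (subst sum.reindex) (auto simp: inj_on_def intro!: sum.cong)
  also have "\<dots> = real_of_int (Diag p)"
    by (simp add: Diag_def case_prod_beta)
  finally show ?thesis .
qed

text \<open>The first \<open>n - k\<close> letters form a tableau of shape \<open>q\<close>, so the
  contents of the last \<open>k\<close> boxes add up to the difference of the two diagram
  sums.\<close>

lemma word_eig_eq:
  assumes "length v = n" "count_list v = parts p" "count_list (take (n - k) v) = parts q"
  shows "word_eig n k v = star_eig n k p q"
proof -
  have "box_content v m = box_content (take (n - k) v) m" if "m < n - k" for m
    using box_content_append[of m "take (n - k) v" "drop (n - k) v"] that assms(1) by simp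
  then have "(\<Sum>m<n - k. box_content v m) = real_of_int (Diag q)"
    using sum_content[OF assms(3)] assms(1) by simp
  moreover have "(\<Sum>m<n. box_content v m) = real_of_int (Diag p)"
    using sum_content[OF assms(2)] assms(1) by simp
  moreover have "{..<n} = {..<n - k} \<union> {n - k..<n}" "{..<n - k} \<inter> {n - k..<n} = {}" by auto
  then have "(\<Sum>m<n. box_content v m) = (\<Sum>m<n - k. box_content v m) + (\<Sum>m\<in>{n - k..<n}. box_content v m)"
    by (metis finite_atLeastLessThan finite_lessThan sum.union_disjoint)
  ultimately have "(\<Sum>m\<in>{n - k..<n}. box_content v m) = real_of_int (Diag p - Diag q)" by simp
  then show ?thesis by (simp add: word_eig_def star_eig_def mult_ac)
qed

section \<open>Collecting pairs of words by their shapes\<close>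

lemma sum_const_mset: "finite S \<Longrightarrow> (\<Sum>x\<in>S. {#c#}) = replicate_mset (card S) c"
  by (induction S rule: finite_induct) auto

lemma image_mset_eq_sum: "finite S \<Longrightarrow> image_mset h (mset_set S) = (\<Sum>x\<in>S. {#h x#})"
  by (induction S rule: finite_induct) auto

text \<open>Cutting \<open>v\<close> after \<open>n - k\<close> letters leaves a tableau of shape
  \<open>q\<close> and a skew tableau from \<open>q\<close> to \<open>p\<close>, while
  \<open>u\<close> ranges freely over the tableaux of shape \<open>p\<close>; these are the three
  factors.\<close>

lemma card_shape_fibre:
  assumes pq: "(p, q) \<in> shape_pairs n k" and k: "k \<le> n"
  shows "card {(u, v) \<in> word_pairs n. count_list v = parts p \<and> count_list (take (n - k) v) = parts q}
    = num_syt p * num_syt q * num_skew_syt p q"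
proof -
  have p: "partition_of n p" and q: "partition_of (n - k) q" and sub: "diagram q \<subseteq> diagram p"
    using pq by (auto simp: shape_pairs_def)
  have length_parts: "length w = sum_list r" if "count_list w = parts r" for w r
  proof -
    have "set w \<subseteq> {..<length r}"
    proof
      fix i assume "i \<in> set w"
      then have "parts r i \<noteq> 0" using that by (metis count_list_0_iff)
      then show "i \<in> {..<length r}" by (auto simp: parts_def split: if_splits)
    qed
    then have "length w = (\<Sum>i<length r. parts r i)"
      using sum_count_set[of w "{..<length r}"] that by simp
    also have "\<dots> = sum_list r" by (simp add: sum_list_sum_nth atLeast0LessThan parts_def)
    finally show ?thesis .
  qed
  have len_p: "length w = n" if "count_list w = parts p" for w
    using length_parts[OF that] p by (simp add: partition_of_def)
  have len_q: "length w = n - k" if "count_list w = parts q" for w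
    using length_parts[OF that] q by (simp add: partition_of_def)
  let ?A = "words_of (parts p) \<times> words_of (parts q) \<times> skew_words (parts q) (parts p)"
  have "{(u, v) \<in> word_pairs n. count_list v = parts p \<and> count_list (take (n - k) v) = parts q}
      = (\<lambda>(u, a, b). (u, a @ b)) ` ?A"
  proof (intro Set.set_eqI iffI)
    fix x assume "x \<in> {(u, v) \<in> word_pairs n. count_list v = parts p \<and> count_list (take (n - k) v) = parts q}"
    then obtain u v where x: "x = (u, v)" and u: "lattice_word u" and v: "lattice_word v"
      and uv: "count_list u = count_list v" and vp: "count_list v = parts p"
      and vq: "count_list (take (n - k) v) = parts q"
      by (auto simp: word_pairs_def lattice_words_def)
    define a where "a = take (n - k) v"
    define b where "b = drop (n - k) v"
    have ab: "v = a @ b" by (simp add: a_def b_def)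
    have "lattice_word a" "lattice_from (count_list a) b"
      using v lattice_word_append unfolding ab by blast+
    moreover have "(\<lambda>i. parts q i + count_list b i) = parts p"
      unfolding vp[symmetric] vq[symmetric] a_def[symmetric] by (subst ab) (simp add: fun_eq_iff)
    ultimately have "(u, a, b) \<in> ?A"
      using u uv vp vq by (simp add: words_of_def skew_words_def a_def)
    then show "x \<in> (\<lambda>(u, a, b). (u, a @ b)) ` ?A" using x ab by force
  next
    fix x assume "x \<in> (\<lambda>(u, a, b). (u, a @ b)) ` ?A"
    then obtain u a b where x: "x = (u, a @ b)" and u: "lattice_word u" "count_list u = parts p"
      and a: "lattice_word a" "count_list a = parts q"
      and b: "lattice_from (parts q) b" "(\<lambda>i. parts q i + count_list b i) = parts p"
      by (auto simp: words_of_def skew_words_def)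
    have ab: "lattice_word (a @ b)" using a b by (simp add: lattice_word_append)
    have cab: "count_list (a @ b) = parts p" using a(2) b(2) by (auto simp: fun_eq_iff)
    show "x \<in> {(u, v) \<in> word_pairs n. count_list v = parts p \<and> count_list (take (n - k) v) = parts q}"
      using u ab cab a(2) len_p[OF u(2)] len_p[OF cab] len_q[OF a(2)]
      by (simp add: x word_pairs_def lattice_words_def)
  qed
  moreover have "inj_on (\<lambda>(u, a, b). (u, a @ b)) ?A"
  proof (rule inj_onI)
    fix x y assume xy: "x \<in> ?A" "y \<in> ?A" "(\<lambda>(u, a, b). (u, a @ b)) x = (\<lambda>(u, a, b). (u, a @ b)) y"
    obtain u a b u' a' b' where eq: "x = (u, a, b)" "y = (u', a', b')" by (metis prod_cases3)
    \<comment> \<open>All words of shape \<open>q\<close> have length \<open>n - k\<close>, so the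
      place of the cut in \<open>a @ b\<close> is determined.\<close>
    have "length a = length a'" using xy(1,2) len_q by (simp add: eq words_of_def)
    then show "x = y" using xy(3) by (simp add: eq)
  qed
  ultimately have "card {(u, v) \<in> word_pairs n. count_list v = parts p \<and> count_list (take (n - k) v) = parts q}
      = card ?A" by (simp add: card_image)
  also have "\<dots> = num_syt p * num_syt q * num_skew_syt p q"
    by (simp add: card_cartesian_product num_syt_eq[OF p] num_syt_eq[OF q] num_skew_syt_eq[OF p q sub])
  finally show ?thesis .
qed

theorem theorem1p2:
  fixes n k :: nat and e :: "nat \<Rightarrow> nat \<Rightarrow> nat"
  assumes "n \<ge> 2" and "k \<in> {1..n}"
    and "bij_betw e {..<fact n} {x. x permutes {1..n}}"
  shows "spectrum_mset (star_matrix n k e) =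
    (\<Sum>(p, q)\<in>shape_pairs n k.
      replicate_mset (num_syt p * num_syt q * num_skew_syt p q)
        (complex_of_real (star_eig n k p q)))"
proof -
  have k: "k \<le> n" using assms(2) by simp
  define h where "h = (\<lambda>(u :: nat list, v). complex_of_real (word_eig n k v))"
  \<comment> \<open>The pair of shapes to which a pair of words contributes; the eigenvalue is
    constant on the fibres of \<open>s\<close>, and their sizes are the multiplicities.\<close>
  define s where "s = (\<lambda>(u :: nat list, v). (part_list (count_list v), part_list (count_list (take (n - k) v))))"
  have take: "lattice_word (take m v)" if "lattice_word v" for m v
    using that lattice_word_append[of "take m v" "drop m v"] by simp
  have s_in: "s ` word_pairs n \<subseteq> shape_pairs n k"
  proof
    fix x assume "x \<in> s ` word_pairs n"
    then obtain v where v: "lattice_word v" "length v = n"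
      and x: "x = (part_list (count_list v), part_list (count_list (take (n - k) v)))"
      by (auto simp: s_def word_pairs_def lattice_words_def)
    have "count_list (take (n - k) v) i \<le> count_list v i" for i
      by (metis append_take_drop_id count_list_append le_add1)
    then show "x \<in> shape_pairs n k"
      using partition_of_part_list[OF v(1)] partition_of_part_list[OF take[OF v(1), of "n - k"]] v
      by (simp add: x shape_pairs_def diagram_eq_boxes parts_part_list take boxes_subset_iff)
  qed
  have fibre: "(\<Sum>x\<in>{x \<in> word_pairs n. s x = (p, q)}. {#h x#}) =
      replicate_mset (num_syt p * num_syt q * num_skew_syt p q) (complex_of_real (star_eig n k p q))"
    if pq: "(p, q) \<in> shape_pairs n k" for p q
  proof -
    have p: "partition_of n p" and q: "partition_of (n - k) q"
      using pq by (auto simp: shape_pairs_def)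
    have eq: "{x \<in> word_pairs n. s x = (p, q)} =
        {(u, v) \<in> word_pairs n. count_list v = parts p \<and> count_list (take (n - k) v) = parts q}"
      using part_list_count_eq_iff[OF _ p] part_list_count_eq_iff[OF take q]
      by (auto simp: s_def word_pairs_def lattice_words_def)
    have "(\<Sum>x\<in>{x \<in> word_pairs n. s x = (p, q)}. {#h x#}) =
        (\<Sum>x\<in>{x \<in> word_pairs n. s x = (p, q)}. {#complex_of_real (star_eig n k p q)#})"
      unfolding eq
      by (intro sum.cong refl) (auto simp: h_def word_pairs_def lattice_words_def word_eig_eq)
    also have "\<dots> = replicate_mset (card {x \<in> word_pairs n. s x = (p, q)})
        (complex_of_real (star_eig n k p q))"
      by (rule sum_const_mset) (simp add: finite_word_pairs)
    finally show ?thesis unfolding eq card_shape_fibre[OF pq k] .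
  qed
  have "spectrum_mset (star_matrix n k e) = image_mset h (mset_set (word_pairs n))"
    using regular_rep.spectrum_star_matrix[OF k assms(3)] by (simp add: h_def)
  also have "\<dots> = (\<Sum>x\<in>word_pairs n. {#h x#})"
    by (rule image_mset_eq_sum[OF finite_word_pairs])
  also have "\<dots> = (\<Sum>y\<in>shape_pairs n k. \<Sum>x\<in>{x \<in> word_pairs n. s x = y}. {#h x#})"
    by (rule sum.group[OF finite_word_pairs finite_shape_pairs s_in, symmetric])
  also have "\<dots> = (\<Sum>(p, q)\<in>shape_pairs n k.
      replicate_mset (num_syt p * num_syt q * num_skew_syt p q) (complex_of_real (star_eig n k p q)))"
    by (intro sum.cong refl) (auto simp: fibre)
  finally show ?thesis .
qed

end
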